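(* Let $(G,\chi)$ be a $k$-coloured graph with $G=(V,E)$, and let $(G,\chi,p)$ be a generic framework on $r\mathbb{S}^1$ (so $d=1$). Then $(G,\chi,p)$ is isostatic if and only if the following two conditions hold: (1) $|E|=|V|-1+\min\{k,|V|-2\}$; and (2) $|F|\leq |V|-\omega(F)+\min\{k(F),|V(F)|-2\}$ for every nonempty $F\subseteq E$.
   Context: $G=(V,E)$ is a finite simple graph with $V=\{1,\dots,n\}$. A colouring is a map $\chi:V\to\mathcal{C}\cup\{\bullet\}$, where $\mathcal{C}$ is a set of colours and $\chi(v)=\bullet$ means that $v$ is uncoloured; every colour of $\mathcal{C}$ is used. $(G,\chi)$ is $k$-coloured if $|\mathcal{C}|=k$ ($\bullet$ is not counted). Given $r:\mathcal{C}\to\mathbb{R}_{>0}$, a framework $(G,\chi,p)$ on $r\mathbb{S}^d$ is given by a map $p:V\to\mathbb{R}^{d+1}$ such that $\|p(v)\|=r(\chi(v))$ for every coloured $v$ and $\|p(v)\|=1$ for every uncoloured $v$. It is generic if the coordinates of $p$ and $r$ satisfy no nonzero polynomial with rational coefficients except those in the ideal generated by the defining polynomials $p(v)\cdot p(v)-r(\chi(v))^2$ ($v$ coloured) and $p(v)\cdot p(v)-1$ ($v$ uncoloured). The rigidity matrix $R(G,\chi,p)$ is the $(|E|+n)\times((d+1)n+k)$ matrix of the following linear system in unknowns $\dot p:V\to\mathbb{R}^{d+1}$, $\dot r:\mathcal{C}\to\mathbb{R}$ (with $\dot r(\bullet)=0$): $(p(u)-p(v))\cdot(\dot p(u)-\dot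 p(v))=0$ for $uv\in E$, and $p(v)\cdot\dot p(v)=\dot r(\chi(v))$ for $v\in V$ (one row per edge and one row per vertex). $(G,\chi,p)$ is infinitesimally rigid if $\mathrm{rank}\,R(G,\chi,p)=(d+1)n-\binom{d+1}{2}+\min\{k,n-(d+1)\}$; it is independent if the rows of $R(G,\chi,p)$ are linearly independent; it is isostatic if it is independent and infinitesimally rigid. For $F\subseteq E$: $V(F)$ is the set of endvertices of edges in $F$, $k(F)$ is the number of colours in $\mathcal{C}$ appearing on $V(F)$, and $\omega(F)$ is the number of connected components of the graph $(V,F)$. *)

theory Defs
  imports "HOL-Analysis.Analysis" "HOL-Library.Poly_Mapping" "HOL-Library.Function_Algebras"
begin

subsection \<open>Coloured graphs\<close>

definition simple_graph :: "'v set \<Rightarrow> 'v set set \<Rightarrow> bool" where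
  "simple_graph V E \<longleftrightarrow> finite V \<and> (\<forall>e\<in>E. e \<subseteq> V \<and> card e = 2)"

text \<open>\<open>\<kappa> v = None\<close> means that \<open>v\<close> is uncoloured; every colour of \<open>C\<close> is used.\<close>

definition colouring :: "'v set \<Rightarrow> 'c set \<Rightarrow> ('v \<Rightarrow> 'c option) \<Rightarrow> bool" where
  "colouring V C \<kappa> \<longleftrightarrow> \<kappa> ` V \<subseteq> insert None (Some ` C) \<and> Some ` C \<subseteq> \<kappa> ` V"

definition k_coloured_graph ::
    "nat \<Rightarrow> 'v set \<Rightarrow> 'v set set \<Rightarrow> 'c set \<Rightarrow> ('v \<Rightarrow> 'c option) \<Rightarrow> bool" where
  "k_coloured_graph k V E C \<kappa> \<longleftrightarrow>
     simple_graph V E \<and> finite C \<and> colouring V C \<kappa> \<and> card C = k"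

definition edge_verts :: "'v set set \<Rightarrow> 'v set" where
  "edge_verts F = \<Union> F"

definition edge_colours :: "'c set \<Rightarrow> ('v \<Rightarrow> 'c option) \<Rightarrow> 'v set set \<Rightarrow> 'c set" where
  "edge_colours C \<kappa> F = {c \<in> C. \<exists>v\<in>edge_verts F. \<kappa> v = Some c}"

definition graph_components :: "'v set \<Rightarrow> 'v set set \<Rightarrow> 'v set set" where
  "graph_components V F = V // {(u, v). u \<in> V \<and> v \<in> V \<and> (u, v) \<in> {(x, y). {x, y} \<in> F}\<^sup>*}"


subsection \<open>Frameworks\<close>

text \<open>The index type \<open>'m\<close> of the ambient space plays the role of \<open>d + 1 = CARD('m)\<close>.\<close>

definition framework ::
    "'v set \<Rightarrow> 'c set \<Rightarrow> ('v \<Rightarrow> 'c option) \<Rightarrow> ('c \<Rightarrow> real) \<Rightarrow> ('v \<Rightarrow> real ^ 'm) \<Rightarrow> bool" where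
  "framework V C \<kappa> r p \<longleftrightarrow>
     (\<forall>c\<in>C. r c > 0) \<and>
     (\<forall>v\<in>V. norm (p v) = (case \<kappa> v of None \<Rightarrow> 1 | Some c \<Rightarrow> r c))"

text \<open>
  \<open>Inl (v, i)\<close> stands for the \<open>i\<close>-th coordinate of the vertex \<open>v\<close> and \<open>Inr c\<close> for the
  radius of the colour \<open>c\<close>. These indices serve both as polynomial variables and as columns of the
  rigidity matrix.
\<close>

type_synonym ('v, 'm, 'c) var = "'v \<times> 'm + 'c"

definition coords :: "'v set \<Rightarrow> 'c set \<Rightarrow> ('v, 'm, 'c) var set" where
  "coords V C = Inl ` (V \<times> UNIV) \<union> Inr ` C"

definition config :: "('v \<Rightarrow> real ^ 'm) \<Rightarrow> ('c \<Rightarrow> real) \<Rightarrow> ('v, 'm, 'c) var \<Rightarrow> real" where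
  "config p r = case_sum (\<lambda>(v, i). p v $ i) r"


subsection \<open>Generic frameworks\<close>

text \<open>
  Multivariate polynomials with rational coefficients: a monomial is a finitely supported map from
  variables to exponents, a polynomial a finitely supported map from monomials to coefficients.
  The ring operations are those of \<^theory>\<open>HOL-Library.Poly_Mapping\<close>.
\<close>

type_synonym 'x mpoly_rat = "('x \<Rightarrow>\<^sub>0 nat) \<Rightarrow>\<^sub>0 rat"

definition poly_ring :: "'x set \<Rightarrow> 'x mpoly_rat set" where
  "poly_ring X = {P. \<forall>m\<in>Poly_Mapping.keys P. Poly_Mapping.keys m \<subseteq> X}"

definition poly_var :: "'x \<Rightarrow> 'x mpoly_rat" where
  "poly_var x = Poly_Mapping.single (Poly_Mapping.single x 1) 1"

definition poly_value :: "('x \<Rightarrow> real) \<Rightarrow> 'x mpoly_rat \<Rightarrow> real" where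
  "poly_value a P =
     (\<Sum>m\<in>Poly_Mapping.keys P. of_rat (Poly_Mapping.lookup P m) *
        (\<Prod>x\<in>Poly_Mapping.keys m. a x ^ Poly_Mapping.lookup m x))"

definition sphere_poly :: "('v \<Rightarrow> 'c option) \<Rightarrow> 'v \<Rightarrow> ('v, 'm::finite, 'c) var mpoly_rat" where
  "sphere_poly \<kappa> v =
     (\<Sum>i\<in>UNIV. poly_var (Inl (v, i)) ^ 2) -
     (case \<kappa> v of None \<Rightarrow> 1 | Some c \<Rightarrow> poly_var (Inr c) ^ 2)"

definition sphere_ideal ::
    "'v set \<Rightarrow> 'c set \<Rightarrow> ('v \<Rightarrow> 'c option) \<Rightarrow> ('v, 'm::finite, 'c) var mpoly_rat set" where
  "sphere_ideal V C \<kappa> =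
     {(\<Sum>v\<in>V. q v * sphere_poly \<kappa> v) | q. \<forall>v\<in>V. q v \<in> poly_ring (coords V C)}"

definition generic ::
    "'v set \<Rightarrow> 'c set \<Rightarrow> ('v \<Rightarrow> 'c option) \<Rightarrow> ('c \<Rightarrow> real) \<Rightarrow> ('v \<Rightarrow> real ^ 'm) \<Rightarrow> bool" where
  "generic V C \<kappa> r p \<longleftrightarrow>
     (\<forall>P\<in>poly_ring (coords V C). P \<noteq> 0 \<and> poly_value (config p r) P = 0 \<longrightarrow> P \<in> sphere_ideal V C \<kappa>)"


subsection \<open>Matrices over arbitrary finite index sets\<close>

text \<open>
  A matrix with row index set \<open>I\<close> and column index set \<open>J\<close> is a function
  \<open>A :: 'i \<Rightarrow> 'j \<Rightarrow> real\<close>, of which only the entries in \<open>I \<times> J\<close> matter. Its rows are regarded as elements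
  of the real vector space \<open>'j \<Rightarrow> real\<close>, extended by zero outside \<open>J\<close>.
\<close>

definition fun_scale :: "real \<Rightarrow> ('j \<Rightarrow> real) \<Rightarrow> 'j \<Rightarrow> real" where
  "fun_scale a f = (\<lambda>j. a * f j)"

interpretation fun_space: vector_space fun_scale
  by unfold_locales (auto simp: fun_scale_def fun_eq_iff algebra_simps)

definition matrix_row :: "'j set \<Rightarrow> ('i \<Rightarrow> 'j \<Rightarrow> real) \<Rightarrow> 'i \<Rightarrow> 'j \<Rightarrow> real" where
  "matrix_row J A i = (\<lambda>j. if j \<in> J then A i j else 0)"

definition matrix_rank :: "'i set \<Rightarrow> 'j set \<Rightarrow> ('i \<Rightarrow> 'j \<Rightarrow> real) \<Rightarrow> nat" where
  "matrix_rank I J A = fun_space.dim (matrix_row J A ` I)"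

text \<open>Injectivity is needed since two equal rows are linearly dependent.\<close>

definition rows_independent :: "'i set \<Rightarrow> 'j set \<Rightarrow> ('i \<Rightarrow> 'j \<Rightarrow> real) \<Rightarrow> bool" where
  "rows_independent I J A \<longleftrightarrow>
     inj_on (matrix_row J A) I \<and> fun_space.independent (matrix_row J A ` I)"


subsection \<open>The rigidity matrix\<close>

text \<open>
  Rows: \<open>Inl e\<close> for an edge \<open>e\<close>, \<open>Inr v\<close> for a vertex \<open>v\<close>. The lemmas below show that these are the
  rows of the system \<open>(p u - p v) \<bullet> (p' u - p' v) = 0\<close>, \<open>p v \<bullet> p' v - r' (\<kappa> v) = 0\<close>.
\<close>

definition rigidity_rows :: "'v set \<Rightarrow> 'v set set \<Rightarrow> ('v set + 'v) set" where
  "rigidity_rows V E = Inl ` E \<union> Inr ` V"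

fun rigidity_matrix ::
    "('v \<Rightarrow> 'c option) \<Rightarrow> ('v \<Rightarrow> real ^ 'm) \<Rightarrow> 'v set + 'v \<Rightarrow> ('v, 'm, 'c) var \<Rightarrow> real" where
  "rigidity_matrix \<kappa> p (Inl e) (Inl (w, i)) =
     (if w \<in> e then (p w - p (the_elem (e - {w}))) $ i else 0)"
| "rigidity_matrix \<kappa> p (Inl e) (Inr c) = 0"
| "rigidity_matrix \<kappa> p (Inr v) (Inl (w, i)) = (if w = v then p v $ i else 0)"
| "rigidity_matrix \<kappa> p (Inr v) (Inr c) = (if \<kappa> v = Some c then - 1 else 0)"

lemma sum_coords:
  fixes f :: "('v, 'm::finite, 'c) var \<Rightarrow> real"
  assumes "finite V" "finite C"
  shows "(\<Sum>j\<in>coords V C. f j) =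
    (\<Sum>w\<in>V. \<Sum>i\<in>UNIV. f (Inl (w, i))) + (\<Sum>c\<in>C. f (Inr c))"
proof -
  have "(\<Sum>j\<in>coords V C. f j) =
    (\<Sum>j\<in>Inl ` (V \<times> UNIV). f j) + (\<Sum>j\<in>Inr ` C. f j)"
    unfolding coords_def using assms by (intro sum.union_disjoint) auto
  then show ?thesis
    by (simp add: sum.reindex sum.cartesian_product case_prod_beta)
qed

lemma rigidity_matrix_edge_row:
  fixes p p' :: "'v \<Rightarrow> real ^ 'm" and r' :: "'c \<Rightarrow> real"
  assumes "finite V" "finite C" "u \<in> V" "v \<in> V" "u \<noteq> v"
  shows "(\<Sum>j\<in>coords V C. rigidity_matrix \<kappa> p (Inl {u, v}) j * config p' r' j) =
    (p u - p v) \<bullet> (p' u - p' v)"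
proof -
  have [simp]: "{u, v} - {u} = {v}" "{u, v} - {v} = {u}" using assms by auto
  have "(\<Sum>j\<in>coords V C. rigidity_matrix \<kappa> p (Inl {u, v}) j * config p' r' j) =
    (\<Sum>w\<in>V. if w \<in> {u, v} then (p w - p (the_elem ({u, v} - {w}))) \<bullet> p' w else 0)"
    using assms by (simp add: sum_coords config_def inner_vec_def if_distrib cong: if_cong)
      (intro sum.cong, auto)
  also have "\<dots> = (\<Sum>w\<in>{u, v}. (p w - p (the_elem ({u, v} - {w}))) \<bullet> p' w)"
    using assms by (intro sum.mono_neutral_cong_right) auto
  also have "\<dots> = (p u - p v) \<bullet> (p' u - p' v)"
    using assms by (simp add: algebra_simps)
  finally show ?thesis .
qed

lemma rigidity_matrix_vertex_row:
  fixes p p' :: "'v \<Rightarrow> real ^ 'm" and r' :: "'c \<Rightarrow> real"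
  assumes "finite V" "finite C" "colouring V C \<kappa>" "v \<in> V"
  shows "(\<Sum>j\<in>coords V C. rigidity_matrix \<kappa> p (Inr v) j * config p' r' j) =
    p v \<bullet> p' v - (case \<kappa> v of None \<Rightarrow> 0 | Some c \<Rightarrow> r' c)"
proof -
  have "(\<Sum>w\<in>V. \<Sum>i\<in>UNIV. rigidity_matrix \<kappa> p (Inr v) (Inl (w, i)) * config p' r' (Inl (w, i))) =
    (\<Sum>w\<in>V. if w = v then p v \<bullet> p' v else 0)"
    by (intro sum.cong) (auto simp: config_def inner_vec_def)
  moreover have "(\<Sum>c\<in>C. rigidity_matrix \<kappa> p (Inr v) (Inr c) * config p' r' (Inr c)) =
    (\<Sum>c\<in>C. if \<kappa> v = Some c then - r' c else 0)"
    by (intro sum.cong) (auto simp: config_def)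
  moreover have "\<dots> = - (case \<kappa> v of None \<Rightarrow> 0 | Some c \<Rightarrow> r' c)"
    using assms by (auto simp: colouring_def split: option.split)
  ultimately show ?thesis
    using assms by (simp add: sum_coords)
qed

definition infinitesimally_rigid ::
    "'v set \<Rightarrow> 'v set set \<Rightarrow> 'c set \<Rightarrow> ('v \<Rightarrow> 'c option) \<Rightarrow> ('v \<Rightarrow> real ^ 'm) \<Rightarrow> bool" where
  "infinitesimally_rigid V E C \<kappa> p \<longleftrightarrow>
     int (matrix_rank (rigidity_rows V E) (coords V C) (rigidity_matrix \<kappa> p)) =
       int CARD('m) * int (card V) - int (CARD('m) choose 2) +
       min (int (card C)) (int (card V) - int CARD('m))"

definition independent_framework ::
    "'v set \<Rightarrow> 'v set set \<Rightarrow> 'c set \<Rightarrow> ('v \<Rightarrow> 'c option) \<Rightarrow> ('v \<Rightarrow> real ^ 'm) \<Rightarrow> bool" where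
  "independent_framework V E C \<kappa> p \<longleftrightarrow>
     rows_independent (rigidity_rows V E) (coords V C) (rigidity_matrix \<kappa> p)"

definition isostatic ::
    "'v set \<Rightarrow> 'v set set \<Rightarrow> 'c set \<Rightarrow> ('v \<Rightarrow> 'c option) \<Rightarrow> ('v \<Rightarrow> real ^ 'm) \<Rightarrow> bool" where
  "isostatic V E C \<kappa> p \<longleftrightarrow> independent_framework V E C \<kappa> p \<and> infinitesimally_rigid V E C \<kappa> p"

end

(*
  In polar coordinates, with angles theta and radii rho, the vertex rows of the rigidity matrix can be
  eliminated; what remains is one linear equation per edge in an angular velocity for each vertex and
  a radial velocity for each colour. The rows are independent iff this system is solvable for every
  right-hand side.

  Necessity is a dimension count: solutions can be normalised by rotating each connected component
  and, after giving every vertex its own colour, by translating the plane.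

  Sufficiency. By a Rado-type exchange argument condition (2) provides a set D of differently coloured
  vertices such that |F| <= |V| - omega(F) + |D Int V(F)| for all F. Together with |F| <= 2|V(F)| - 3
  this says that the cone graph, obtained from G by joining a new vertex z (the centre of the circles)
  to all vertices outside D, is Laman sparse. A solvable position is then built by induction on |V|. A
  degree count yields a vertex v of degree at most 2, or of degree 3 that is the only one of its
  colour. Removing v and, as in Henneberg's 1-extension, adding an edge between two neighbours of v in
  the cone graph preserves sparsity; an added edge az means that the colour of a is merged with the
  colour of v. Conversely v can be put back in a special position: on the line through a and b, or
  close to a, or on the ray through a.

  Solvability is the nonvanishing of a Gram determinant. This is a polynomial with rational
  coefficients, so one solvable position makes every generic framework independent; being analytic
  along lines, it also makes solvable positions dense, which supplies the general position needed in
  the induction.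
*)

theory Submission
  imports Defs "Jordan_Normal_Form.Determinant" "HOL-Complex_Analysis.Conformal_Mappings"
begin

section \<open>Full row rank and Gram determinants\<close>

text \<open>In the cone count an edge at the centre stands for a frozen radius, while each vertex of
  \<open>D\<close> keeps a radial freedom of its own. The obstacle is that radii belong to colours,
  not to vertices: a vertex that is put back can in general not leave its circle, so its special
  position has to suit the colours of its neighbours. Sparsity of the cone depends on the colouring
  only through \<open>D\<close>, and \<open>D\<close> merely has to meet no colour twice and to
  avoid uncoloured vertices. Hence the induction runs over all such colourings, and a colour not
  carried by \<open>D\<close> may be merged or erased. The minimum in (2) is used as two
  inequalities. Since omega(F) is at least |V| - |V(F)| + 1, the one with |V(F)| - 2 yields |F|
  \<le> 2|V(F)| - 3; the one with k(F) feeds the exchange argument. Condition (1) only compares the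
  rank |E| + |V| of an independent framework with the required one. The determinant of A A^T is used
  instead of minors of A because it is a single polynomial whose real zeros are exactly the
  positions with dependent rows.\<close>

definition full_row_rank :: "'i set \<Rightarrow> 'j set \<Rightarrow> ('i \<Rightarrow> 'j \<Rightarrow> real) \<Rightarrow> bool" where
  "full_row_rank I J A \<longleftrightarrow> (\<forall>b. \<exists>x. \<forall>i\<in>I. (\<Sum>j\<in>J. A i j * x j) = b i)"

text \<open>Injectivity of the transpose. Stated by coefficients, so that two equal rows count as
  dependent.\<close>

definition row_injective :: "'i set \<Rightarrow> 'j set \<Rightarrow> ('i \<Rightarrow> 'j \<Rightarrow> real) \<Rightarrow> bool" where
  "row_injective I J A \<longleftrightarrow> (\<forall>y. (\<forall>j\<in>J. (\<Sum>i\<in>I. y i * A i j) = 0) \<longrightarrow> (\<forall>i\<in>I. y i = 0))"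

text \<open>Bridges arbitrary row sets and matrices indexed by natural numbers; any numbering
  serves.\<close>

definition enumeration :: "'i set \<Rightarrow> nat \<Rightarrow> 'i" where
  "enumeration I = (SOME e. bij_betw e {0..<card I} I)"

text \<open>This is A A^T, without conjugation, so that its determinant is holomorphic in complex
  parameters. The ring is arbitrary: reals for the rank, complex numbers for analyticity, rational
  polynomials for genericity.\<close>

definition gram_mat :: "'i set \<Rightarrow> 'j set \<Rightarrow> ('i \<Rightarrow> 'j \<Rightarrow> 'a::comm_ring_1) \<Rightarrow> 'a mat" where
  "gram_mat I J A = mat (card I) (card I)
     (\<lambda>(i, k). \<Sum>j\<in>J. A (enumeration I i) j * A (enumeration I k) j)"

definition gram_det :: "'i set \<Rightarrow> 'j set \<Rightarrow> ('i \<Rightarrow> 'j \<Rightarrow> 'a::comm_ring_1) \<Rightarrow> 'a" where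
  "gram_det I J A = Determinant.det (gram_mat I J A)"

lemma bij_betw_enumeration: "finite I \<Longrightarrow> bij_betw (enumeration I) {0..<card I} I"
  unfolding enumeration_def by (rule someI_ex[OF ex_bij_betw_nat_finite])

lemma enumeration_in: "finite I \<Longrightarrow> i < card I \<Longrightarrow> enumeration I i \<in> I"
  using bij_betw_enumeration[of I] by (auto simp: bij_betw_def)

lemma permutes_less: "\<pi> permutes {0..<n::nat} \<Longrightarrow> i < n \<Longrightarrow> \<pi> i < n"
  using permutes_in_image[of \<pi> "{0..<n}" i] by simp

lemma enumeration_cases:
  assumes "finite I" "i \<in> I"
  obtains l where "l < card I" "i = enumeration I l"
proof -
  have "i \<in> enumeration I ` {0..<card I}"
    using bij_betw_enumeration[OF assms(1)] assms(2) by (simp add: bij_betw_def)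
  then show thesis using that by auto
qed

lemma gram_mat_carrier: "gram_mat I J A \<in> carrier_mat (card I) (card I)"
  by (simp add: gram_mat_def)

lemma gram_det_expand:
  "gram_det I J A = (\<Sum>\<pi> | \<pi> permutes {0..<card I}. signof \<pi> *
     (\<Prod>i = 0..<card I. \<Sum>j\<in>J. A (enumeration I i) j * A (enumeration I (\<pi> i)) j))"
  unfolding gram_det_def det_def'[OF gram_mat_carrier]
proof (intro sum.cong refl arg_cong2[where f = "(*)"] prod.cong)
  fix \<pi> i assume "\<pi> \<in> {\<pi>. \<pi> permutes {0..<card I}}" "i \<in> {0..<card I}"
  then have "i < card I" "\<pi> i < card I" using permutes_less by auto
  then show "gram_mat I J A $$ (i, \<pi> i) =
      (\<Sum>j\<in>J. A (enumeration I i) j * A (enumeration I (\<pi> i)) j)"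
    by (simp add: gram_mat_def)
qed

text \<open>If A A^T y = 0, then |A^T y|^2 = y . A A^T y = 0. Positivity of real squares is
  essential here.\<close>

lemma gram_mat_kernel:
  fixes A :: "'i \<Rightarrow> 'j \<Rightarrow> real"
  assumes "finite I" "finite J" "row_injective I J A"
    and v: "v \<in> carrier_vec (card I)" "gram_mat I J A *\<^sub>v v = 0\<^sub>v (card I)"
  shows "v = 0\<^sub>v (card I)"
proof -
  let ?n = "card I"
  note bij = bij_betw_enumeration[OF \<open>finite I\<close>]
  define y where "y i = vec_index v (the_inv_into {0..<?n} (enumeration I) i)" for i
  have y: "y (enumeration I k) = vec_index v k" if "k < ?n" for k
    unfolding y_def using bij that by (subst the_inv_into_f_f) (auto simp: bij_betw_def)
  have reindex: "(\<Sum>i\<in>I. f i) = (\<Sum>k\<in>{0..<?n}. f (enumeration I k))" for f :: "'i \<Rightarrow> real"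
    using sum.reindex_bij_betw[OF bij, of f] by simp
  have G: "(\<Sum>k\<in>I. (\<Sum>j\<in>J. A i j * A k j) * y k) = 0" if "i \<in> I" for i
  proof -
    obtain l where l: "l < ?n" "i = enumeration I l"
      using enumeration_cases[OF assms(1) \<open>i \<in> I\<close>] .
    have "vec_index (gram_mat I J A *\<^sub>v v) l = 0" using v l by simp
    then have "(\<Sum>k\<in>{0..<?n}. gram_mat I J A $$ (l, k) * vec_index v k) = 0"
      using l v(1) by (simp add: mult_mat_vec_def scalar_prod_def gram_mat_def)
    moreover have "(\<Sum>k\<in>{0..<?n}. gram_mat I J A $$ (l, k) * vec_index v k) =
        (\<Sum>k\<in>{0..<?n}. (\<Sum>j\<in>J. A i j * A (enumeration I k) j) * y (enumeration I k))"
      using l by (intro sum.cong) (auto simp: gram_mat_def y)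
    ultimately show ?thesis by (simp add: reindex)
  qed
  have "(\<Sum>j\<in>J. (\<Sum>i\<in>I. y i * A i j)\<^sup>2) = (\<Sum>j\<in>J. \<Sum>i\<in>I. \<Sum>k\<in>I. y i * A i j * (y k * A k j))"
    by (simp add: power2_eq_square sum_product)
  also have "\<dots> = (\<Sum>i\<in>I. \<Sum>j\<in>J. \<Sum>k\<in>I. y i * A i j * (y k * A k j))"
    by (rule sum.swap)
  also have "\<dots> = (\<Sum>i\<in>I. \<Sum>k\<in>I. \<Sum>j\<in>J. y i * A i j * (y k * A k j))"
    by (intro sum.cong refl sum.swap)
  also have "\<dots> = (\<Sum>i\<in>I. y i * (\<Sum>k\<in>I. (\<Sum>j\<in>J. A i j * A k j) * y k))"
    by (simp add: sum_distrib_left sum_distrib_right algebra_simps)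
  also have "\<dots> = 0" using G by simp
  finally have "\<forall>j\<in>J. (\<Sum>i\<in>I. y i * A i j) = 0"
    using \<open>finite J\<close> by (simp add: sum_nonneg_eq_0_iff)
  with \<open>row_injective I J A\<close> have "\<forall>i\<in>I. y i = 0" unfolding row_injective_def by blast
  then have "vec_index v k = 0" if "k < ?n" for k
    using y[OF that] bij_betwE[OF bij] that by (metis atLeastLessThan_iff le0)
  then show ?thesis using v(1) by (intro eq_vecI) auto
qed

text \<open>Solve A x = y for the relation y itself: then |y|^2 = y . A x = 0.\<close>

lemma full_row_rank_imp_row_injective:
  assumes "finite I" "full_row_rank I J A"
  shows "row_injective I J A"
  unfolding row_injective_def
proof (intro allI impI)
  fix y assume y: "\<forall>j\<in>J. (\<Sum>i\<in>I. y i * A i j) = 0"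
  from assms(2) obtain x where x: "\<And>i. i \<in> I \<Longrightarrow> (\<Sum>j\<in>J. A i j * x j) = y i"
    unfolding full_row_rank_def by metis
  have "(\<Sum>i\<in>I. (y i)\<^sup>2) = (\<Sum>i\<in>I. y i * (\<Sum>j\<in>J. A i j * x j))"
    using x by (simp add: power2_eq_square)
  also have "\<dots> = (\<Sum>i\<in>I. \<Sum>j\<in>J. y i * A i j * x j)"
    by (simp add: sum_distrib_left mult.assoc)
  also have "\<dots> = (\<Sum>j\<in>J. \<Sum>i\<in>I. y i * A i j * x j)"
    by (rule sum.swap)
  also have "\<dots> = 0" using y by (simp flip: sum_distrib_right)
  finally show "\<forall>i\<in>I. y i = 0"
    using assms(1) by (simp add: sum_nonneg_eq_0_iff)
qed

lemma row_injective_imp_gram_det: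
  fixes A :: "'i \<Rightarrow> 'j \<Rightarrow> real"
  assumes "finite I" "finite J" "row_injective I J A"
  shows "gram_det I J A \<noteq> 0"
proof
  assume "gram_det I J A = 0"
  then obtain v where "v \<in> carrier_vec (card I)" "v \<noteq> 0\<^sub>v (card I)"
      "gram_mat I J A *\<^sub>v v = 0\<^sub>v (card I)"
    unfolding gram_det_def det_0_iff_vec_prod_zero_field[OF gram_mat_carrier] by blast
  then show False using gram_mat_kernel[OF assms] by blast
qed

text \<open>A^T (A A^T)^-1 is a right inverse of A; below, \<open>z\<close> is (A A^T)^-1 b and
  \<open>x\<close> is A^T z.\<close>

lemma gram_det_imp_full_row_rank:
  fixes A :: "'i \<Rightarrow> 'j \<Rightarrow> real"
  assumes "finite I" "gram_det I J A \<noteq> 0"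
  shows "full_row_rank I J A"
  unfolding full_row_rank_def
proof
  fix b :: "'i \<Rightarrow> real"
  let ?n = "card I" and ?G = "gram_mat I J A"
  note bij = bij_betw_enumeration[OF \<open>finite I\<close>]
  have "?G \<in> Units (ring_mat TYPE(real) ?n ())"
    using assms(2) unfolding gram_det_def by (rule det_non_zero_imp_unit[OF gram_mat_carrier])
  then obtain B where B: "B \<in> carrier_mat ?n ?n" "?G * B = 1\<^sub>m ?n"
    unfolding Units_def by (auto simp: ring_mat_simps)
  define w where "w = Matrix.vec ?n (\<lambda>k. b (enumeration I k))"
  define z where "z = B *\<^sub>v w"
  have z: "z \<in> carrier_vec ?n" using B(1) by (simp add: z_def w_def)
  have "?G *\<^sub>v z = w"
    using B gram_mat_carrier[of I J A] assoc_mult_mat_vec[of ?G ?n ?n B ?n w]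
    by (simp add: z_def w_def)
  then have G: "(\<Sum>k\<in>{0..<?n}. ?G $$ (l, k) * vec_index z k) = b (enumeration I l)" if "l < ?n" for l
    using that z by (auto simp: w_def mult_mat_vec_def scalar_prod_def gram_mat_def dest!: arg_cong[where f = "\<lambda>u. vec_index u l"])
  define x where "x j = (\<Sum>k\<in>{0..<?n}. A (enumeration I k) j * vec_index z k)" for j
  have "(\<Sum>j\<in>J. A i j * x j) = b i" if "i \<in> I" for i
  proof -
    obtain l where l: "l < ?n" "i = enumeration I l"
      using enumeration_cases[OF assms(1) \<open>i \<in> I\<close>] .
    have "(\<Sum>j\<in>J. A i j * x j) = (\<Sum>j\<in>J. \<Sum>k\<in>{0..<?n}. A i j * A (enumeration I k) j * vec_index z k)"
      by (simp add: x_def sum_distrib_left mult.assoc)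
    also have "\<dots> = (\<Sum>k\<in>{0..<?n}. \<Sum>j\<in>J. A i j * A (enumeration I k) j * vec_index z k)"
      by (rule sum.swap)
    also have "\<dots> = (\<Sum>k\<in>{0..<?n}. ?G $$ (l, k) * vec_index z k)"
      using l by (intro sum.cong) (auto simp: gram_mat_def sum_distrib_right)
    also have "\<dots> = b i" using G l by simp
    finally show ?thesis .
  qed
  then show "\<exists>x. \<forall>i\<in>I. (\<Sum>j\<in>J. A i j * x j) = b i" by blast
qed

lemma full_row_rank_iff_gram_det:
  fixes A :: "'i \<Rightarrow> 'j \<Rightarrow> real"
  assumes "finite I" "finite J"
  shows "full_row_rank I J A \<longleftrightarrow> gram_det I J A \<noteq> 0"
  using full_row_rank_imp_row_injective[of I J A] row_injective_imp_gram_det[of I J A]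
    gram_det_imp_full_row_rank[of I J A] assms by argo

lemma full_row_rank_iff_row_injective:
  assumes "finite I" "finite J"
  shows "full_row_rank I J A \<longleftrightarrow> row_injective I J A"
  using full_row_rank_imp_row_injective[of I J A] row_injective_imp_gram_det[of I J A]
    gram_det_imp_full_row_rank[of I J A] assms by argo

lemma sum_matrix_row:
  "(\<Sum>i\<in>I. fun_scale (y i) (matrix_row J A i)) = (\<lambda>j. if j \<in> J then \<Sum>i\<in>I. y i * A i j else 0)"
  by (induction I rule: infinite_finite_induct) (auto simp: fun_eq_iff fun_scale_def matrix_row_def zero_fun_def)

lemma rows_independent_iff_row_injective:
  assumes "finite I"
  shows "rows_independent I J A \<longleftrightarrow> row_injective I J A"
proof
  assume ind: "rows_independent I J A"
  note inj = conjunct1[OF ind[unfolded rows_independent_def]]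
  note ind' = conjunct2[OF ind[unfolded rows_independent_def]]
  show "row_injective I J A"
    unfolding row_injective_def
  proof (intro allI impI ballI)
    fix y i assume y: "\<forall>j\<in>J. (\<Sum>i\<in>I. y i * A i j) = 0" and i: "i \<in> I"
    define u where "u f = y (the_inv_into I (matrix_row J A) f)" for f
    have u: "u (matrix_row J A i) = y i" if "i \<in> I" for i
      using that inj by (simp add: u_def the_inv_into_f_f)
    have "(\<Sum>f\<in>matrix_row J A ` I. fun_scale (u f) f) = (\<Sum>i\<in>I. fun_scale (y i) (matrix_row J A i))"
      using inj u by (simp add: sum.reindex)
    also have "\<dots> = 0" using y by (auto simp: sum_matrix_row fun_eq_iff zero_fun_def)
    finally have "u (matrix_row J A i) = 0"
      using fun_space.independentD[OF ind', of "matrix_row J A ` I" u "matrix_row J A i"] assms i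
      by auto
    then show "y i = 0" using u i by simp
  qed
next
  assume inj: "row_injective I J A"
  have key: "\<forall>i\<in>I. y i = 0" if "(\<Sum>i\<in>I. fun_scale (y i) (matrix_row J A i)) = 0" for y
  proof -
    have "\<forall>j\<in>J. (\<Sum>i\<in>I. y i * A i j) = 0"
    proof
      fix j assume "j \<in> J"
      then show "(\<Sum>i\<in>I. y i * A i j) = 0"
        using fun_cong[OF that, of j] unfolding sum_matrix_row by simp
    qed
    then show ?thesis using inj unfolding row_injective_def by blast
  qed
  have inj_row: "inj_on (matrix_row J A) I"
  proof (rule inj_onI, rule ccontr)
    fix i k assume *: "i \<in> I" "k \<in> I" "matrix_row J A i = matrix_row J A k" "i \<noteq> k"
    define y :: "'a \<Rightarrow> real" where "y = (\<lambda>l. if l = i then 1 else if l = k then - 1 else 0)"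
    have "(\<Sum>l\<in>I. fun_scale (y l) (matrix_row J A l)) =
        (\<Sum>l\<in>{i, k}. fun_scale (y l) (matrix_row J A l))"
      using * assms by (intro sum.mono_neutral_right) (auto simp: y_def fun_scale_def zero_fun_def)
    also have "\<dots> = 0" using * by (simp add: y_def fun_scale_def fun_eq_iff)
    finally have "y i = 0" using key * by blast
    then show False by (simp add: y_def)
  qed
  moreover have "fun_space.independent (matrix_row J A ` I)"
  proof (rule fun_space.independent_if_scalars_zero)
    show "finite (matrix_row J A ` I)" using assms by simp
    fix u f assume s: "(\<Sum>f\<in>matrix_row J A ` I. fun_scale (u f) f) = 0" and f: "f \<in> matrix_row J A ` I"
    then have "(\<Sum>i\<in>I. fun_scale (u (matrix_row J A i)) (matrix_row J A i)) = 0"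
      using inj_row by (simp add: sum.reindex)
    from key[OF this] f show "u f = 0" by auto
  qed
  ultimately show "rows_independent I J A" unfolding rows_independent_def by blast
qed

text \<open>The rows are independent and lie in the span of the unit vectors indexed by
  \<open>J\<close>.\<close>

lemma full_row_rank_imp_card_le:
  assumes "finite I" "finite J" "full_row_rank I J A"
  shows "card I \<le> card J"
proof -
  have rows: "rows_independent I J A"
    using assms by (simp add: rows_independent_iff_row_injective full_row_rank_imp_row_injective)
  note inj = conjunct1[OF rows[unfolded rows_independent_def]]
  note ind = conjunct2[OF rows[unfolded rows_independent_def]]
  define \<delta> where "\<delta> j = (\<lambda>k::'b. if k = j then 1 else (0::real))" for j
  have "matrix_row J A i = (\<Sum>j\<in>J. fun_scale (A i j) (\<delta> j))" for i
  proof -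
    have "(\<Sum>j\<in>S. fun_scale (A i j) (\<delta> j)) k = (\<Sum>j\<in>S. A i j * \<delta> j k)" if "finite S" for k S
      using that by induction (auto simp: fun_scale_def zero_fun_def)
    then show ?thesis
      using assms(2) by (auto simp: fun_eq_iff matrix_row_def \<delta>_def if_distrib cong: if_cong)
  qed
  then have "matrix_row J A i \<in> fun_space.span (\<delta> ` J)" for i
    by (metis (no_types, lifting) fun_space.span_sum fun_space.span_scale fun_space.span_base image_eqI)
  then have "card (matrix_row J A ` I) \<le> card (\<delta> ` J)"
    using fun_space.independent_span_bound[OF _ ind, of "\<delta> ` J"] assms(2) by blast
  then show ?thesis
    using card_image[OF inj] card_image_le[OF assms(2), of \<delta>] by simp
qed

lemma tendsto_gram_det:
  fixes A :: "'t \<Rightarrow> 'i \<Rightarrow> 'j \<Rightarrow> real"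
  assumes "finite I" "\<And>i j. i \<in> I \<Longrightarrow> j \<in> J \<Longrightarrow> ((\<lambda>t. A t i j) \<longlongrightarrow> A0 i j) F"
  shows "((\<lambda>t. gram_det I J (A t)) \<longlongrightarrow> gram_det I J A0) F"
proof -
  note e = enumeration_in[OF assms(1)]
  show ?thesis
    unfolding gram_det_expand
    by (intro tendsto_sum tendsto_mult tendsto_prod tendsto_const assms(2) e) (auto intro: permutes_less)
qed

text \<open>Full row rank is an open condition, being the nonvanishing of a continuous
  function.\<close>

lemma full_row_rank_limit:
  assumes "finite I" "finite J" "full_row_rank I J A0"
    and "\<And>i j. i \<in> I \<Longrightarrow> j \<in> J \<Longrightarrow> ((\<lambda>t. A t i j) \<longlongrightarrow> A0 i j) F"
  shows "\<forall>\<^sub>F t in F. full_row_rank I J (A t)"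
proof -
  have "gram_det I J A0 \<noteq> 0"
    using assms(1-3) full_row_rank_iff_gram_det by blast
  with tendsto_gram_det[OF assms(1,4)] have "\<forall>\<^sub>F t in F. gram_det I J (A t) \<noteq> 0"
    by (rule tendsto_imp_eventually_ne)
  then show ?thesis using assms by (simp add: full_row_rank_iff_gram_det)
qed

lemma holomorphic_gram_det:
  assumes "finite I" "\<And>i j. i \<in> I \<Longrightarrow> j \<in> J \<Longrightarrow> (\<lambda>z. A z i j) holomorphic_on S"
  shows "(\<lambda>z. gram_det I J (A z)) holomorphic_on S"
proof -
  note e = enumeration_in[OF assms(1)]
  show ?thesis
    unfolding gram_det_expand
    by (intro holomorphic_on_sum holomorphic_on_mult holomorphic_on_prod holomorphic_on_const assms(2) e) (auto intro: permutes_less)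
qed

text \<open>Used for the embedding of the reals into the complex numbers and for the evaluation of
  polynomials.\<close>

lemma gram_det_hom:
  assumes "comm_ring_hom h" "\<And>i j. i \<in> I \<Longrightarrow> j \<in> J \<Longrightarrow> B i j = h (A i j)" "finite I"
  shows "gram_det I J B = h (gram_det I J A)"
proof -
  interpret comm_ring_hom h by fact
  note e = enumeration_in[OF assms(3)]
  have "gram_mat I J B = map_mat h (gram_mat I J A)"
    by (intro eq_matI) (auto simp: gram_mat_def hom_sum hom_mult assms(2) e intro!: sum.cong)
  then show ?thesis by (simp add: gram_det_def)
qed

section \<open>Graph components and Laman sparsity\<close>

lemma simple_graph_finite_edges:
  assumes "simple_graph V E"
  shows "finite E"
proof (rule finite_subset)
  show "E \<subseteq> Pow V" using assms by (auto simp: simple_graph_def)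
  show "finite (Pow V)" using assms by (simp add: simple_graph_def)
qed

section \<open>Components: |V| - omega(F) as the rank function of the graphic matroid\<close>

definition connectivity :: "'v set \<Rightarrow> 'v set set \<Rightarrow> ('v \<times> 'v) set" where
  "connectivity V F = {(u, v). u \<in> V \<and> v \<in> V \<and> (u, v) \<in> {(x, y). {x, y} \<in> F}\<^sup>*}"

lemma graph_components_connectivity: "graph_components V F = V // connectivity V F"
  by (simp add: graph_components_def connectivity_def)

lemma sym_adjacency_rtrancl: "sym ({(x, y). {x, y} \<in> F}\<^sup>*)"
  by (intro sym_rtrancl symI) (simp add: insert_commute)

lemma equiv_connectivity: "equiv V (connectivity V F)"
proof (rule equivI)
  show "connectivity V F \<subseteq> V \<times> V" by (auto simp: connectivity_def)
  show "refl_on V (connectivity V F)" by (auto simp: refl_on_def connectivity_def)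
  show "sym (connectivity V F)"
    using symD[OF sym_adjacency_rtrancl[of F]] by (auto simp: sym_def connectivity_def)
  show "trans (connectivity V F)" by (auto simp: trans_def connectivity_def)
qed

lemma connectivity_mono: "F \<subseteq> G \<Longrightarrow> connectivity V F \<subseteq> connectivity V G"
  unfolding connectivity_def using rtrancl_mono[of "{(x, y). {x, y} \<in> F}" "{(x, y). {x, y} \<in> G}"]
  by blast

lemma connectivity_edge: "{u, v} \<in> F \<Longrightarrow> u \<in> V \<Longrightarrow> v \<in> V \<Longrightarrow> (u, v) \<in> connectivity V F"
  by (auto simp: connectivity_def)

lemma connectivity_insert:
  assumes "u \<in> V" "v \<in> V"
  shows "(x, y) \<in> connectivity V (insert {u, v} F) \<longleftrightarrow>
    (x, y) \<in> connectivity V F \<or>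
    ((x, u) \<in> connectivity V F \<and> (v, y) \<in> connectivity V F) \<or>
    ((x, v) \<in> connectivity V F \<and> (u, y) \<in> connectivity V F)"
proof -
  define R where "R = {(x, y). {x, y} \<in> F}"
  have eq: "{(x, y). {x, y} \<in> insert {u, v} F} = insert (u, v) (insert (v, u) R)"
    by (auto simp: R_def doubleton_eq_iff)
  have "(x, y) \<in> (insert (u, v) (insert (v, u) R))\<^sup>* \<longleftrightarrow> (x, y) \<in> R\<^sup>* \<or>
      ((x, v) \<in> R\<^sup>* \<and> (u, y) \<in> R\<^sup>*) \<or>
      (((x, u) \<in> R\<^sup>* \<or> (x, v) \<in> R\<^sup>*) \<and> ((v, y) \<in> R\<^sup>* \<or> (u, y) \<in> R\<^sup>*))"
    by (simp add: rtrancl_insert)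
  also have "\<dots> \<longleftrightarrow> (x, y) \<in> R\<^sup>* \<or> ((x, u) \<in> R\<^sup>* \<and> (v, y) \<in> R\<^sup>*) \<or>
      ((x, v) \<in> R\<^sup>* \<and> (u, y) \<in> R\<^sup>*)"
    using rtrancl_trans[of x u R y] rtrancl_trans[of x v R y] by argo
  finally show ?thesis
    unfolding connectivity_def eq R_def[symmetric] using assms by simp argo
qed

lemma connectivity_insert_connected:
  assumes "(u, v) \<in> connectivity V F"
  shows "connectivity V (insert {u, v} F) = connectivity V F"
proof -
  have uv: "u \<in> V" "v \<in> V" using assms by (auto simp: connectivity_def)
  have sym: "(y, x) \<in> connectivity V F" if "(x, y) \<in> connectivity V F" for x y
    using that equiv_connectivity[of V F] by (auto simp: equiv_def dest: symD)
  have trans: "(x, z) \<in> connectivity V F"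
    if "(x, y) \<in> connectivity V F" "(y, z) \<in> connectivity V F" for x y z
    using that equiv_connectivity[of V F] by (meson equiv_def transD)
  have "(x, y) \<in> connectivity V (insert {u, v} F) \<longleftrightarrow> (x, y) \<in> connectivity V F" for x y
    unfolding connectivity_insert[OF uv] using assms sym trans by blast
  then show ?thesis by auto
qed

text \<open>Only the classes \<open>A\<close> of u and \<open>B\<close> of v change: they are
  replaced by their union.\<close>

lemma card_graph_components_insert:
  assumes "finite V" "u \<in> V" "v \<in> V" "(u, v) \<notin> connectivity V F"
  shows "card (graph_components V F) = Suc (card (graph_components V (insert {u, v} F)))"
proof -
  let ?r = "connectivity V F" and ?r' = "connectivity V (insert {u, v} F)"
  define A where "A = ?r `` {u}"
  define B where "B = ?r `` {v}"
  have sym: "(y, x) \<in> ?r" if "(x, y) \<in> ?r" for x y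
    using that equiv_connectivity[of V F] by (auto simp: equiv_def dest: symD)
  have trans: "(x, z) \<in> ?r" if "(x, y) \<in> ?r" "(y, z) \<in> ?r" for x y z
    using that equiv_connectivity[of V F] by (meson equiv_def transD)
  have refl: "(x, x) \<in> ?r" if "x \<in> V" for x
    using that by (auto simp: connectivity_def)
  have class': "?r' `` {x} = (if x \<in> A \<union> B then A \<union> B else ?r `` {x})" for x
  proof -
    have "y \<in> ?r' `` {x} \<longleftrightarrow> y \<in> (if x \<in> A \<union> B then A \<union> B else ?r `` {x})" for y
      using sym[of u x] sym[of x u] sym[of v x] sym[of x v] trans[of u x y] trans[of x u y]
        trans[of v x y] trans[of x v y]
      unfolding Image_singleton_iff connectivity_insert[OF assms(2,3)]
      by (simp add: A_def B_def) argo
    then show ?thesis by blast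
  qed
  have AB: "A \<noteq> B" using assms refl by (auto simp: A_def B_def)
  have AV: "A \<in> V // ?r" "B \<in> V // ?r" using assms by (auto simp: A_def B_def quotient_def)
  have classA: "?r `` {x} = A" if "x \<in> A" for x
    using that sym trans unfolding A_def by blast
  have classB: "?r `` {x} = B" if "x \<in> B" for x
    using that sym trans unfolding B_def by blast
  have "V // ?r' = insert (A \<union> B) (V // ?r - {A, B})"
  proof
    show "V // ?r' \<subseteq> insert (A \<union> B) (V // ?r - {A, B})"
    proof
      fix X assume "X \<in> V // ?r'"
      then obtain x where x: "x \<in> V" "X = ?r' `` {x}" by (auto simp: quotient_def)
      show "X \<in> insert (A \<union> B) (V // ?r - {A, B})"
      proof (cases "x \<in> A \<union> B")
        case True
        then show ?thesis using x class' by simp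
      next
        case False
        then have "x \<in> ?r `` {x}" "X = ?r `` {x}" using x class' refl by auto
        then show ?thesis using False x by (auto simp: quotient_def)
      qed
    qed
    show "insert (A \<union> B) (V // ?r - {A, B}) \<subseteq> V // ?r'"
    proof
      fix X assume "X \<in> insert (A \<union> B) (V // ?r - {A, B})"
      then consider "X = A \<union> B" | "X \<in> V // ?r" "X \<noteq> A" "X \<noteq> B" by auto
      then show "X \<in> V // ?r'"
      proof cases
        case 1
        moreover have "u \<in> A" using refl assms by (auto simp: A_def)
        ultimately have "X = ?r' `` {u}" using class' by simp
        then show ?thesis using assms by (auto simp: quotient_def)
      next
        case 2
        then obtain x where x: "x \<in> V" "X = ?r `` {x}" by (auto simp: quotient_def)
        then have "x \<notin> A \<union> B" using 2 classA classB by auto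
        then have "X = ?r' `` {x}" using x class' by simp
        then show ?thesis using x by (auto simp: quotient_def)
      qed
    qed
  qed
  moreover have "A \<union> B \<notin> V // ?r - {A, B}"
  proof
    assume "A \<union> B \<in> V // ?r - {A, B}"
    then obtain x where "A \<union> B = ?r `` {x}" by (auto simp: quotient_def)
    moreover have "u \<in> A" "v \<in> B" using refl assms by (auto simp: A_def B_def)
    ultimately have "(x, u) \<in> ?r" "(x, v) \<in> ?r" by auto
    then show False using assms(4) sym trans by blast
  qed
  moreover have fin: "finite (V // ?r)"
    using assms(1) by (simp add: quotient_def)
  moreover have "card (V // ?r - {A, B}) + 2 = card (V // ?r)"
    using card_Diff_subset[of "{A, B}" "V // ?r"] card_mono[OF fin, of "{A, B}"] AV AB by simp
  ultimately show ?thesis by (simp add: graph_components_connectivity)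
qed

text \<open>Diminishing returns: an edge that joins two components of the larger graph also joins
  two components of the smaller one.\<close>

lemma card_graph_components_insert_le:
  assumes "finite V" "u \<in> V" "v \<in> V" "F \<subseteq> G"
  shows "card (graph_components V G) + card (graph_components V (insert {u, v} F)) \<le>
    card (graph_components V F) + card (graph_components V (insert {u, v} G))"
proof (cases "(u, v) \<in> connectivity V F")
  case True
  then have "(u, v) \<in> connectivity V G" using connectivity_mono[OF assms(4)] by blast
  then show ?thesis
    using True by (simp add: graph_components_connectivity connectivity_insert_connected)
next
  case F: False
  show ?thesis
  proof (cases "(u, v) \<in> connectivity V G")
    case True
    then show ?thesis using card_graph_components_insert[OF assms(1-3) F]
      by (simp add: graph_components_connectivity connectivity_insert_connected)
  next
    case False
    then show ?thesis using card_graph_components_insert[OF assms(1-3) F]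
        card_graph_components_insert[OF assms(1-3) False] by simp
  qed
qed

text \<open>Supermodularity of omega, that is, submodularity of the graphic rank: the edges of F - G
  are added one by one, both to the intersection and to G.\<close>

lemma card_graph_components_Un_Int:
  assumes "simple_graph V E" "F \<subseteq> E" "G \<subseteq> E"
  shows "card (graph_components V F) + card (graph_components V G) \<le>
    card (graph_components V (F \<union> G)) + card (graph_components V (F \<inter> G))"
proof -
  have V: "finite V" and E: "\<And>e. e \<in> E \<Longrightarrow> e \<subseteq> V \<and> card e = 2"
    using assms(1) by (auto simp: simple_graph_def)
  have "finite E" using simple_graph_finite_edges[OF assms(1)] .
  have *: "card (graph_components V B) + card (graph_components V (A \<union> X)) \<le>
      card (graph_components V A) + card (graph_components V (B \<union> X))"
    if "finite X" "X \<subseteq> E" "A \<subseteq> B" for A B X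
    using that
  proof (induction X)
    case (insert e X)
    obtain u v where e: "e = {u, v}" "u \<in> V" "v \<in> V"
      using E[of e] insert.prems by (auto simp: card_2_iff)
    have "A \<union> X \<subseteq> B \<union> X" using insert.prems by auto
    from card_graph_components_insert_le[OF V e(2,3) this] insert e(1) show ?case by simp
  qed simp
  have "finite (F - G)" using \<open>finite E\<close> assms(2) by (meson finite_Diff finite_subset)
  from *[of "F - G" "F \<inter> G" G] this assms show ?thesis
    by (simp add: Un_commute Int_Un_distrib Un_Diff_Int subset_iff add.commute)
qed

text \<open>Each vertex outside V(F) is a component by itself, and at least one further component
  meets V(F).\<close>

lemma card_graph_components_ge:
  assumes "simple_graph V F" "F \<noteq> {}"
  shows "card V + 1 \<le> card (graph_components V F) + card (\<Union> F)"
proof -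
  have V: "finite V" and F: "\<And>e. e \<in> F \<Longrightarrow> e \<subseteq> V \<and> card e = 2"
    using assms(1) by (auto simp: simple_graph_def)
  obtain e where "e \<in> F" using assms(2) by auto
  with F[of e] obtain u where u: "u \<in> \<Union> F" by (fastforce simp: card_2_iff)
  have FV: "\<Union> F \<subseteq> V" using F by auto
  let ?r = "connectivity V F"
  have isolated: "?r `` {x} = {x}" if "x \<in> V - \<Union> F" for x
  proof -
    have "y = x" if "(x, y) \<in> {(x, y). {x, y} \<in> F}\<^sup>*" for y
      using that \<open>x \<in> V - \<Union> F\<close> by (induction rule: rtrancl_induct) auto
    then show ?thesis using that by (auto simp: connectivity_def)
  qed
  have "u \<in> ?r `` {u}" using u FV by (auto simp: connectivity_def)
  then have "x = u" if "x \<in> V - \<Union> F" "?r `` {u} = ?r `` {x}" for x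
    using isolated[OF that(1)] that(2) by (metis singletonD)
  then have "inj_on (\<lambda>x. ?r `` {x}) (insert u (V - \<Union> F))"
    using isolated by (intro inj_onI) (metis insert_iff singleton_inject)
  moreover have "(\<lambda>x. ?r `` {x}) ` insert u (V - \<Union> F) \<subseteq> V // ?r"
    using u FV by (auto simp: quotient_def)
  moreover have "finite (V // ?r)" using V by (simp add: quotient_def)
  ultimately have "card (insert u (V - \<Union> F)) \<le> card (V // ?r)" by (rule card_inj_on_le)
  moreover have "card (insert u (V - \<Union> F)) = Suc (card V - card (\<Union> F))"
    using V u FV by (simp add: card_Diff_subset finite_subset)
  ultimately show ?thesis by (simp add: graph_components_connectivity)
qed

text \<open>Vertices of \<open>D0\<close> are discarded until no colour repeats. If u and v share a
  colour and neither can be discarded, the sets F and G that block them are tight. By submodularity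
  the bound then fails for their union or their intersection, because the common colour counts on
  V(F) and on V(G), but not on the vertices of the intersection.\<close>

lemma colour_transversal:
  assumes E: "simple_graph V E" and "finite D0"
    and D0: "\<And>F. F \<subseteq> E \<Longrightarrow> card F + card (graph_components V F) \<le> card V + card (\<kappa> ` (D0 \<inter> \<Union> F))"
  shows "\<exists>D\<subseteq>D0. inj_on \<kappa> D \<and>
    (\<forall>F\<subseteq>E. card F + card (graph_components V F) \<le> card V + card (D \<inter> \<Union> F))"
  using assms(2,3)
proof (induction "card D0" arbitrary: D0 rule: less_induct)
  case less
  note D0 = less.prems(2)
  show ?case
  proof (cases "inj_on \<kappa> D0")
    case True
    then have "card (\<kappa> ` (D0 \<inter> \<Union> F)) = card (D0 \<inter> \<Union> F)" for F
      by (meson card_image inf_le1 inj_on_subset)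
    then show ?thesis using True D0 by auto
  next
    case False
    then obtain u v where uv: "u \<in> D0" "v \<in> D0" "u \<noteq> v" "\<kappa> u = \<kappa> v" by (auto simp: inj_on_def)
    have fE: "finite E" using simple_graph_finite_edges[OF E] .
    have IH: ?thesis if "w \<in> D0" "\<And>F. F \<subseteq> E \<Longrightarrow>
        card F + card (graph_components V F) \<le> card V + card (\<kappa> ` ((D0 - {w}) \<inter> \<Union> F))" for w
    proof -
      have "card (D0 - {w}) < card D0" using less.prems(1) that(1) by (intro psubset_card_mono) auto
      from less.hyps[OF this _ that(2)] less.prems(1) show ?thesis by auto
    qed
    show ?thesis
    proof (rule ccontr)
      assume no: "\<not> ?thesis"
      \<comment> \<open>F is tight, and w alone carries its colour among the vertices of
        \<open>D0\<close> in V(F), so that dropping w loses a colour there.\<close>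
      define blocks where "blocks w F \<longleftrightarrow> F \<subseteq> E \<and>
          card V + card (\<kappa> ` (D0 \<inter> \<Union> F)) \<le> card F + card (graph_components V F) \<and>
          w \<in> \<Union> F \<and> (\<forall>x\<in>D0 \<inter> \<Union> F. \<kappa> x = \<kappa> w \<longrightarrow> x = w)" for w F
      have blocked: "\<exists>F. blocks w F" if w0: "w \<in> D0" for w
      proof -
        have "\<not> (\<forall>F\<subseteq>E. card F + card (graph_components V F) \<le>
            card V + card (\<kappa> ` ((D0 - {w}) \<inter> \<Union> F)))"
          using IH[OF w0] no by auto
        then obtain F where F: "F \<subseteq> E"
            "card V + card (\<kappa> ` ((D0 - {w}) \<inter> \<Union> F)) < card F + card (graph_components V F)"
          by (auto simp: not_le)
        let ?K = "\<kappa> ` ((D0 - {w}) \<inter> \<Union> F)"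
        have fin: "finite ?K" using less.prems(1) by simp
        have sub: "\<kappa> ` (D0 \<inter> \<Union> F) \<subseteq> insert (\<kappa> w) ?K" by auto
        have "\<not> \<kappa> ` (D0 \<inter> \<Union> F) \<subseteq> ?K"
          using card_mono[OF fin, of "\<kappa> ` (D0 \<inter> \<Union> F)"] D0[OF F(1)] F(2) by auto
        then have w: "w \<in> \<Union> F" "\<kappa> w \<notin> ?K" by auto
        have "card (\<kappa> ` (D0 \<inter> \<Union> F)) \<le> Suc (card ?K)"
          using card_mono[OF _ sub] fin by (simp add: card_insert_if split: if_splits)
        with F have "card V + card (\<kappa> ` (D0 \<inter> \<Union> F)) \<le> card F + card (graph_components V F)"
          by linarith
        moreover have "\<forall>x\<in>D0 \<inter> \<Union> F. \<kappa> x = \<kappa> w \<longrightarrow> x = w"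
        proof (intro ballI impI, rule ccontr)
          fix x assume "x \<in> D0 \<inter> \<Union> F" "\<kappa> x = \<kappa> w" "x \<noteq> w"
          then have "\<kappa> x \<in> ?K" by (intro imageI) simp
          then show False using w(2) \<open>\<kappa> x = \<kappa> w\<close> by simp
        qed
        ultimately have "blocks w F" using F(1) w(1) unfolding blocks_def by (intro conjI)
        then show ?thesis by (rule exI)
      qed
      from blocked[OF uv(1)] obtain F where "blocks u F" by (rule exE)
      then have F: "F \<subseteq> E"
        "card V + card (\<kappa> ` (D0 \<inter> \<Union> F)) \<le> card F + card (graph_components V F)"
        "u \<in> \<Union> F" "\<forall>x\<in>D0 \<inter> \<Union> F. \<kappa> x = \<kappa> u \<longrightarrow> x = u"
        unfolding blocks_def by - (elim conjE, assumption)+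
      from blocked[OF uv(2)] obtain G where "blocks v G" by (rule exE)
      then have G: "G \<subseteq> E"
        "card V + card (\<kappa> ` (D0 \<inter> \<Union> G)) \<le> card G + card (graph_components V G)"
        "v \<in> \<Union> G" "\<forall>x\<in>D0 \<inter> \<Union> G. \<kappa> x = \<kappa> v \<longrightarrow> x = v"
        unfolding blocks_def by - (elim conjE, assumption)+
      let ?K = "\<kappa> ` (D0 \<inter> \<Union> F)" and ?L = "\<kappa> ` (D0 \<inter> \<Union> G)"
      have fin: "finite ?K" "finite ?L" using less.prems(1) by auto
      have "card F + card G = card (F \<union> G) + card (F \<inter> G)"
        using card_Un_Int finite_subset[OF F(1) fE] finite_subset[OF G(1) fE] by blast
      moreover note card_graph_components_Un_Int[OF E F(1) G(1)]
      moreover have "F \<union> G \<subseteq> E" "F \<inter> G \<subseteq> E" using F(1) G(1) by auto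
      note D0[OF this(1)] D0[OF this(2)]
      moreover have "card (\<kappa> ` (D0 \<inter> \<Union> (F \<union> G))) = card (?K \<union> ?L)"
        by (rule arg_cong[where f = card]) blast
      \<comment> \<open>Strict: a vertex of the intersection with the colour of u would have to be
        u, because of F, and v, because of G.\<close>
      moreover have "card (\<kappa> ` (D0 \<inter> \<Union> (F \<inter> G))) < card (?K \<inter> ?L)"
      proof (rule psubset_card_mono)
        show "finite (?K \<inter> ?L)" using fin by simp
        have "\<kappa> u \<in> ?K \<inter> ?L" using uv F(3) G(3) by blast
        moreover have "\<kappa> u \<notin> \<kappa> ` (D0 \<inter> \<Union> (F \<inter> G))"
        proof
          assume "\<kappa> u \<in> \<kappa> ` (D0 \<inter> \<Union> (F \<inter> G))"
          then obtain x where x: "\<kappa> u = \<kappa> x" "x \<in> D0 \<inter> \<Union> (F \<inter> G)" by (rule imageE)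
          from x(2) have mem: "x \<in> D0 \<inter> \<Union> F" "x \<in> D0 \<inter> \<Union> G" by auto
          have "x = u" by (rule mp[OF bspec[OF F(4) mem(1)] x(1)[symmetric]])
          moreover have "x = v"
            by (rule mp[OF bspec[OF G(4) mem(2)] trans[OF x(1)[symmetric] uv(4)]])
          ultimately show False using uv(3) by simp
        qed
        moreover have "\<kappa> ` (D0 \<inter> \<Union> (F \<inter> G)) \<subseteq> ?K \<inter> ?L" by blast
        ultimately show "\<kappa> ` (D0 \<inter> \<Union> (F \<inter> G)) \<subset> ?K \<inter> ?L" by blast
      qed
      moreover have "card ?K + card ?L = card (?K \<union> ?L) + card (?K \<inter> ?L)"
        using card_Un_Int[OF fin] .
      ultimately show False using F(2) G(2) by linarith
    qed
  qed
qed

section \<open>Laman sparsity, reversed 1-extensions and the cone\<close>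

definition laman_sparse :: "'v set \<Rightarrow> 'v set set \<Rightarrow> bool" where
  "laman_sparse W H \<longleftrightarrow> (\<forall>X\<subseteq>W. 2 \<le> card X \<longrightarrow> card {e\<in>H. e \<subseteq> X} + 3 \<le> 2 * card X)"

lemma laman_sparse_mono:
  assumes "laman_sparse W H" "finite H" "W' \<subseteq> W" "H' \<subseteq> H"
  shows "laman_sparse W' H'"
  unfolding laman_sparse_def
proof (intro allI impI)
  fix X assume X: "X \<subseteq> W'" "2 \<le> card X"
  have "card {e\<in>H'. e \<subseteq> X} \<le> card {e\<in>H. e \<subseteq> X}"
    using assms(2,4) by (intro card_mono) auto
  then show "card {e\<in>H'. e \<subseteq> X} + 3 \<le> 2 * card X"
    using assms(1,3) X unfolding laman_sparse_def by (meson add_le_mono1 le_trans subset_trans)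
qed

lemma laman_sparse_extend:
  assumes sparse: "laman_sparse W H" and W: "simple_graph W H"
    and star: "{e\<in>H. v \<in> e} = {{v, a}, {v, b}, {v, c}}"
    and distinct: "v \<in> W" "a \<noteq> b" "a \<noteq> c" "b \<noteq> c" "v \<noteq> a" "v \<noteq> b" "v \<noteq> c"
  defines "H' \<equiv> {e\<in>H. v \<notin> e}"
  shows "\<exists>x y. (x, y) \<in> {(a, b), (a, c), (b, c)} \<and> {x, y} \<notin> H' \<and>
    laman_sparse (W - {v}) (insert {x, y} H')"
proof (rule ccontr)
  assume no: "\<not> ?thesis"
  define i where "i X = card {e\<in>H. e \<subseteq> X}" for X
  have finH: "finite H" using simple_graph_finite_edges[OF W] .
  have finW: "finite W" using W by (simp add: simple_graph_def)
  have bound: "i X + 3 \<le> 2 * card X" if "X \<subseteq> W" "2 \<le> card X" for X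
    using sparse that by (simp add: laman_sparse_def i_def)
  have super: "i X + i Y \<le> i (X \<union> Y) + i (X \<inter> Y)" for X Y
  proof -
    have "i X + i Y = card ({e\<in>H. e \<subseteq> X} \<union> {e\<in>H. e \<subseteq> Y}) + card ({e\<in>H. e \<subseteq> X} \<inter> {e\<in>H. e \<subseteq> Y})"
      unfolding i_def using finH by (intro card_Un_Int) auto
    also have "\<dots> \<le> i (X \<union> Y) + i (X \<inter> Y)"
      unfolding i_def using finH by (intro add_mono card_mono) auto
    finally show ?thesis .
  qed
  have nbrs: "a \<in> W" "b \<in> W" "c \<in> W"
  proof -
    have "{v, a} \<in> H" "{v, b} \<in> H" "{v, c} \<in> H" using star by auto
    then show "a \<in> W" "b \<in> W" "c \<in> W" using W by (auto simp: simple_graph_def)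
  qed
  \<comment> \<open>For sets of at least two points \<open>bound\<close> makes this an equality. An
    edge xy that is already present makes {x, y} itself tight.\<close>
  define tight where "tight X \<longleftrightarrow> X \<subseteq> W - {v} \<and> 2 * card X \<le> i X + 3" for X
  have blocked: "\<exists>X. tight X \<and> x \<in> X \<and> y \<in> X"
    if xy: "(x, y) \<in> {(a, b), (a, c), (b, c)}" for x y
  proof (cases "{x, y} \<in> H'")
    case True
    have ne: "x \<noteq> y" using xy distinct by auto
    have "card {{x, y}} \<le> i {x, y}"
      unfolding i_def using finH True by (intro card_mono) (auto simp: H'_def)
    moreover have "{x, y} \<subseteq> W - {v}" using xy nbrs distinct by auto
    ultimately have "tight {x, y}" using ne by (simp add: tight_def)
    then show ?thesis by blast
  next
    case False
    with no xy have "\<not> laman_sparse (W - {v}) (insert {x, y} H')" by blast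
    then obtain X where X: "X \<subseteq> W - {v}" "2 \<le> card X"
      "2 * card X < card {e\<in>insert {x, y} H'. e \<subseteq> X} + 3"
      by (auto simp: laman_sparse_def not_le)
    have "i X + 3 \<le> 2 * card X" using X bound by auto
    with X(3) have lt: "i X < card {e\<in>insert {x, y} H'. e \<subseteq> X}" by simp
    have "{x, y} \<subseteq> X"
    proof (rule ccontr)
      assume "\<not> {x, y} \<subseteq> X"
      then have "card {e\<in>insert {x, y} H'. e \<subseteq> X} \<le> i X"
        unfolding i_def using finH by (intro card_mono) (auto simp: H'_def)
      with lt show False by simp
    qed
    moreover have "card {e\<in>insert {x, y} H'. e \<subseteq> X} \<le> card (insert {x, y} {e\<in>H. e \<subseteq> X})"
      using finH by (intro card_mono) (auto simp: H'_def)
    then have "card {e\<in>insert {x, y} H'. e \<subseteq> X} \<le> i X + 1"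
      unfolding i_def using finH by (simp add: card_insert_if split: if_splits)
    then have "tight X" using X by (auto simp: tight_def)
    ultimately show ?thesis by blast
  qed
  have not_all: False if "tight X" "a \<in> X" "b \<in> X" "c \<in> X" for X
  proof -
    have X: "X \<subseteq> W - {v}" "2 * card X \<le> i X + 3" using that by (auto simp: tight_def)
    have fin: "finite X" using X finW by (meson finite_Diff finite_subset)
    have "card ({e\<in>H. e \<subseteq> X} \<union> {{v, a}, {v, b}, {v, c}}) = i X + 3"
    proof (subst card_Un_disjoint)
      show "{e\<in>H. e \<subseteq> X} \<inter> {{v, a}, {v, b}, {v, c}} = {}" using X by auto
      have "card {{v, a}, {v, b}, {v, c}} = 3" using distinct by (auto simp: doubleton_eq_iff)
      then show "card {e\<in>H. e \<subseteq> X} + card {{v, a}, {v, b}, {v, c}} = i X + 3" by (simp add: i_def)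
    qed (use finH in auto)
    moreover have "card ({e\<in>H. e \<subseteq> X} \<union> {{v, a}, {v, b}, {v, c}}) \<le> i (insert v X)"
      unfolding i_def using finH that star by (intro card_mono) auto
    moreover have "v \<notin> X" using X by blast
    then have "card (insert v X) = Suc (card X)" using fin by simp
    moreover have "card {a, b} \<le> card X" using that fin by (intro card_mono) auto
    then have "2 \<le> card X" using distinct by simp
    ultimately show False using bound[of "insert v X"] X \<open>v \<in> W\<close> by auto
  qed
  have union: "tight (X \<union> Y)" if "tight X" "tight Y" "2 \<le> card (X \<inter> Y)" for X Y
  proof -
    have sub: "X \<subseteq> W - {v}" "Y \<subseteq> W - {v}" using that by (auto simp: tight_def)
    then have "finite X" "finite Y" using finW by (meson finite_Diff finite_subset)+
    then have "card X + card Y = card (X \<union> Y) + card (X \<inter> Y)" by (rule card_Un_Int)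
    moreover have "i (X \<inter> Y) + 3 \<le> 2 * card (X \<inter> Y)" using bound that sub by blast
    ultimately show ?thesis using super[of X Y] that by (auto simp: tight_def)
  qed
  obtain X Y Z where X: "tight X" "a \<in> X" "b \<in> X" and Y: "tight Y" "a \<in> Y" "c \<in> Y"
    and Z: "tight Z" "b \<in> Z" "c \<in> Z" using blocked by (metis insertCI)
  have fin: "finite X" "finite Y" "finite Z"
    using X Y Z finW by (auto simp: tight_def intro: finite_subset)
  have single: "card (S \<inter> T) = 1"
    if "tight S" "tight T" "x \<in> S \<inter> T" "{a, b, c} \<subseteq> S \<union> T" "finite S" for S T x
  proof -
    have "\<not> 2 \<le> card (S \<inter> T)" using union[OF that(1,2)] not_all[of "S \<union> T"] that(4) by blast
    moreover have "card (S \<inter> T) \<noteq> 0" using that by auto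
    ultimately show ?thesis by linarith
  qed
  have XY: "card (X \<inter> Y) = 1" using single[of X Y a] X Y fin by auto
  have XZ: "card (X \<inter> Z) = 1" using single[of X Z b] X Z fin by auto
  have YZ: "card (Y \<inter> Z) = 1" using single[of Y Z c] Y Z fin by auto
  \<comment> \<open>Sets that meet in a single point have no common edge, so the edges inside X, Y
    and Z can simply be added up.\<close>
  have small: "i S = 0" if "card S \<le> 1" "finite S" for S
  proof -
    have "\<not> e \<subseteq> S" if "e \<in> H" for e
      using card_mono[OF \<open>finite S\<close>, of e] \<open>card S \<le> 1\<close> W that by (auto simp: simple_graph_def)
    then have "{e\<in>H. e \<subseteq> S} = {}" by blast
    then show ?thesis unfolding i_def by (simp only: card.empty)
  qed
  have "X \<inter> Y = {a}" "X \<inter> Z = {b}" "Y \<inter> Z = {c}"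
    using XY XZ YZ X Y Z by (metis IntI card_1_singletonE singletonD)+
  then have XYZ: "(X \<union> Y) \<inter> Z = {b, c}" by auto
  have "{e\<in>H. e \<subseteq> X} \<inter> {e\<in>H. e \<subseteq> Y} = {}" "({e\<in>H. e \<subseteq> X} \<union> {e\<in>H. e \<subseteq> Y}) \<inter> {e\<in>H. e \<subseteq> Z} = {}"
    using small[of "X \<inter> Y"] small[of "X \<inter> Z"] small[of "Y \<inter> Z"] XY XZ YZ fin finH
    by (auto simp: i_def)
  then have "card ({e\<in>H. e \<subseteq> X} \<union> {e\<in>H. e \<subseteq> Y} \<union> {e\<in>H. e \<subseteq> Z}) = i X + i Y + i Z"
    unfolding i_def using finH by (simp add: card_Un_disjoint)
  moreover have "card ({e\<in>H. e \<subseteq> X} \<union> {e\<in>H. e \<subseteq> Y} \<union> {e\<in>H. e \<subseteq> Z}) \<le> i (X \<union> Y \<union> Z)"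
    unfolding i_def using finH by (intro card_mono) auto
  moreover have "card X + card Y = card (X \<union> Y) + 1" using card_Un_Int[OF fin(1,2)] XY by simp
  moreover have "card (X \<union> Y) + card Z = card (X \<union> Y \<union> Z) + 2"
    using card_Un_Int[of "X \<union> Y" Z] fin XYZ distinct by simp
  \<comment> \<open>2|X| + 2|Y| + 2|Z| exceeds twice the size of the union by 6, and the three tight
    sets allow a slack of 9; what remains is 3.\<close>
  ultimately have "2 * card (X \<union> Y \<union> Z) \<le> i (X \<union> Y \<union> Z) + 3"
    using X(1) Y(1) Z(1) unfolding tight_def by linarith
  then have "tight (X \<union> Y \<union> Z)" using X(1) Y(1) Z(1) unfolding tight_def by blast
  then show False using not_all X Y by blast
qed

definition cone_edges :: "'v \<Rightarrow> 'v set \<Rightarrow> 'v set set" where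
  "cone_edges z U = (\<lambda>w. {z, w}) ` U"

text \<open>For z in X and F nonempty, the bound with \<open>D\<close> and |V| - omega(F) \<le>
  |V(F)| - 1 give at most |Y| - 1 plus the number of vertices of \<open>D\<close> in Y for |F|. The
  cone adds at most |Y - D| edges, in total 2|Y| - 1 = 2|X| - 3. The empty F is treated apart
  because |V| - omega(F) \<le> |V(F)| - 1 fails for it.\<close>

lemma laman_sparse_cone:
  assumes E: "simple_graph V E" and "z \<notin> V"
    and laman: "\<And>F. F \<subseteq> E \<Longrightarrow> F \<noteq> {} \<Longrightarrow> card F + 3 \<le> 2 * card (\<Union> F)"
    and D: "\<And>F. F \<subseteq> E \<Longrightarrow> card F + card (graph_components V F) \<le> card V + card (D \<inter> \<Union> F)"
  shows "laman_sparse (insert z V) (E \<union> cone_edges z (V - D))"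
  unfolding laman_sparse_def
proof (intro allI impI)
  fix X assume X: "X \<subseteq> insert z V" "2 \<le> card X"
  have finV: "finite V" and EV: "\<And>e. e \<in> E \<Longrightarrow> e \<subseteq> V" using E by (auto simp: simple_graph_def)
  have finE: "finite E" using simple_graph_finite_edges[OF E] .
  have finX: "finite X" using X finV finite_subset by blast
  define F where "F = {e\<in>E. e \<subseteq> X}"
  define Y where "Y = X - {z}"
  have Y: "Y \<subseteq> V" "finite Y" using X finX by (auto simp: Y_def)
  have FE: "F \<subseteq> E" and FY: "\<Union> F \<subseteq> Y" using EV \<open>z \<notin> V\<close> by (auto simp: F_def Y_def)
  have F: "card F + 3 \<le> 2 * card Y" if "F \<noteq> {}"
    using laman[OF FE that] card_mono[OF Y(2) FY] by linarith
  show "card {e\<in>E \<union> cone_edges z (V - D). e \<subseteq> X} + 3 \<le> 2 * card X"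
  proof (cases "z \<in> X")
    case False
    then have eq: "{e\<in>E \<union> cone_edges z (V - D). e \<subseteq> X} = F" and "Y = X"
      by (auto simp: F_def Y_def cone_edges_def)
    then have "card F + 3 \<le> 2 * card X" using F X by (cases "F = {}") simp_all
    then show ?thesis unfolding eq .
  next
    case True
    then have eq: "{e\<in>E \<union> cone_edges z (V - D). e \<subseteq> X} = F \<union> cone_edges z (Y - D)"
      using Y \<open>z \<notin> V\<close> by (auto simp: F_def Y_def cone_edges_def)
    have "card (F \<union> cone_edges z (Y - D)) \<le> card F + card (Y - D)"
      using card_Un_le[of F "cone_edges z (Y - D)"] card_image_le[of "Y - D" "\<lambda>w. {z, w}"] Y(2)
      by (simp add: cone_edges_def)
    moreover have cX: "card X = Suc (card Y)" using True finX unfolding Y_def by (metis card_Suc_Diff1)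
    moreover have "card F + card (Y - D) + 1 \<le> 2 * card Y"
    proof (cases "F = {}")
      case True
      then show ?thesis using cX X(2) card_mono[OF Y(2), of "Y - D"] by auto
    next
      case False
      have "simple_graph V F" using E FE by (auto simp: simple_graph_def)
      then have "card V + 1 \<le> card (graph_components V F) + card (\<Union> F)"
        using card_graph_components_ge False by blast
      moreover have "card (\<Union> F) \<le> card Y" "card (D \<inter> \<Union> F) \<le> card (Y \<inter> D)"
        using Y FY by (auto intro!: card_mono)
      moreover have "card Y = card (Y \<inter> D) + card (Y - D)"
        using card_Int_Diff Y(2) by blast
      ultimately show ?thesis using D[OF FE] by linarith
    qed
    ultimately show ?thesis unfolding eq by linarith
  qed
qed

lemma sum_degree:
  assumes "simple_graph V E"
  shows "(\<Sum>v\<in>V. card {e\<in>E. v \<in> e}) = 2 * card E"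
proof -
  have V: "finite V" and E: "\<And>e. e \<in> E \<Longrightarrow> e \<subseteq> V \<and> card e = 2"
    using assms by (auto simp: simple_graph_def)
  have "(\<Sum>v\<in>V. card {e\<in>E. v \<in> e}) = (\<Sum>v\<in>V. \<Sum>e\<in>E. if v \<in> e then 1 else 0)"
    using simple_graph_finite_edges[OF assms] by (simp add: sum.If_cases Int_def)
  also have "\<dots> = (\<Sum>e\<in>E. \<Sum>v\<in>V. if v \<in> e then 1 else 0)" by (rule sum.swap)
  also have "\<dots> = (\<Sum>e\<in>E. card e)"
  proof (rule sum.cong)
    fix e assume "e \<in> E"
    then have "V \<inter> e = e" using E by auto
    then show "(\<Sum>v\<in>V. if v \<in> e then 1 else 0) = card e" using V by (simp add: sum.If_cases)
  qed simp
  also have "\<dots> = 2 * card E" using E by simp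
  finally show ?thesis .
qed

text \<open>
  Every vertex of \<open>D\<close> whose colour is not unique is matched with a vertex of the same colour outside \<open>D\<close>.
\<close>

lemma low_degree_vertex:
  assumes E: "simple_graph V E" and "V \<noteq> {}" "D \<subseteq> V" "inj_on \<kappa> D"
    and count: "card E + card (V - D) + 1 \<le> 2 * card V"
  shows "\<exists>v\<in>V. card {e\<in>E. v \<in> e} \<le> 2 \<or>
    (card {e\<in>E. v \<in> e} = 3 \<and> v \<in> D \<and> (\<forall>w\<in>V. \<kappa> w = \<kappa> v \<longrightarrow> w = v))"
proof (rule ccontr)
  assume no: "\<not> ?thesis"
  have V: "finite V" using E by (simp add: simple_graph_def)
  define S where "S = {v\<in>D. \<forall>w\<in>V. \<kappa> w = \<kappa> v \<longrightarrow> w = v}"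
  have S: "S \<subseteq> D" by (auto simp: S_def)
  have fin: "finite D" "finite S"
    using finite_subset[OF assms(3) V] finite_subset[OF S] by simp_all
  \<comment> \<open>If the claim fails, all degrees are at least 3, and at least 4 on
    \<open>S\<close>, the vertices of \<open>D\<close> with a colour of their own.\<close>
  have "(\<Sum>v\<in>V. 3 + (if v \<in> S then 1 else 0)) \<le> (\<Sum>v\<in>V. card {e\<in>E. v \<in> e})"
  proof (rule sum_mono)
    fix v assume "v \<in> V"
    with no have "\<not> card {e\<in>E. v \<in> e} \<le> 2" "v \<in> S \<longrightarrow> card {e\<in>E. v \<in> e} \<noteq> 3"
      by (auto simp: S_def)
    then show "3 + (if v \<in> S then 1 else 0) \<le> card {e\<in>E. v \<in> e}" by auto
  qed
  moreover have "V \<inter> S = S" using S assms(3) by auto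
  then have "(\<Sum>v\<in>V. 3 + (if v \<in> S then 1 else 0)) = 3 * card V + card S"
    using V by (simp add: sum.distrib sum.If_cases)
  ultimately have deg: "3 * card V + card S \<le> 2 * card E" using sum_degree[OF E] by simp
  have "\<exists>w\<in>V - D. \<kappa> w = \<kappa> v" if "v \<in> D - S" for v
  proof -
    from that obtain w where "w \<in> V" "\<kappa> w = \<kappa> v" "w \<noteq> v" by (auto simp: S_def)
    moreover from this have "w \<notin> D" using \<open>inj_on \<kappa> D\<close> that by (auto simp: inj_on_def)
    ultimately show ?thesis by blast
  qed
  then obtain f where f: "\<And>v. v \<in> D - S \<Longrightarrow> f v \<in> V - D \<and> \<kappa> (f v) = \<kappa> v" by metis
  then have "inj_on f (D - S)" using \<open>inj_on \<kappa> D\<close> by (metis DiffD1 inj_on_def)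
  then have "card (D - S) \<le> card (V - D)" using f V by (intro card_inj_on_le) auto
  moreover have "card (D - S) + card S = card D"
    using card_Diff_subset[OF fin(2) S] card_mono[OF fin(1) S] by simp
  moreover have "card (V - D) + card D = card V"
    using card_Diff_subset[OF fin(1) assms(3)] card_mono[OF V assms(3)] by simp
  \<comment> \<open>From |D - S| \<le> |V - D| one gets |V| \<le> |S| + 2|V - D|, so
    \<open>count\<close> yields 2|E| \<le> 3|V| + |S| - 2.\<close>
  ultimately show False using deg count by linarith
qed

section \<open>Frameworks in polar coordinates\<close>

text \<open>Polymorphic because the parameters are also taken complex.\<close>

definition radius :: "('v \<Rightarrow> 'c option) \<Rightarrow> ('c \<Rightarrow> 'a::one) \<Rightarrow> 'v \<Rightarrow> 'a" where
  "radius \<kappa> \<rho> v = (case \<kappa> v of None \<Rightarrow> 1 | Some c \<Rightarrow> \<rho> c)"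

definition radius_velocity :: "('v \<Rightarrow> 'c option) \<Rightarrow> ('c \<Rightarrow> real) \<Rightarrow> 'v \<Rightarrow> real" where
  "radius_velocity \<kappa> s v = (case \<kappa> v of None \<Rightarrow> 0 | Some c \<Rightarrow> s c)"

text \<open>
  Here \<open>\<phi>\<close> is the angular velocity and \<open>s\<close> the radial velocity. Radii may be negative: only their
  squares enter the sphere equations.
\<close>

definition edge_form ::
    "('v \<Rightarrow> 'c option) \<Rightarrow> ('v \<Rightarrow> real) \<Rightarrow> ('c \<Rightarrow> real) \<Rightarrow> ('v \<Rightarrow> real) \<Rightarrow> ('c \<Rightarrow> real) \<Rightarrow> 'v \<Rightarrow> 'v \<Rightarrow> real" where
  "edge_form \<kappa> \<theta> \<rho> \<phi> s u v =
     radius \<kappa> \<rho> u * radius \<kappa> \<rho> v * sin (\<theta> u - \<theta> v) * (\<phi> u - \<phi> v) +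
     (radius \<kappa> \<rho> u - radius \<kappa> \<rho> v * cos (\<theta> u - \<theta> v)) * radius_velocity \<kappa> s u +
     (radius \<kappa> \<rho> v - radius \<kappa> \<rho> u * cos (\<theta> u - \<theta> v)) * radius_velocity \<kappa> s v"

text \<open>Both orientations of an edge are listed; by \<open>edge_form_commute\<close> they impose
  the same equation.\<close>

definition solvable ::
    "'v set set \<Rightarrow> ('v \<Rightarrow> 'c option) \<Rightarrow> ('v \<Rightarrow> real) \<Rightarrow> ('c \<Rightarrow> real) \<Rightarrow> bool" where
  "solvable E \<kappa> \<theta> \<rho> \<longleftrightarrow>
     (\<forall>b. \<exists>\<phi> s. \<forall>u v. {u, v} \<in> E \<longrightarrow> edge_form \<kappa> \<theta> \<rho> \<phi> s u v = b {u, v})"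

text \<open>Coefficients of \<open>edge_form\<close> in the unknowns \<phi> and s. If both ends of e
  have the same colour, its column collects two terms, hence the sum. The type class provides sine
  and cosine over the reals and the complex numbers alike.\<close>

fun edge_matrix ::
    "('v \<Rightarrow> 'c option) \<Rightarrow> ('v \<Rightarrow> 'a) \<Rightarrow> ('c \<Rightarrow> 'a) \<Rightarrow> 'v set \<Rightarrow> 'v + 'c \<Rightarrow> 'a::{banach,real_normed_field}" where
  "edge_matrix \<kappa> \<theta> \<rho> e (Inl w) = (if w \<in> e then
     radius \<kappa> \<rho> w * radius \<kappa> \<rho> (the_elem (e - {w})) * sin (\<theta> w - \<theta> (the_elem (e - {w}))) else 0)"
| "edge_matrix \<kappa> \<theta> \<rho> e (Inr c) = (\<Sum>w\<in>e. if \<kappa> w = Some c then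
     radius \<kappa> \<rho> w - radius \<kappa> \<rho> (the_elem (e - {w})) * cos (\<theta> w - \<theta> (the_elem (e - {w}))) else 0)"

text \<open>Only colours that occur on V get a column, which keeps the set finite for any colour
  type.\<close>

definition motion_coords :: "'v set \<Rightarrow> ('v \<Rightarrow> 'c option) \<Rightarrow> ('v + 'c) set" where
  "motion_coords V \<kappa> = Inl ` V \<union> Inr ` {c. Some c \<in> \<kappa> ` V}"

lemma finite_motion_coords:
  assumes "finite V"
  shows "finite (motion_coords V \<kappa>)"
proof -
  have "{c. Some c \<in> \<kappa> ` V} \<subseteq> the ` \<kappa> ` V" by (auto simp: image_iff) (metis option.sel)
  then have "finite {c. Some c \<in> \<kappa> ` V}" using assms by (meson finite_imageI finite_subset)
  then show ?thesis using assms by (simp add: motion_coords_def)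
qed

lemma edge_form_commute: "edge_form \<kappa> \<theta> \<rho> \<phi> s v u = edge_form \<kappa> \<theta> \<rho> \<phi> s u v"
proof -
  have "sin (\<theta> v - \<theta> u) = - sin (\<theta> u - \<theta> v)" "cos (\<theta> v - \<theta> u) = cos (\<theta> u - \<theta> v)"
    by (metis minus_diff_eq sin_minus) (metis minus_diff_eq cos_minus)
  then show ?thesis by (simp add: edge_form_def algebra_simps)
qed

lemma edge_form_cong:
  assumes "\<phi> u = \<phi>' u" "\<phi> v = \<phi>' v" "radius_velocity \<kappa> s u = radius_velocity \<kappa>' s' u"
    "radius_velocity \<kappa> s v = radius_velocity \<kappa>' s' v" "radius \<kappa> \<rho> u = radius \<kappa>' \<rho>' u" "radius \<kappa> \<rho> v = radius \<kappa>' \<rho>' v"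
    "\<theta> u = \<theta>' u" "\<theta> v = \<theta>' v"
  shows "edge_form \<kappa> \<theta> \<rho> \<phi> s u v = edge_form \<kappa>' \<theta>' \<rho>' \<phi>' s' u v"
  using assms by (simp add: edge_form_def)

lemma sum_edge_matrix:
  assumes "finite V" "u \<in> V" "v \<in> V" "u \<noteq> v"
  shows "(\<Sum>j\<in>motion_coords V \<kappa>. edge_matrix \<kappa> \<theta> \<rho> {u, v} j * case_sum \<phi> s j) =
    edge_form \<kappa> \<theta> \<rho> \<phi> s u v"
proof -
  let ?C = "{c. Some c \<in> \<kappa> ` V}"
  have fin: "finite ?C"
    using finite_motion_coords[OF assms(1), of \<kappa>] unfolding motion_coords_def
    by (simp add: finite_image_iff inj_on_def)
  have elem: "the_elem ({u, v} - {u}) = v" "the_elem ({u, v} - {v}) = u"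
    using assms(4) by (simp_all add: insert_Diff_if)
  have "(\<Sum>j\<in>motion_coords V \<kappa>. edge_matrix \<kappa> \<theta> \<rho> {u, v} j * case_sum \<phi> s j) =
      (\<Sum>w\<in>V. edge_matrix \<kappa> \<theta> \<rho> {u, v} (Inl w) * \<phi> w) + (\<Sum>c\<in>?C. edge_matrix \<kappa> \<theta> \<rho> {u, v} (Inr c) * s c)"
    unfolding motion_coords_def using assms(1) fin
    by (subst sum.union_disjoint) (auto simp: sum.reindex)
  also have "(\<Sum>w\<in>V. edge_matrix \<kappa> \<theta> \<rho> {u, v} (Inl w) * \<phi> w) =
      (\<Sum>w\<in>{u, v}. edge_matrix \<kappa> \<theta> \<rho> {u, v} (Inl w) * \<phi> w)"
    using assms by (intro sum.mono_neutral_right) auto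
  also have "\<dots> = radius \<kappa> \<rho> u * radius \<kappa> \<rho> v * sin (\<theta> u - \<theta> v) * \<phi> u +
      radius \<kappa> \<rho> v * radius \<kappa> \<rho> u * sin (\<theta> v - \<theta> u) * \<phi> v"
    using assms(4) by (simp add: elem)
  also have "sin (\<theta> v - \<theta> u) = - sin (\<theta> u - \<theta> v)" by (metis minus_diff_eq sin_minus)
  also have "(\<Sum>c\<in>?C. edge_matrix \<kappa> \<theta> \<rho> {u, v} (Inr c) * s c) =
      (\<Sum>c\<in>?C. if \<kappa> u = Some c then (radius \<kappa> \<rho> u - radius \<kappa> \<rho> v * cos (\<theta> u - \<theta> v)) * s c else 0) +
      (\<Sum>c\<in>?C. if \<kappa> v = Some c then (radius \<kappa> \<rho> v - radius \<kappa> \<rho> u * cos (\<theta> v - \<theta> u)) * s c else 0)"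
    unfolding sum.distrib[symmetric] using assms(4)
    by (intro sum.cong) (auto simp: elem distrib_right)
  also have "(\<Sum>c\<in>?C. if \<kappa> u = Some c then (radius \<kappa> \<rho> u - radius \<kappa> \<rho> v * cos (\<theta> u - \<theta> v)) * s c else 0) =
      (radius \<kappa> \<rho> u - radius \<kappa> \<rho> v * cos (\<theta> u - \<theta> v)) * radius_velocity \<kappa> s u"
    using fin assms(2) by (cases "\<kappa> u") (auto simp: radius_velocity_def image_iff intro!: bexI[of _ u])
  also have "(\<Sum>c\<in>?C. if \<kappa> v = Some c then (radius \<kappa> \<rho> v - radius \<kappa> \<rho> u * cos (\<theta> v - \<theta> u)) * s c else 0) =
      (radius \<kappa> \<rho> v - radius \<kappa> \<rho> u * cos (\<theta> v - \<theta> u)) * radius_velocity \<kappa> s v"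
    using fin assms(3) by (cases "\<kappa> v") (auto simp: radius_velocity_def image_iff intro!: bexI[of _ v])
  also have "cos (\<theta> v - \<theta> u) = cos (\<theta> u - \<theta> v)" by (metis minus_diff_eq cos_minus)
  finally show ?thesis by (simp add: edge_form_def algebra_simps)
qed

lemma simple_graph_edge:
  assumes "simple_graph V E" "{u, v} \<in> E"
  shows "u \<in> V" "v \<in> V" "u \<noteq> v"
  using assms by (auto simp: simple_graph_def card_insert_if split: if_splits)

lemma simple_graph_edgeE:
  assumes "simple_graph V E" "e \<in> E"
  obtains u v where "e = {u, v}" "u \<in> V" "v \<in> V" "u \<noteq> v"
proof -
  have "card e = 2" "e \<subseteq> V" using assms by (auto simp: simple_graph_def)
  then obtain u v where "e = {u, v}" "u \<noteq> v" by (auto simp: card_2_iff)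
  with \<open>e \<subseteq> V\<close> that show thesis by auto
qed

lemma solvable_iff_full_row_rank:
  assumes E: "simple_graph V E"
  shows "solvable E \<kappa> \<theta> \<rho> \<longleftrightarrow> full_row_rank E (motion_coords V \<kappa>) (edge_matrix \<kappa> \<theta> \<rho>)"
proof
  have V: "finite V" using E by (simp add: simple_graph_def)
  show "full_row_rank E (motion_coords V \<kappa>) (edge_matrix \<kappa> \<theta> \<rho>)" if "solvable E \<kappa> \<theta> \<rho>"
    unfolding full_row_rank_def
  proof
    fix b
    obtain \<phi> s where *: "\<And>u v. {u, v} \<in> E \<Longrightarrow> edge_form \<kappa> \<theta> \<rho> \<phi> s u v = b {u, v}"
      using \<open>solvable E \<kappa> \<theta> \<rho>\<close> unfolding solvable_def by meson
    have "(\<Sum>j\<in>motion_coords V \<kappa>. edge_matrix \<kappa> \<theta> \<rho> e j * case_sum \<phi> s j) = b e" if "e \<in> E" for e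
    proof (rule simple_graph_edgeE[OF E that])
      fix u v assume "e = {u, v}" "u \<in> V" "v \<in> V" "u \<noteq> v"
      then show ?thesis using *[of u v] that sum_edge_matrix[OF V, of u v \<kappa> \<theta> \<rho> \<phi> s] by simp
    qed
    then show "\<exists>x. \<forall>e\<in>E. (\<Sum>j\<in>motion_coords V \<kappa>. edge_matrix \<kappa> \<theta> \<rho> e j * x j) = b e" by blast
  qed
  show "solvable E \<kappa> \<theta> \<rho>" if full: "full_row_rank E (motion_coords V \<kappa>) (edge_matrix \<kappa> \<theta> \<rho>)"
    unfolding solvable_def
  proof
    fix b
    obtain x where x: "\<And>e. e \<in> E \<Longrightarrow> (\<Sum>j\<in>motion_coords V \<kappa>. edge_matrix \<kappa> \<theta> \<rho> e j * x j) = b e"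
      using full unfolding full_row_rank_def by meson
    have "edge_form \<kappa> \<theta> \<rho> (x \<circ> Inl) (x \<circ> Inr) u v = b {u, v}" if "{u, v} \<in> E" for u v
    proof -
      have "case_sum (x \<circ> Inl) (x \<circ> Inr) = x" by (auto simp: fun_eq_iff split: sum.split)
      then show ?thesis
        using x[OF that] sum_edge_matrix[OF V simple_graph_edge[OF E that], of \<kappa> \<theta> \<rho> "x \<circ> Inl" "x \<circ> Inr"]
        by simp
    qed
    then show "\<exists>\<phi> s. \<forall>u v. {u, v} \<in> E \<longrightarrow> edge_form \<kappa> \<theta> \<rho> \<phi> s u v = b {u, v}" by blast
  qed
qed

section \<open>Dependence on the parameters and density of solvable positions\<close>

lemma radius_of_real: "radius \<kappa> (\<lambda>c. of_real (\<rho> c)) v = of_real (radius \<kappa> \<rho> v)"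
  by (simp add: radius_def split: option.split)

lemma edge_matrix_of_real:
  "edge_matrix \<kappa> (\<lambda>v. complex_of_real (\<theta> v)) (\<lambda>c. of_real (\<rho> c)) e j =
    of_real (edge_matrix \<kappa> \<theta> \<rho> e j)"
proof -
  have trig: "sin (complex_of_real a - of_real b) = of_real (sin (a - b))"
    "cos (complex_of_real a - of_real b) = of_real (cos (a - b))" for a b
    by (metis of_real_diff sin_of_real) (metis of_real_diff cos_of_real)
  show ?thesis
  proof (cases j)
    case (Inl w)
    then show ?thesis by (simp add: radius_of_real trig)
  next
    case (Inr c)
    show ?thesis unfolding Inr edge_matrix.simps of_real_sum
      by (intro sum.cong) (simp_all add: radius_of_real trig)
  qed
qed

lemma holomorphic_edge_matrix:
  assumes "\<And>v. (\<lambda>z. \<theta> z v) holomorphic_on S" "\<And>c. (\<lambda>z. \<rho> z c) holomorphic_on S"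
  shows "(\<lambda>z. edge_matrix \<kappa> (\<theta> z) (\<rho> z) e j) holomorphic_on S"
proof -
  have r: "(\<lambda>z. radius \<kappa> (\<rho> z) v) holomorphic_on S" for v
    using assms(2) by (cases "\<kappa> v") (auto simp: radius_def)
  show ?thesis
  proof (cases j)
    case (Inl w)
    then show ?thesis
      by (cases "w \<in> e") (auto intro!: holomorphic_intros assms(1) r)
  next
    case (Inr c)
    have "(\<lambda>z. if \<kappa> w = Some c then radius \<kappa> (\<rho> z) w - radius \<kappa> (\<rho> z) (the_elem (e - {w})) *
        cos (\<theta> z w - \<theta> z (the_elem (e - {w}))) else 0) holomorphic_on S" for w
      by (cases "\<kappa> w = Some c") (auto intro!: holomorphic_intros assms(1) r)
    then show ?thesis unfolding Inr edge_matrix.simps by (intro holomorphic_on_sum)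
  qed
qed

lemma tendsto_edge_matrix:
  fixes \<theta> :: "real \<Rightarrow> 'v \<Rightarrow> real"
  assumes "\<And>v. ((\<lambda>t. \<theta> t v) \<longlongrightarrow> \<theta>0 v) F" "\<And>c. ((\<lambda>t. \<rho> t c) \<longlongrightarrow> \<rho>0 c) F"
  shows "((\<lambda>t. edge_matrix \<kappa> (\<theta> t) (\<rho> t) e j) \<longlongrightarrow> edge_matrix \<kappa> \<theta>0 \<rho>0 e j) F"
proof -
  have r: "((\<lambda>t. radius \<kappa> (\<rho> t) v) \<longlongrightarrow> radius \<kappa> \<rho>0 v) F" for v
    using assms(2) by (cases "\<kappa> v") (auto simp: radius_def)
  show ?thesis
  proof (cases j)
    case (Inl w)
    then show ?thesis
      by (cases "w \<in> e") (auto intro!: tendsto_mult tendsto_sin tendsto_diff assms(1) r)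
  next
    case (Inr c)
    have "((\<lambda>t. if \<kappa> w = Some c then radius \<kappa> (\<rho> t) w - radius \<kappa> (\<rho> t) (the_elem (e - {w})) *
        cos (\<theta> t w - \<theta> t (the_elem (e - {w}))) else 0) \<longlongrightarrow>
        (if \<kappa> w = Some c then radius \<kappa> \<rho>0 w - radius \<kappa> \<rho>0 (the_elem (e - {w})) *
        cos (\<theta>0 w - \<theta>0 (the_elem (e - {w}))) else 0)) F" for w
      by (cases "\<kappa> w = Some c") (auto intro!: tendsto_mult tendsto_cos tendsto_diff assms(1) r)
    then show ?thesis unfolding Inr edge_matrix.simps by (intro tendsto_sum)
  qed
qed

text \<open>On the complex line through (\<theta>1, \<rho>1) at 0 and (\<theta>0, \<rho>0) at 1 the
  Gram determinant is entire and nonzero at 1. By the identity theorem its zeros cannot accumulate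
  at 0.\<close>

lemma solvable_frequently:
  assumes E: "simple_graph V E" and solv: "solvable E \<kappa> \<theta>0 \<rho>0"
  shows "\<exists>\<^sub>F t in at (0::real). solvable E \<kappa> (\<lambda>v. \<theta>1 v + t * (\<theta>0 v - \<theta>1 v)) (\<lambda>c. \<rho>1 c + t * (\<rho>0 c - \<rho>1 c))"
proof (rule ccontr)
  assume no: "\<not> ?thesis"
  have V: "finite V" using E by (simp add: simple_graph_def)
  have finE: "finite E" using simple_graph_finite_edges[OF E] .
  let ?J = "motion_coords V \<kappa>"
  have rank: "solvable E \<kappa> \<theta> \<rho> \<longleftrightarrow> gram_det E ?J (edge_matrix \<kappa> \<theta> \<rho>) \<noteq> 0" for \<theta> \<rho>
    using solvable_iff_full_row_rank[OF E] full_row_rank_iff_gram_det[OF finE finite_motion_coords[OF V]] by blast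
  define \<theta> where "\<theta> z v = of_real (\<theta>1 v) + z * of_real (\<theta>0 v - \<theta>1 v)" for z :: complex and v
  define \<rho> where "\<rho> z c = of_real (\<rho>1 c) + z * of_real (\<rho>0 c - \<rho>1 c)" for z :: complex and c
  define H where "H z = gram_det E ?J (edge_matrix \<kappa> (\<theta> z) (\<rho> z))" for z
  have "H holomorphic_on UNIV"
    unfolding H_def \<theta>_def \<rho>_def
    by (intro holomorphic_gram_det finE holomorphic_edge_matrix holomorphic_intros)
  have hom: "comm_ring_hom complex_of_real" by unfold_locales auto
  have H: "H (of_real t) = of_real (gram_det E ?J (edge_matrix \<kappa> (\<lambda>v. \<theta>1 v + t * (\<theta>0 v - \<theta>1 v))
      (\<lambda>c. \<rho>1 c + t * (\<rho>0 c - \<rho>1 c))))" for t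
    unfolding H_def
  proof (rule gram_det_hom[OF hom _ finE])
    fix e j
    have "\<theta> (of_real t) = (\<lambda>v. of_real (\<theta>1 v + t * (\<theta>0 v - \<theta>1 v)))"
      "\<rho> (of_real t) = (\<lambda>c. of_real (\<rho>1 c + t * (\<rho>0 c - \<rho>1 c)))"
      by (auto simp: \<theta>_def \<rho>_def)
    then show "edge_matrix \<kappa> (\<theta> (of_real t)) (\<rho> (of_real t)) e j =
      of_real (edge_matrix \<kappa> (\<lambda>v. \<theta>1 v + t * (\<theta>0 v - \<theta>1 v)) (\<lambda>c. \<rho>1 c + t * (\<rho>0 c - \<rho>1 c)) e j)"
      by (simp only: edge_matrix_of_real)
  qed
  from no have "\<forall>\<^sub>F t in at (0::real). H (of_real t) = 0"
    unfolding not_frequently rank H by simp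
  then obtain d where d: "d > 0" "\<And>t. t \<noteq> 0 \<Longrightarrow> dist t 0 < d \<Longrightarrow> H (of_real t) = 0"
    unfolding eventually_at by auto
  have "H (of_real 1) = 0"
  proof (rule analytic_continuation[of H UNIV "of_real ` {0<..<d}" 0])
    show "0 islimpt complex_of_real ` {0<..<d}"
      unfolding islimpt_approachable
    proof (intro allI impI)
      fix \<epsilon> :: real assume "\<epsilon> > 0"
      define t where "t = min (d / 2) (\<epsilon> / 2)"
      have "0 < t" "t < d" "t < \<epsilon>" using \<open>\<epsilon> > 0\<close> d(1) by (auto simp: t_def)
      then show "\<exists>x'\<in>complex_of_real ` {0<..<d}. x' \<noteq> 0 \<and> dist x' 0 < \<epsilon>"
        by (intro bexI[of _ "of_real t"]) auto
    qed
    show "H z = 0" if "z \<in> complex_of_real ` {0<..<d}" for z using that d(2) by (auto simp: dist_real_def)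
  qed (use \<open>H holomorphic_on UNIV\<close> in auto)
  moreover have "H (of_real 1) \<noteq> 0" unfolding H using solv rank by simp
  ultimately show False by contradiction
qed

text \<open>\<open>P\<close> is a condition that holds in a neighbourhood of \<open>(\<theta>1, \<rho>1)\<close>.\<close>

lemma solvable_near:
  assumes E: "simple_graph V E" and solv: "solvable E \<kappa> \<theta>0 \<rho>0"
    and P: "\<And>\<theta> \<rho>. (\<And>v. ((\<lambda>t. \<theta> t v) \<longlongrightarrow> \<theta>1 v) (at (0::real))) \<Longrightarrow>
      (\<And>c. ((\<lambda>t. \<rho> t c) \<longlongrightarrow> \<rho>1 c) (at 0)) \<Longrightarrow> \<forall>\<^sub>F t in at 0. P (\<theta> t) (\<rho> t)"
  shows "\<exists>\<theta> \<rho>. solvable E \<kappa> \<theta> \<rho> \<and> P \<theta> \<rho>"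
proof -
  define \<theta> where "\<theta> t v = \<theta>1 v + t * (\<theta>0 v - \<theta>1 v)" for t v
  define \<rho> where "\<rho> t c = \<rho>1 c + t * (\<rho>0 c - \<rho>1 c)" for t c
  have lim: "((\<lambda>t. x + t * (y - x)) \<longlongrightarrow> x) (at 0)" for x y :: real
    by (rule tendsto_eq_intros refl | simp)+
  have "\<forall>\<^sub>F t in at 0. P (\<theta> t) (\<rho> t)"
  proof (rule P[of \<theta> \<rho>])
    show "((\<lambda>t. \<theta> t v) \<longlongrightarrow> \<theta>1 v) (at 0)" for v unfolding \<theta>_def by (rule lim)
    show "((\<lambda>t. \<rho> t c) \<longlongrightarrow> \<rho>1 c) (at 0)" for c unfolding \<rho>_def by (rule lim)
  qed
  moreover have "\<exists>\<^sub>F t in at 0. solvable E \<kappa> (\<theta> t) (\<rho> t)"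
    using solvable_frequently[OF E solv, of \<theta>1 \<rho>1] unfolding \<theta>_def \<rho>_def .
  ultimately have "\<exists>\<^sub>F t in at 0. solvable E \<kappa> (\<theta> t) (\<rho> t) \<and> P (\<theta> t) (\<rho> t)"
    by (simp add: frequently_eventually_conj conj_commute)
  from frequently_ex[OF this] show ?thesis by blast
qed

section \<open>Adding a vertex\<close>

text \<open>Once every edge is oriented, a symmetric right-hand side becomes a function of the
  edge.\<close>

lemma solvable_symmetric:
  assumes "solvable E \<kappa> \<theta> \<rho>" "\<And>u v. b u v = b v u"
  shows "\<exists>\<phi> s. \<forall>u v. {u, v} \<in> E \<longrightarrow> edge_form \<kappa> \<theta> \<rho> \<phi> s u v = b u v"
proof -
  define p where "p e = (SOME q. e = {fst q, snd q})" for e :: "'a set"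
  define B where "B e = b (fst (p e)) (snd (p e))" for e
  have "B {u, v} = b u v" for u v
  proof -
    have "{u, v} = {fst (p {u, v}), snd (p {u, v})}"
      unfolding p_def by (rule someI[of _ "(u, v)"]) simp
    then have "(fst (p {u, v}) = u \<and> snd (p {u, v}) = v) \<or> (fst (p {u, v}) = v \<and> snd (p {u, v}) = u)"
      by (metis doubleton_eq_iff)
    then show ?thesis using assms(2) by (auto simp: B_def)
  qed
  moreover obtain \<phi> s where "\<forall>u v. {u, v} \<in> E \<longrightarrow> edge_form \<kappa> \<theta> \<rho> \<phi> s u v = B {u, v}"
    using assms(1) unfolding solvable_def by meson
  ultimately show ?thesis by auto
qed

text \<open>Separates the equations at v from the others; at v one orientation is enough.\<close>

lemma solvableI:
  assumes "\<And>b. (\<And>u w. b u w = b w u) \<Longrightarrow> \<exists>\<phi> s. (\<forall>x y. {x, y} \<in> {e\<in>E. v \<notin> e} \<longrightarrow>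
      edge_form \<kappa> \<theta> \<rho> \<phi> s x y = b x y) \<and> (\<forall>u. {v, u} \<in> E \<longrightarrow> edge_form \<kappa> \<theta> \<rho> \<phi> s v u = b v u)"
  shows "solvable E \<kappa> \<theta> \<rho>"
  unfolding solvable_def
proof
  fix b
  have "\<exists>\<phi> s. (\<forall>x y. {x, y} \<in> {e\<in>E. v \<notin> e} \<longrightarrow> edge_form \<kappa> \<theta> \<rho> \<phi> s x y = b {x, y}) \<and>
      (\<forall>u. {v, u} \<in> E \<longrightarrow> edge_form \<kappa> \<theta> \<rho> \<phi> s v u = b {v, u})"
    by (rule assms[of "\<lambda>x y. b {x, y}"]) (simp add: insert_commute)
  then obtain \<phi> s where away: "\<And>x y. {x, y} \<in> {e\<in>E. v \<notin> e} \<Longrightarrow> edge_form \<kappa> \<theta> \<rho> \<phi> s x y = b {x, y}"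
    and star: "\<And>u. {v, u} \<in> E \<Longrightarrow> edge_form \<kappa> \<theta> \<rho> \<phi> s v u = b {v, u}" by auto
  have "edge_form \<kappa> \<theta> \<rho> \<phi> s x y = b {x, y}" if xy: "{x, y} \<in> E" for x y
  proof -
    consider "v \<notin> {x, y}" | "x = v" | "y = v" by auto
    then show ?thesis
    proof cases
      case 1
      then show ?thesis using away[of x y] xy by simp
    next
      case 2
      then show ?thesis using star[of y] xy by simp
    next
      case 3
      have swap: "{x, v} = {v, x}" by auto
      have "edge_form \<kappa> \<theta> \<rho> \<phi> s v x = b {v, x}" using star[of x] xy 3 swap by simp
      then show ?thesis using 3 swap edge_form_commute[of \<kappa> \<theta> \<rho> \<phi> s x v] by simp
    qed
  qed
  then show "\<exists>\<phi> s. \<forall>u v. {u, v} \<in> E \<longrightarrow> edge_form \<kappa> \<theta> \<rho> \<phi> s u v = b {u, v}" by blast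
qed

lemma simple_graph_delete:
  assumes "simple_graph V E"
  shows "simple_graph V {e\<in>E. v \<notin> e}"
  using assms by (auto simp: simple_graph_def)

lemma simple_graph_insert:
  assumes "simple_graph V E" "a \<in> V" "b \<in> V" "a \<noteq> b"
  shows "simple_graph V (insert {a, b} {e\<in>E. v \<notin> e})"
  using assms by (auto simp: simple_graph_def)

lemma edge_form_upd:
  assumes "v \<noteq> x" "v \<noteq> y"
  shows "edge_form \<kappa> (\<theta>(v := \<tau>)) \<rho> (\<phi>(v := \<alpha>)) s x y = edge_form \<kappa> \<theta> \<rho> \<phi> s x y"
    "edge_form \<kappa> \<theta> \<rho> (\<phi>(v := \<alpha>)) s x y = edge_form \<kappa> \<theta> \<rho> \<phi> s x y"
    "edge_form \<kappa> (\<theta>(v := \<tau>)) \<rho> \<phi> s x y = edge_form \<kappa> \<theta> \<rho> \<phi> s x y"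
  using assms by (auto simp: edge_form_def)

text \<open>The unknown \<phi> v enters the equation of vu linearly with this coefficient. So the
  angular velocity of v can serve one neighbour that is not collinear with v and the centre.\<close>

lemma edge_form_solve:
  assumes "radius \<kappa> \<rho> v * radius \<kappa> \<rho> u * sin (\<theta> v - \<theta> u) \<noteq> 0"
  shows "\<exists>x. edge_form \<kappa> \<theta> \<rho> (\<phi>(v := x)) s v u = \<beta>"
proof -
  have vu: "v \<noteq> u" using assms by auto
  let ?g = "radius \<kappa> \<rho> v * radius \<kappa> \<rho> u * sin (\<theta> v - \<theta> u)"
  let ?r = "edge_form \<kappa> \<theta> \<rho> (\<phi>(v := 0)) s v u"
  have "edge_form \<kappa> \<theta> \<rho> (\<phi>(v := (\<beta> - ?r) / ?g)) s v u = ?g * ((\<beta> - ?r) / ?g) + ?r"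
    using vu by (simp add: edge_form_def algebra_simps)
  also have "\<dots> = \<beta>" using assms by simp
  finally show ?thesis by blast
qed

lemma tendsto_radius:
  assumes "\<And>c. ((\<lambda>t. \<rho> t c) \<longlongrightarrow> \<rho>0 c) F"
  shows "((\<lambda>t. radius \<kappa> (\<rho> t) v) \<longlongrightarrow> radius \<kappa> \<rho>0 v) F"
  using assms by (cases "\<kappa> v") (auto simp: radius_def)

text \<open>\<open>solvable_near\<close> is applied around the position with all radii 1, a at angle
  pi/2 and every other vertex at angle 0.\<close>

lemma solvable_general_position:
  assumes E: "simple_graph V E" and solv: "solvable E \<kappa> \<theta>0 \<rho>0" and "a \<noteq> b"
  shows "\<exists>\<theta> \<rho>. solvable E \<kappa> \<theta> \<rho> \<and> radius \<kappa> \<rho> a * radius \<kappa> \<rho> b * sin (\<theta> a - \<theta> b) \<noteq> 0"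
proof (rule solvable_near[OF E solv])
  define g where "g \<theta> \<rho> = radius \<kappa> \<rho> a * radius \<kappa> \<rho> b * sin (\<theta> a - \<theta> b)" for \<theta> :: "'a \<Rightarrow> real" and \<rho>
  fix \<theta> :: "real \<Rightarrow> 'a \<Rightarrow> real" and \<rho> :: "real \<Rightarrow> 'b \<Rightarrow> real"
  assume \<theta>: "\<And>w. ((\<lambda>t. \<theta> t w) \<longlongrightarrow> (if w = a then pi / 2 else 0)) (at 0)"
    and \<rho>: "\<And>c. ((\<lambda>t. \<rho> t c) \<longlongrightarrow> 1) (at 0)"
  have "((\<lambda>t. g (\<theta> t) (\<rho> t)) \<longlongrightarrow> g (\<lambda>w. if w = a then pi / 2 else 0) (\<lambda>_. 1)) (at 0)"
    unfolding g_def by (intro tendsto_mult tendsto_radius tendsto_sin tendsto_diff \<theta> \<rho>)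
  moreover have "g (\<lambda>w. if w = a then pi / 2 else 0) (\<lambda>_. 1) \<noteq> 0"
    using \<open>a \<noteq> b\<close> by (simp add: g_def radius_def split: option.split)
  ultimately have "\<forall>\<^sub>F t in at 0. g (\<theta> t) (\<rho> t) \<noteq> 0" by (rule tendsto_imp_eventually_ne)
  then show "\<forall>\<^sub>F t in at 0. radius \<kappa> (\<rho> t) a * radius \<kappa> (\<rho> t) b * sin (\<theta> t a - \<theta> t b) \<noteq> 0"
    unfolding g_def .
qed

text \<open>The angular velocity of v affects only the single equation at v. The inclusion in
  \<open>star\<close> also covers an isolated v.\<close>

lemma extend_pendant:
  assumes E: "simple_graph V E" and star: "{e\<in>E. v \<in> e} \<subseteq> {{v, a}}" and "v \<noteq> a"
    and solv: "solvable {e\<in>E. v \<notin> e} \<kappa> \<theta>0 \<rho>0"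
  shows "\<exists>\<theta> \<rho>. solvable E \<kappa> \<theta> \<rho>"
proof -
  obtain \<theta> \<rho> where solv: "solvable {e\<in>E. v \<notin> e} \<kappa> \<theta> \<rho>"
    and g: "radius \<kappa> \<rho> v * radius \<kappa> \<rho> a * sin (\<theta> v - \<theta> a) \<noteq> 0"
    using solvable_general_position[OF simple_graph_delete[OF E] solv \<open>v \<noteq> a\<close>] by (elim exE conjE)
  have "solvable E \<kappa> \<theta> \<rho>"
  proof (rule solvableI[of E v])
    fix b :: "'a \<Rightarrow> 'a \<Rightarrow> real" assume b: "\<And>u w. b u w = b w u"
    obtain \<phi> s where *: "\<forall>x y. {x, y} \<in> {e\<in>E. v \<notin> e} \<longrightarrow> edge_form \<kappa> \<theta> \<rho> \<phi> s x y = b x y"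
      using solvable_symmetric[where b = b, OF solv b] by blast
    obtain \<alpha> where \<alpha>: "edge_form \<kappa> \<theta> \<rho> (\<phi>(v := \<alpha>)) s v a = b v a"
      using edge_form_solve[OF g, of \<phi> s "b v a"] by blast
    have "edge_form \<kappa> \<theta> \<rho> (\<phi>(v := \<alpha>)) s x y = b x y" if "{x, y} \<in> {e\<in>E. v \<notin> e}" for x y
      using * that by (subst edge_form_upd) auto
    moreover have "u = a" if "{v, u} \<in> E" for u
    proof -
      have "{v, u} \<in> {e\<in>E. v \<in> e}" using that by simp
      then have "{v, u} \<in> {{v, a}}" by (rule subsetD[OF star])
      then show ?thesis by (auto simp: doubleton_eq_iff)
    qed
    ultimately show "\<exists>\<phi> s. (\<forall>x y. {x, y} \<in> {e\<in>E. v \<notin> e} \<longrightarrow> edge_form \<kappa> \<theta> \<rho> \<phi> s x y = b x y) \<and>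
        (\<forall>u. {v, u} \<in> E \<longrightarrow> edge_form \<kappa> \<theta> \<rho> \<phi> s v u = b v u)"
      using \<alpha> by (intro exI[of _ "\<phi>(v := \<alpha>)"] exI[of _ s]) blast
  qed
  then show ?thesis by blast
qed

lemma star_two:
  assumes "{e\<in>E. v \<in> e} = {{v, a}, {v, b}}" "{v, u} \<in> E"
  shows "u = a \<or> u = b"
proof -
  have "{v, u} \<in> {e\<in>E. v \<in> e}" using assms(2) by simp
  then show ?thesis unfolding assms(1) by (auto simp: doubleton_eq_iff)
qed

lemma full_row_rank_scale:
  assumes "full_row_rank I J (\<lambda>i j. A i j / c i)" "\<And>i. i \<in> I \<Longrightarrow> c i \<noteq> 0"
  shows "full_row_rank I J A"
  unfolding full_row_rank_def
proof
  fix b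
  obtain x where x: "\<forall>i\<in>I. (\<Sum>j\<in>J. A i j / c i * x j) = b i / c i"
    using assms(1) unfolding full_row_rank_def by (elim allE[of _ "\<lambda>i. b i / c i"]) blast
  have "(\<Sum>j\<in>J. A i j * x j) = b i" if "i \<in> I" for i
  proof -
    have "(\<Sum>j\<in>J. A i j * x j) = c i * (\<Sum>j\<in>J. A i j / c i * x j)"
      using assms(2)[OF that] by (simp add: sum_distrib_left)
    also have "\<dots> = b i" using x assms(2)[OF that] that by simp
    finally show ?thesis .
  qed
  then show "\<exists>x. \<forall>i\<in>I. (\<Sum>j\<in>J. A i j * x j) = b i" by blast
qed

text \<open>A row that degenerates as \<open>t\<close> tends to 0 may be divided by \<open>t\<close> before passing to the limit.\<close>

lemma solvable_limit:
  assumes E: "simple_graph V E" and va: "{v, a} \<in> E"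
    and \<theta>: "\<And>x. ((\<lambda>t. \<theta> t x) \<longlongrightarrow> \<theta>0 x) (at (0::real))"
    and \<rho>: "\<And>c. ((\<lambda>t. \<rho> t c) \<longlongrightarrow> \<rho>0 c) (at (0::real))"
    and L: "\<And>\<phi> s. ((\<lambda>t. edge_form \<kappa> (\<theta> t) (\<rho> t) \<phi> s v a / t) \<longlongrightarrow> L \<phi> s) (at 0)"
    and solv: "\<And>b. \<exists>\<phi> s. (\<forall>x y. {x, y} \<in> E - {{v, a}} \<longrightarrow> edge_form \<kappa> \<theta>0 \<rho>0 \<phi> s x y = b {x, y}) \<and>
      L \<phi> s = b {v, a}"
  shows "\<exists>\<theta> \<rho>. solvable E \<kappa> \<theta> \<rho>"
proof -
  have V: "finite V" using E by (simp add: simple_graph_def)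
  have finE: "finite E" using simple_graph_finite_edges[OF E] .
  let ?J = "motion_coords V \<kappa>"
  have finJ: "finite ?J" using finite_motion_coords[OF V] .
  \<comment> \<open>Unit vectors: the values of \<open>L\<close> on them are the entries of the
    limit row.\<close>
  define \<delta> where "\<delta> j = (\<lambda>k::'a + 'b. if k = j then 1 else (0::real))" for j
  define c where "c t e = (if e = {v, a} then t else 1)" for t :: real and e
  define A where "A t e j = edge_matrix \<kappa> (\<theta> t) (\<rho> t) e j / c t e" for t e j
  define A0 where "A0 e j = (if e = {v, a} then L (\<delta> j \<circ> Inl) (\<delta> j \<circ> Inr)
      else edge_matrix \<kappa> \<theta>0 \<rho>0 e j)" for e j
  note va' = simple_graph_edge[OF E va]
  have row: "(\<Sum>j\<in>?J. edge_matrix \<kappa> (\<theta> t) (\<rho> t) {v, a} j * case_sum \<phi> s j) =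
      edge_form \<kappa> (\<theta> t) (\<rho> t) \<phi> s v a" for t \<phi> s
    using sum_edge_matrix[OF V va'] .
  have entry: "edge_matrix \<kappa> (\<theta> t) (\<rho> t) {v, a} j = edge_form \<kappa> (\<theta> t) (\<rho> t) (\<delta> j \<circ> Inl) (\<delta> j \<circ> Inr) v a"
    if "j \<in> ?J" for t j
  proof -
    have eq: "case_sum (\<delta> j \<circ> Inl) (\<delta> j \<circ> Inr) = \<delta> j" by (auto simp: fun_eq_iff split: sum.split)
    have "(\<Sum>k\<in>?J. edge_matrix \<kappa> (\<theta> t) (\<rho> t) {v, a} k * \<delta> j k) = edge_matrix \<kappa> (\<theta> t) (\<rho> t) {v, a} j"
      using that finJ by (simp add: \<delta>_def if_distrib cong: if_cong)
    then show ?thesis using row[of t "\<delta> j \<circ> Inl" "\<delta> j \<circ> Inr"] eq by simp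
  qed
  have lim: "((\<lambda>t. A t e j) \<longlongrightarrow> A0 e j) (at 0)" if "j \<in> ?J" for e j
  proof (cases "e = {v, a}")
    case True
    then show ?thesis using L that by (simp add: A_def A0_def c_def entry)
  next
    case False
    then show ?thesis using tendsto_edge_matrix[OF \<theta> \<rho>] by (simp add: A_def A0_def c_def)
  qed
  \<comment> \<open>As a limit of linear forms \<open>L\<close> is linear, hence determined by its
    values on the unit vectors.\<close>
  have L_sum: "(\<Sum>j\<in>?J. A0 {v, a} j * case_sum \<phi> s j) = L \<phi> s" for \<phi> s
  proof (rule tendsto_unique[OF _ _ L])
    have "((\<lambda>t. \<Sum>j\<in>?J. A t {v, a} j * case_sum \<phi> s j) \<longlongrightarrow> (\<Sum>j\<in>?J. A0 {v, a} j * case_sum \<phi> s j)) (at 0)"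
      by (intro tendsto_sum tendsto_mult lim tendsto_const)
    moreover have "(\<Sum>j\<in>?J. A t {v, a} j * case_sum \<phi> s j) = edge_form \<kappa> (\<theta> t) (\<rho> t) \<phi> s v a / t" for t
      unfolding row[symmetric] by (simp add: A_def c_def sum_divide_distrib)
    ultimately show "((\<lambda>t. edge_form \<kappa> (\<theta> t) (\<rho> t) \<phi> s v a / t) \<longlongrightarrow> (\<Sum>j\<in>?J. A0 {v, a} j * case_sum \<phi> s j)) (at 0)"
      by simp
  qed simp
  have "full_row_rank E ?J A0"
    unfolding full_row_rank_def
  proof
    fix b
    obtain \<phi> s where *: "\<forall>x y. {x, y} \<in> E - {{v, a}} \<longrightarrow> edge_form \<kappa> \<theta>0 \<rho>0 \<phi> s x y = b {x, y}"
      "L \<phi> s = b {v, a}" using solv[of b] by blast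
    have "(\<Sum>j\<in>?J. A0 e j * case_sum \<phi> s j) = b e" if e: "e \<in> E" for e
    proof (cases "e = {v, a}")
      case True
      then show ?thesis using L_sum * by simp
    next
      case False
      obtain x y where xy: "e = {x, y}" "x \<in> V" "y \<in> V" "x \<noteq> y" using simple_graph_edgeE[OF E e] .
      have "(\<Sum>j\<in>?J. A0 e j * case_sum \<phi> s j) = edge_form \<kappa> \<theta>0 \<rho>0 \<phi> s x y"
        using sum_edge_matrix[OF V xy(2-4), of \<kappa> \<theta>0 \<rho>0 \<phi> s] False xy(1) by (simp add: A0_def)
      then show ?thesis using * False xy(1) that by simp
    qed
    then show "\<exists>x. \<forall>e\<in>E. (\<Sum>j\<in>?J. A0 e j * x j) = b e" by blast
  qed
  from full_row_rank_limit[OF finE finJ this lim]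
  have "\<forall>\<^sub>F t in at 0. full_row_rank E ?J (A t)" .
  then obtain d where d: "d > 0" "\<And>t. t \<noteq> 0 \<Longrightarrow> dist t 0 < d \<Longrightarrow> full_row_rank E ?J (A t)"
    unfolding eventually_at by auto
  have "full_row_rank E ?J (A (d / 2))" using d by (simp add: dist_real_def)
  then have "full_row_rank E ?J (edge_matrix \<kappa> (\<theta> (d / 2)) (\<rho> (d / 2)))"
    unfolding A_def by (rule full_row_rank_scale) (use d(1) in \<open>simp add: c_def\<close>)
  then show ?thesis unfolding solvable_iff_full_row_rank[OF E, symmetric] by blast
qed

text \<open>With y = None the colour x is erased, which freezes its radius at 1.\<close>

definition merge_colour :: "'c \<Rightarrow> 'c option \<Rightarrow> ('v \<Rightarrow> 'c option) \<Rightarrow> 'v \<Rightarrow> 'c option" where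
  "merge_colour x y \<kappa> w = (if \<kappa> w = Some x then y else \<kappa> w)"

definition colour_radius :: "('c \<Rightarrow> real) \<Rightarrow> 'c option \<Rightarrow> real" where
  "colour_radius \<rho> y = (case y of None \<Rightarrow> 1 | Some c \<Rightarrow> \<rho> c)"

definition colour_velocity :: "('c \<Rightarrow> real) \<Rightarrow> 'c option \<Rightarrow> real" where
  "colour_velocity s y = (case y of None \<Rightarrow> 0 | Some c \<Rightarrow> s c)"

lemma radius_colour_radius: "radius \<kappa> \<rho> v = colour_radius \<rho> (\<kappa> v)"
  by (simp add: radius_def colour_radius_def)

lemma radius_velocity_colour_velocity: "radius_velocity \<kappa> s v = colour_velocity s (\<kappa> v)"
  by (simp add: radius_velocity_def colour_velocity_def)

text \<open>In a solution for the merged colouring x and y move at the same rate. The extra velocity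
  \<beta> of x is added afterwards, and its effect \<open>K\<close> on the edges is subtracted from
  the right-hand side beforehand.\<close>

lemma merged_solution:
  assumes solv: "solvable E (merge_colour x y \<kappa>) \<theta> \<rho>" and "y \<noteq> Some x"
    and b: "\<And>u v. b u v = b v u"
  defines "\<rho>0 \<equiv> \<rho>(x := colour_radius \<rho> y)"
  shows "\<exists>\<phi> s. (\<forall>u v. {u, v} \<in> E \<longrightarrow> edge_form \<kappa> \<theta> \<rho>0 \<phi> s u v = b u v) \<and> s x = colour_velocity s y + \<beta>"
proof -
  let ?\<kappa> = "merge_colour x y \<kappa>"
  have r: "radius \<kappa> \<rho>0 w = radius ?\<kappa> \<rho> w" for w
    using \<open>y \<noteq> Some x\<close>
    by (auto simp: radius_def merge_colour_def \<rho>0_def colour_radius_def split: option.split)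
  define K where "K = edge_form \<kappa> \<theta> \<rho>0 (\<lambda>_. 0) (\<lambda>c. if c = x then \<beta> else 0)"
  have K: "K u v = K v u" for u v unfolding K_def by (rule edge_form_commute)
  have "b u v - K u v = b v u - K v u" for u v using K[of u v] b[of u v] by simp
  from solvable_symmetric[where b = "\<lambda>u v. b u v - K u v", OF solv this]
  obtain \<phi> s where *: "\<forall>u v. {u, v} \<in> E \<longrightarrow> edge_form ?\<kappa> \<theta> \<rho> \<phi> s u v = b u v - K u v" by blast
  define s' where "s' = s(x := colour_velocity s y + \<beta>)"
  have vel: "radius_velocity \<kappa> s' w =
      radius_velocity ?\<kappa> s w + radius_velocity \<kappa> (\<lambda>c. if c = x then \<beta> else 0) w" for w
    using \<open>y \<noteq> Some x\<close>
    by (auto simp: radius_velocity_def merge_colour_def s'_def colour_velocity_def split: option.split)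
  have "edge_form \<kappa> \<theta> \<rho>0 \<phi> s' u v = edge_form ?\<kappa> \<theta> \<rho> \<phi> s u v + K u v" for u v
    by (simp add: edge_form_def K_def vel r algebra_simps)
  then have "\<forall>u v. {u, v} \<in> E \<longrightarrow> edge_form \<kappa> \<theta> \<rho>0 \<phi> s' u v = b u v" using * by simp
  moreover have "s' x = colour_velocity s' y + \<beta>"
    using \<open>y \<noteq> Some x\<close> by (auto simp: s'_def colour_velocity_def split: option.split)
  ultimately show ?thesis by blast
qed

lemma merged_position:
  assumes E: "simple_graph V E" and "a \<noteq> b"
    and solv: "solvable E (merge_colour x y \<kappa>) \<theta>1 \<rho>1" and "y \<noteq> Some x"
  shows "\<exists>\<theta> \<rho>. solvable E (merge_colour x y \<kappa>) \<theta> \<rho> \<and>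
    radius \<kappa> (\<rho>(x := colour_radius \<rho> y)) a * radius \<kappa> (\<rho>(x := colour_radius \<rho> y)) b * sin (\<theta> a - \<theta> b) \<noteq> 0"
proof -
  let ?\<kappa> = "merge_colour x y \<kappa>"
  have r: "radius \<kappa> (\<rho>(x := colour_radius \<rho> y)) w = radius ?\<kappa> \<rho> w" for w \<rho>
    using \<open>y \<noteq> Some x\<close>
    by (auto simp: radius_def merge_colour_def colour_radius_def split: option.split)
  show ?thesis unfolding r by (rule solvable_general_position[OF E solv \<open>a \<noteq> b\<close>])
qed

text \<open>
  Here \<open>v\<close> lies on the ray through \<open>a\<close>, and the two radii become equal in the limit: the edge between
  them then forces equal radial velocities.
\<close>

lemma extend_merge:
  assumes E: "simple_graph V E" and star: "{e\<in>E. v \<in> e} = {{v, a}, {v, b}}" and "a \<noteq> b"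
    and colours: "(\<kappa> v = Some x \<and> \<kappa> a = y) \<or> (\<kappa> v = y \<and> \<kappa> a = Some x)" and "y \<noteq> Some x"
    and solv: "solvable {e\<in>E. v \<notin> e} (merge_colour x y \<kappa>) \<theta>1 \<rho>1"
  shows "\<exists>\<theta> \<rho>. solvable E \<kappa> \<theta> \<rho>"
proof -
  obtain \<theta> \<rho> where solv: "solvable {e\<in>E. v \<notin> e} (merge_colour x y \<kappa>) \<theta> \<rho>" and
    g: "radius \<kappa> (\<rho>(x := colour_radius \<rho> y)) a * radius \<kappa> (\<rho>(x := colour_radius \<rho> y)) b * sin (\<theta> a - \<theta> b) \<noteq> 0"
    using merged_position[OF simple_graph_delete[OF E] \<open>a \<noteq> b\<close> solv \<open>y \<noteq> Some x\<close>] by blast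
  define \<rho>0 where "\<rho>0 = \<rho>(x := colour_radius \<rho> y)"
  \<comment> \<open>The parameter t separates the two radii. As the angles are equal, the row of va
    is the difference of the radii times the difference of the radial velocities, hence proportional
    to t.\<close>
  define \<rho>' where "\<rho>' t = \<rho>(x := colour_radius \<rho> y + t)" for t
  define \<theta>0 where "\<theta>0 = \<theta>(v := \<theta> a)"
  define L where "L \<phi> s = s x - colour_velocity s y" for \<phi> :: "'a \<Rightarrow> real" and s :: "'b \<Rightarrow> real"
  have in_star: "{v, a} \<in> E" "{v, b} \<in> E" using star by auto
  have va: "v \<noteq> a" "v \<noteq> b" using simple_graph_edge(3)[OF E] in_star by auto
  have rr: "radius \<kappa> \<rho>0 v = radius \<kappa> \<rho>0 a"
    using colours \<open>y \<noteq> Some x\<close> by (auto simp: radius_def \<rho>0_def colour_radius_def split: option.split)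
  show ?thesis
  proof (rule solvable_limit[OF E in_star(1), of "\<lambda>_. \<theta>0" \<theta>0 \<rho>' \<rho>0 \<kappa> L])
    show "((\<lambda>t. \<theta>0 w) \<longlongrightarrow> \<theta>0 w) (at 0)" for w by simp
    show "((\<lambda>t. \<rho>' t c) \<longlongrightarrow> \<rho>0 c) (at 0)" for c
      by (cases "c = x") (auto simp: \<rho>'_def \<rho>0_def intro!: tendsto_eq_intros)
    show "((\<lambda>t. edge_form \<kappa> \<theta>0 (\<rho>' t) \<phi> s v a / t) \<longlongrightarrow> L \<phi> s) (at 0)" for \<phi> s
    proof (rule tendsto_eventually)
      have "edge_form \<kappa> \<theta>0 (\<rho>' t) \<phi> s v a / t = L \<phi> s" if "t \<noteq> 0" for t
      proof -
        have "edge_form \<kappa> \<theta>0 (\<rho>' t) \<phi> s v a = (radius \<kappa> (\<rho>' t) v - radius \<kappa> (\<rho>' t) a) *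
            (radius_velocity \<kappa> s v - radius_velocity \<kappa> s a)"
          by (simp add: edge_form_def \<theta>0_def algebra_simps)
        \<comment> \<open>In the second case of \<open>colours\<close> both factors change
          sign.\<close>
        also have "\<dots> = t * L \<phi> s"
          using colours \<open>y \<noteq> Some x\<close>
          by (auto simp: radius_colour_radius radius_velocity_colour_velocity L_def \<rho>'_def colour_radius_def
              colour_velocity_def algebra_simps split: option.split)
        finally show ?thesis using that by simp
      qed
      then show "\<forall>\<^sub>F t in at 0. edge_form \<kappa> \<theta>0 (\<rho>' t) \<phi> s v a / t = L \<phi> s"
        by (intro eventually_mono[OF eventually_neq_at_within[of 0]]) auto
    qed
    fix c :: "'a set \<Rightarrow> real"
    obtain \<phi> s where *: "\<forall>u w. {u, w} \<in> {e\<in>E. v \<notin> e} \<longrightarrow> edge_form \<kappa> \<theta> \<rho>0 \<phi> s u w = c {u, w}"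
      "s x = colour_velocity s y + c {v, a}"
      using merged_solution[where b = "\<lambda>u w. c {u, w}" and \<beta> = "c {v, a}", OF solv \<open>y \<noteq> Some x\<close>]
      unfolding \<rho>0_def by (auto simp: insert_commute)
    \<comment> \<open>In the limit v coincides with a and inherits its general position relative to
      b, so the angular velocity of v can solve vb.\<close>
    have "radius \<kappa> \<rho>0 v * radius \<kappa> \<rho>0 b * sin (\<theta>0 v - \<theta>0 b) \<noteq> 0"
      unfolding rr using g va by (simp add: \<theta>0_def \<rho>0_def)
    from edge_form_solve[OF this, of \<phi> s "c {v, b}"]
    obtain \<alpha> where \<alpha>: "edge_form \<kappa> \<theta>0 \<rho>0 (\<phi>(v := \<alpha>)) s v b = c {v, b}" by blast
    have "edge_form \<kappa> \<theta>0 \<rho>0 (\<phi>(v := \<alpha>)) s u w = c {u, w}" if "{u, w} \<in> E - {{v, a}}" for u w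
    proof -
      consider "v \<notin> {u, w}" | "u = v" | "w = v" by auto
      then show ?thesis
      proof cases
        case 1
        then show ?thesis using *(1) that unfolding \<theta>0_def by (subst edge_form_upd) auto
      next
        case 2
        then have "w = b" using star_two[OF star, of w] that by auto
        then show ?thesis using \<alpha> 2 by simp
      next
        case 3
        then have "u = b" using star_two[OF star, of u] that by (auto simp: insert_commute)
        then show ?thesis using \<alpha> 3 edge_form_commute[of \<kappa> \<theta>0 \<rho>0 "\<phi>(v := \<alpha>)" s b v]
          by (simp add: insert_commute)
      qed
    qed
    moreover have "L (\<phi>(v := \<alpha>)) s = c {v, a}" using *(2) by (simp add: L_def)
    ultimately show "\<exists>\<phi> s. (\<forall>u w. {u, w} \<in> E - {{v, a}} \<longrightarrow> edge_form \<kappa> \<theta>0 \<rho>0 \<phi> s u w = c {u, w}) \<and>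
        L \<phi> s = c {v, a}" by blast
  qed
qed

text \<open>Here \<open>v\<close> is placed antipodally to \<open>a\<close>, so that the edge between them measures the radius.\<close>

lemma extend_uncolour:
  assumes E: "simple_graph V E" and star: "{e\<in>E. v \<in> e} = {{v, a}, {v, b}}" and "a \<noteq> b"
    and colours: "\<kappa> v = Some x" "\<kappa> a = Some x"
    and solv: "solvable {e\<in>E. v \<notin> e} (merge_colour x None \<kappa>) \<theta>1 \<rho>1"
  shows "\<exists>\<theta> \<rho>. solvable E \<kappa> \<theta> \<rho>"
proof -
  obtain \<theta> \<rho> where solv: "solvable {e\<in>E. v \<notin> e} (merge_colour x None \<kappa>) \<theta> \<rho>" and
    g: "radius \<kappa> (\<rho>(x := colour_radius \<rho> None)) a * radius \<kappa> (\<rho>(x := colour_radius \<rho> None)) b * sin (\<theta> a - \<theta> b) \<noteq> 0"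
    using merged_position[OF simple_graph_delete[OF E] \<open>a \<noteq> b\<close> solv] by blast
  define \<rho>0 where "\<rho>0 = \<rho>(x := colour_radius \<rho> None)"
  define \<theta>0 where "\<theta>0 = \<theta>(v := \<theta> a + pi)"
  have in_star: "{v, a} \<in> E" "{v, b} \<in> E" using star by auto
  have va: "v \<noteq> a" "v \<noteq> b" using simple_graph_edge(3)[OF E] in_star by auto
  have "solvable E \<kappa> \<theta>0 \<rho>0"
  proof (rule solvableI[of E v])
    fix c :: "'a \<Rightarrow> 'a \<Rightarrow> real" assume c: "\<And>u w. c u w = c w u"
    \<comment> \<open>For antipodal points of radius 1 with common radial velocity s x, the row of
      va is 4 * s x.\<close>
    obtain \<phi> s where *: "\<forall>u w. {u, w} \<in> {e\<in>E. v \<notin> e} \<longrightarrow> edge_form \<kappa> \<theta> \<rho>0 \<phi> s u w = c u w"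
      "s x = colour_velocity s None + c v a / 4"
      using merged_solution[where b = c and \<beta> = "c v a / 4", OF solv _ c] unfolding \<rho>0_def by auto
    have "sin (\<theta>0 v - \<theta>0 b) = - sin (\<theta> a - \<theta> b)"
      using va by (simp add: \<theta>0_def algebra_simps flip: sin_periodic_pi)
    moreover have "radius \<kappa> \<rho>0 v = radius \<kappa> \<rho>0 a" using colours by (simp add: radius_def)
    ultimately have "radius \<kappa> \<rho>0 v * radius \<kappa> \<rho>0 b * sin (\<theta>0 v - \<theta>0 b) \<noteq> 0"
      using g by (simp add: \<rho>0_def)
    from edge_form_solve[OF this, of \<phi> s "c v b"]
    obtain \<alpha> where \<alpha>: "edge_form \<kappa> \<theta>0 \<rho>0 (\<phi>(v := \<alpha>)) s v b = c v b" by blast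
    have "edge_form \<kappa> \<theta>0 \<rho>0 (\<phi>(v := \<alpha>)) s u w = c u w" if "{u, w} \<in> {e\<in>E. v \<notin> e}" for u w
      using *(1) that unfolding \<theta>0_def by (subst edge_form_upd) auto
    moreover have "edge_form \<kappa> \<theta>0 \<rho>0 (\<phi>(v := \<alpha>)) s v a = c v a"
      using *(2) va colours
      by (simp add: edge_form_def \<theta>0_def \<rho>0_def radius_def colour_radius_def radius_velocity_def colour_velocity_def)
    ultimately show "\<exists>\<phi> s. (\<forall>u w. {u, w} \<in> {e\<in>E. v \<notin> e} \<longrightarrow> edge_form \<kappa> \<theta>0 \<rho>0 \<phi> s u w = c u w) \<and>
        (\<forall>u. {v, u} \<in> E \<longrightarrow> edge_form \<kappa> \<theta>0 \<rho>0 \<phi> s v u = c v u)"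
      using \<alpha> star_two[OF star] by (intro exI[of _ "\<phi>(v := \<alpha>)"] exI[of _ s]) metis
  qed
  then show ?thesis by blast
qed

text \<open>As \<open>v\<close> approaches \<open>a\<close> on their common circle, the edge \<open>vb\<close> turns into the added edge \<open>ab\<close>.\<close>

lemma extend_contract:
  assumes E: "simple_graph V E" and star: "{e\<in>E. v \<in> e} = {{v, a}, {v, b}}" and "a \<noteq> b"
    and colours: "\<kappa> v = \<kappa> a" and ab: "{a, b} \<notin> {e\<in>E. v \<notin> e}"
    and solv: "solvable (insert {a, b} {e\<in>E. v \<notin> e}) \<kappa> \<theta>1 \<rho>1"
  shows "\<exists>\<theta> \<rho>. solvable E \<kappa> \<theta> \<rho>"
proof -
  let ?E = "insert {a, b} {e\<in>E. v \<notin> e}"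
  have in_star: "{v, a} \<in> E" "{v, b} \<in> E" using star by auto
  note ends = simple_graph_edge[OF E in_star(1)] simple_graph_edge[OF E in_star(2)]
  obtain \<theta> \<rho> where solv: "solvable ?E \<kappa> \<theta> \<rho>"
    and "radius \<kappa> \<rho> a * radius \<kappa> \<rho> b * sin (\<theta> a - \<theta> b) \<noteq> 0"
    using solvable_general_position[OF simple_graph_insert[OF E ends(2,5) \<open>a \<noteq> b\<close>] solv \<open>a \<noteq> b\<close>]
    by (elim exE conjE)
  then have Ra: "radius \<kappa> \<rho> a \<noteq> 0" by simp
  define R where "R = radius \<kappa> \<rho> a"
  have R: "R \<noteq> 0" using Ra by (simp add: R_def)
  have Rv: "radius \<kappa> \<rho> v = R" using colours by (simp add: radius_def R_def)
  define \<theta>0 where "\<theta>0 = \<theta>(v := \<theta> a)"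
  define \<theta>' where "\<theta>' t = \<theta>(v := \<theta> a + t)" for t
  \<comment> \<open>The first-order term at t = 0: the radial velocities enter with the factor 1 -
    cos t, which is of second order.\<close>
  define L where "L \<phi> s = R\<^sup>2 * (\<phi> v - \<phi> a)" for \<phi> :: "'a \<Rightarrow> real" and s :: "'b \<Rightarrow> real"
  show ?thesis
  proof (rule solvable_limit[OF E in_star(1), of \<theta>' \<theta>0 "\<lambda>_. \<rho>" \<rho> \<kappa> L])
    show "((\<lambda>t. \<theta>' t w) \<longlongrightarrow> \<theta>0 w) (at 0)" for w
      by (cases "w = v") (auto simp: \<theta>'_def \<theta>0_def intro!: tendsto_eq_intros)
    show "((\<lambda>t. \<rho> c) \<longlongrightarrow> \<rho> c) (at 0)" for c by simp
    show "((\<lambda>t. edge_form \<kappa> (\<theta>' t) \<rho> \<phi> s v a / t) \<longlongrightarrow> L \<phi> s) (at 0)" for \<phi> s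
    proof -
      have vel: "radius_velocity \<kappa> s v = radius_velocity \<kappa> s a"
        using colours by (simp add: radius_velocity_def)
      have "edge_form \<kappa> (\<theta>' t) \<rho> \<phi> s v a / t =
          R\<^sup>2 * (sin t / t) * (\<phi> v - \<phi> a) + R * ((1 - cos t) / t) * (2 * radius_velocity \<kappa> s a)" for t
        using ends(3) by (simp add: edge_form_def \<theta>'_def Rv R_def[symmetric] vel add_divide_distrib
            power2_eq_square algebra_simps diff_divide_distrib)
      moreover have "((\<lambda>t. R\<^sup>2 * (sin t / t) * (\<phi> v - \<phi> a) + R * ((1 - cos t) / t) * (2 * radius_velocity \<kappa> s a))
          \<longlongrightarrow> R\<^sup>2 * 1 * (\<phi> v - \<phi> a) + R * 0 * (2 * radius_velocity \<kappa> s a)) (at 0)"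
      proof (intro tendsto_intros)
        show "((\<lambda>t::real. sin t / t) \<longlongrightarrow> 1) (at 0)"
          using DERIV_sin[of "0::real"] unfolding DERIV_def by simp
        have "((\<lambda>t::real. (cos (0 + t) - cos 0) / t) \<longlongrightarrow> - sin 0) (at 0)"
          using DERIV_cos[of "0::real"] unfolding DERIV_def .
        from tendsto_minus[OF this] show "((\<lambda>t::real. (1 - cos t) / t) \<longlongrightarrow> 0) (at 0)"
          by (simp add: minus_divide_left)
      qed
      ultimately show ?thesis by (simp add: L_def)
    qed
    fix c :: "'a set \<Rightarrow> real"
    \<comment> \<open>The angular velocity of v relative to a that satisfies the limit of the
      equation of va.\<close>
    define \<beta> where "\<beta> = c {v, a} / R\<^sup>2"
    let ?k = "R * radius \<kappa> \<rho> b * sin (\<theta> a - \<theta> b)"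
    \<comment> \<open>The subtracted term compensates what \<beta> adds to the row of vb, which in
      the limit agrees with the row of ab otherwise.\<close>
    obtain \<phi> s where *: "\<forall>u w. {u, w} \<in> ?E \<longrightarrow>
        edge_form \<kappa> \<theta> \<rho> \<phi> s u w = (c({a, b} := c {v, b} - ?k * \<beta>)) {u, w}"
      using solv unfolding solvable_def by (elim allE[of _ "c({a, b} := c {v, b} - ?k * \<beta>)"]) blast
    define \<phi>' where "\<phi>' = \<phi>(v := \<phi> a + \<beta>)"
    have vb: "edge_form \<kappa> \<theta>0 \<rho> \<phi>' s v b = c {v, b}"
    proof -
      have "edge_form \<kappa> \<theta>0 \<rho> \<phi>' s v b = edge_form \<kappa> \<theta> \<rho> \<phi> s a b + ?k * \<beta>"
        using ends colours
        by (simp add: edge_form_def \<theta>0_def \<phi>'_def radius_velocity_def Rv R_def[symmetric] algebra_simps)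
      also have "edge_form \<kappa> \<theta> \<rho> \<phi> s a b = c {v, b} - ?k * \<beta>" using * by simp
      finally show ?thesis by simp
    qed
    have "edge_form \<kappa> \<theta>0 \<rho> \<phi>' s u w = c {u, w}" if uw: "{u, w} \<in> E - {{v, a}}" for u w
    proof -
      consider "v \<notin> {u, w}" | "u = v" | "w = v" by auto
      then show ?thesis
      proof cases
        case 1
        then have uw': "{u, w} \<in> {e\<in>E. v \<notin> e}" using uw by simp
        have "{u, w} \<noteq> {a, b}"
          by (rule notI, rule notE[OF ab], erule subst, rule uw')
        from trans[OF *[rule_format, OF insertI2[OF uw']] fun_upd_other[OF this]]
        have "edge_form \<kappa> \<theta> \<rho> \<phi> s u w = c {u, w}" .
        then show ?thesis using 1 unfolding \<theta>0_def \<phi>'_def by (subst edge_form_upd) auto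
      next
        case 2
        then have "w = b" using star_two[OF star, of w] uw by auto
        then show ?thesis using vb 2 by simp
      next
        case 3
        then have "u = b" using star_two[OF star, of u] uw by (auto simp: insert_commute)
        then show ?thesis using vb 3 edge_form_commute[of \<kappa> \<theta>0 \<rho> \<phi>' s b v]
          by (simp add: insert_commute)
      qed
    qed
    moreover have "L \<phi>' s = c {v, a}" using R ends(3) by (simp add: L_def \<phi>'_def \<beta>_def)
    ultimately show "\<exists>\<phi> s. (\<forall>u w. {u, w} \<in> E - {{v, a}} \<longrightarrow> edge_form \<kappa> \<theta>0 \<rho> \<phi> s u w = c {u, w}) \<and>
        L \<phi> s = c {v, a}" by blast
  qed
qed

section \<open>Complex notation for points and velocities\<close>

definition position :: "('v \<Rightarrow> 'c option) \<Rightarrow> ('v \<Rightarrow> real) \<Rightarrow> ('c \<Rightarrow> real) \<Rightarrow> 'v \<Rightarrow> complex" where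
  "position \<kappa> \<theta> \<rho> v = of_real (radius \<kappa> \<rho> v) * cis (\<theta> v)"

text \<open>The derivative of r * cis \<theta> when r and \<theta> change at the rates s and
  \<phi>.\<close>

definition velocity ::
    "('v \<Rightarrow> 'c option) \<Rightarrow> ('v \<Rightarrow> real) \<Rightarrow> ('c \<Rightarrow> real) \<Rightarrow> ('v \<Rightarrow> real) \<Rightarrow> ('c \<Rightarrow> real) \<Rightarrow> 'v \<Rightarrow> complex" where
  "velocity \<kappa> \<theta> \<rho> \<phi> s v = Complex (radius_velocity \<kappa> s v) (radius \<kappa> \<rho> v * \<phi> v) * cis (\<theta> v)"

text \<open>Re (cnj z * w) is the scalar product of the plane, so \<open>edge_form\<close> is the
  rigidity row of the edge in polar coordinates.\<close>

lemma edge_form_complex: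
  "edge_form \<kappa> \<theta> \<rho> \<phi> s u v = Re (cnj (position \<kappa> \<theta> \<rho> u - position \<kappa> \<theta> \<rho> v) *
     (velocity \<kappa> \<theta> \<rho> \<phi> s u - velocity \<kappa> \<theta> \<rho> \<phi> s v))"
proof -
  have *: "cos x * cos x = 1 - sin x * sin x" for x :: real
    using sin_cos_squared_add[of x] by (simp add: power2_eq_square algebra_simps)
  have **: "cos x * (cos x * y) = y - sin x * (sin x * y)" for x y :: real
    using *[of x] by (metis left_diff_distrib mult.assoc mult_1)
  show ?thesis
    by (simp add: edge_form_def position_def velocity_def sin_diff cos_diff algebra_simps * **)
qed

text \<open>Ties the coefficient in \<open>edge_form_solve\<close> to the cross product of the two
  points.\<close>

lemma cross_position:
  "Im (cnj (position \<kappa> \<theta> \<rho> u) * position \<kappa> \<theta> \<rho> v) = radius \<kappa> \<rho> v * radius \<kappa> \<rho> u * sin (\<theta> v - \<theta> u)"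
  by (simp add: position_def sin_diff algebra_simps)

text \<open>With D = b - a one has v - a = \<mu> D and v - b = -(1 - \<mu>) D. Once rescaled, the
  two rows at v are scalar products with the same vector D, and they telescope.\<close>

lemma edge_form_collinear:
  assumes v: "position \<kappa> \<theta> \<rho> v = (1 - of_real \<mu>) * position \<kappa> \<theta> \<rho> a + of_real \<mu> * position \<kappa> \<theta> \<rho> b"
    and "\<mu> \<noteq> 0" "\<mu> \<noteq> 1"
  shows "edge_form \<kappa> \<theta> \<rho> \<phi> s a b =
    edge_form \<kappa> \<theta> \<rho> \<phi> s v a / \<mu> + edge_form \<kappa> \<theta> \<rho> \<phi> s v b / (1 - \<mu>)"
proof -
  let ?P = "position \<kappa> \<theta> \<rho>" and ?W = "velocity \<kappa> \<theta> \<rho> \<phi> s"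
  define D where "D = ?P b - ?P a"
  have Pa: "?P v - ?P a = of_real \<mu> * D" and Pb: "?P v - ?P b = - (of_real (1 - \<mu>) * D)"
    using v by (simp_all add: D_def algebra_simps)
  have "edge_form \<kappa> \<theta> \<rho> \<phi> s v a = \<mu> * Re (cnj D * (?W v - ?W a))"
    unfolding edge_form_complex Pa by (simp add: algebra_simps)
  moreover have "edge_form \<kappa> \<theta> \<rho> \<phi> s v b = (1 - \<mu>) * - Re (cnj D * (?W v - ?W b))"
    unfolding edge_form_complex Pb by (simp add: algebra_simps)
  moreover have "edge_form \<kappa> \<theta> \<rho> \<phi> s a b = Re (cnj D * (?W v - ?W a)) + - Re (cnj D * (?W v - ?W b))"
    unfolding edge_form_complex D_def by (simp add: algebra_simps)
  ultimately show ?thesis using assms(2,3) by simp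
qed

text \<open>For \<open>v\<close> on the line \<open>ab\<close>, the rows of \<open>va\<close> and \<open>vb\<close> span that of \<open>ab\<close>.\<close>

lemma extend_line:
  assumes E: "simple_graph V E" and star: "{e\<in>E. v \<in> e} = {{v, a}, {v, b}}" and "a \<noteq> b"
    and colours: "\<kappa> v \<noteq> \<kappa> a" "\<kappa> v \<noteq> \<kappa> b" and ab: "{a, b} \<notin> {e\<in>E. v \<notin> e}"
    and solv: "solvable (insert {a, b} {e\<in>E. v \<notin> e}) \<kappa> \<theta>1 \<rho>1"
  shows "\<exists>\<theta> \<rho>. solvable E \<kappa> \<theta> \<rho>"
proof -
  let ?E = "insert {a, b} {e\<in>E. v \<notin> e}"
  have in_star: "{v, a} \<in> E" "{v, b} \<in> E" using star by auto
  note ends = simple_graph_edge[OF E in_star(1)] simple_graph_edge[OF E in_star(2)]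
  \<comment> \<open>The circle of v is to enclose a and b: then it meets the line ab, but in neither
    of these points. The assumption that v shares no colour with a or b makes this possible.\<close>
  define ok where "ok \<theta> \<rho> \<longleftrightarrow> radius \<kappa> \<rho> a > 0 \<and> radius \<kappa> \<rho> b > 0 \<and> radius \<kappa> \<rho> v - radius \<kappa> \<rho> a > 0 \<and>
      radius \<kappa> \<rho> v - radius \<kappa> \<rho> b > 0 \<and> sin (\<theta> b - \<theta> a) > 0"
    for \<theta> :: "'a \<Rightarrow> real" and \<rho> :: "'b \<Rightarrow> real"
  \<comment> \<open>An uncoloured v has radius 1, so all colours get 1/2. Otherwise the colour of v
    gets 2, which also exceeds the radius 1 of uncoloured vertices.\<close>
  define \<rho>2 where "\<rho>2 c = (case \<kappa> v of None \<Rightarrow> 1 / 2 | Some c' \<Rightarrow> if c = c' then 2 else (1::real))" for c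
  have base: "ok (\<lambda>w. if w = b then pi / 2 else 0) \<rho>2"
    using colours \<open>a \<noteq> b\<close> unfolding ok_def radius_def \<rho>2_def
    by (cases "\<kappa> v"; cases "\<kappa> a"; cases "\<kappa> b") auto
  have "\<exists>\<theta> \<rho>. solvable ?E \<kappa> \<theta> \<rho> \<and> ok \<theta> \<rho>"
  proof (rule solvable_near[OF simple_graph_insert[OF E ends(2,5) \<open>a \<noteq> b\<close>] solv])
    fix \<theta> :: "real \<Rightarrow> 'a \<Rightarrow> real" and \<rho> :: "real \<Rightarrow> 'b \<Rightarrow> real"
    assume \<theta>: "\<And>w. ((\<lambda>t. \<theta> t w) \<longlongrightarrow> (if w = b then pi / 2 else 0)) (at 0)"
      and \<rho>: "\<And>c. ((\<lambda>t. \<rho> t c) \<longlongrightarrow> \<rho>2 c) (at 0)"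
    have r: "((\<lambda>t. radius \<kappa> (\<rho> t) w) \<longlongrightarrow> radius \<kappa> \<rho>2 w) (at 0)" for w
      by (intro tendsto_radius \<rho>)
    note pos = order_tendstoD(1)[where a = 0]
    from base show "\<forall>\<^sub>F t in at 0. ok (\<theta> t) (\<rho> t)"
      unfolding ok_def eventually_conj_iff
      by (elim conjE) (intro conjI pos[OF r] pos[OF tendsto_diff[OF r r]]
          pos[OF tendsto_sin[OF tendsto_diff[OF \<theta> \<theta>]]])
  qed
  then obtain \<theta> \<rho> where solv: "solvable ?E \<kappa> \<theta> \<rho>" and "ok \<theta> \<rho>" by blast
  then have r: "radius \<kappa> \<rho> a > 0" "radius \<kappa> \<rho> b > 0" "radius \<kappa> \<rho> v > radius \<kappa> \<rho> a"
    "radius \<kappa> \<rho> v > radius \<kappa> \<rho> b" and sin: "sin (\<theta> b - \<theta> a) > 0"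
    by (auto simp: ok_def)
  define A where "A = position \<kappa> \<theta> \<rho> a"
  define B where "B = position \<kappa> \<theta> \<rho> b"
  have nA: "cmod A = radius \<kappa> \<rho> a" "cmod B = radius \<kappa> \<rho> b"
    using r by (simp_all add: A_def B_def position_def norm_mult)
  have cross: "Im (cnj A * B) \<noteq> 0"
    using r sin unfolding A_def B_def cross_position by simp
  have "A \<noteq> B"
  proof
    assume "A = B"
    with cross have "Im (cnj B * B) \<noteq> 0" by simp
    then show False by simp
  qed
  \<comment> \<open>Distance from the centre along the line ab. At 0 it is below the radius of v; by
    the triangle inequality \<open>T\<close> is far enough out for it to reach that radius.\<close>
  define f where "f \<mu> = cmod (A + of_real \<mu> * (B - A))" for \<mu>
  define T where "T = (radius \<kappa> \<rho> v + cmod A) / cmod (B - A)"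
  have d: "cmod (B - A) > 0" using \<open>A \<noteq> B\<close> by simp
  have T: "T \<ge> 0" using r nA by (simp add: T_def)
  have "radius \<kappa> \<rho> v + cmod A = T * cmod (B - A)" using d by (simp add: T_def)
  also have "\<dots> = cmod (of_real T * (B - A))" using T by (simp add: norm_mult)
  also have "\<dots> = cmod ((A + of_real T * (B - A)) - A)" by simp
  also have "\<dots> \<le> f T + cmod A" unfolding f_def by (rule norm_triangle_ineq4)
  finally have "radius \<kappa> \<rho> v \<le> f T" by simp
  moreover have "f 0 \<le> radius \<kappa> \<rho> v" using r nA by (simp add: f_def)
  moreover have "continuous_on {0..T} f" unfolding f_def by (intro continuous_intros)
  ultimately obtain \<mu> where \<mu>: "f \<mu> = radius \<kappa> \<rho> v" using IVT'[of f 0 _ T] T by blast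
  have \<mu>01: "\<mu> \<noteq> 0" "\<mu> \<noteq> 1" using \<mu> r nA by (auto simp: f_def)
  define \<theta>0 where "\<theta>0 = \<theta>(v := Arg (A + of_real \<mu> * (B - A)))"
  have PA: "position \<kappa> \<theta>0 \<rho> a = A" and PB: "position \<kappa> \<theta>0 \<rho> b = B"
    using ends by (simp_all add: \<theta>0_def A_def B_def position_def)
  have PV: "position \<kappa> \<theta>0 \<rho> v = A + of_real \<mu> * (B - A)"
    using rcis_cmod_Arg[of "A + of_real \<mu> * (B - A)"] \<mu> by (simp add: position_def \<theta>0_def f_def rcis_def)
  have col: "position \<kappa> \<theta>0 \<rho> v = (1 - of_real \<mu>) * position \<kappa> \<theta>0 \<rho> a + of_real \<mu> * position \<kappa> \<theta>0 \<rho> b"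
    unfolding PA PB PV by (simp add: algebra_simps)
  \<comment> \<open>Since \<mu> is nonzero and the line ab misses the centre, v is not collinear
    with a and the centre.\<close>
  have "radius \<kappa> \<rho> v * radius \<kappa> \<rho> a * sin (\<theta>0 v - \<theta>0 a) = \<mu> * Im (cnj A * B)"
    unfolding cross_position[symmetric] PA PV by (simp add: algebra_simps)
  then have g: "radius \<kappa> \<rho> v * radius \<kappa> \<rho> a * sin (\<theta>0 v - \<theta>0 a) \<noteq> 0" using cross \<mu>01 by simp
  have "solvable E \<kappa> \<theta>0 \<rho>"
  proof (rule solvableI[of E v])
    fix c :: "'a \<Rightarrow> 'a \<Rightarrow> real" assume c: "\<And>u w. c u w = c w u"
    \<comment> \<open>The value on ab which, by collinearity, becomes the required equation of vb
      once that of va holds.\<close>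
    define c' where "c' u w = (if {u, w} = {a, b} then c v a / \<mu> + c v b / (1 - \<mu>) else c u w)" for u w
    have c': "c' u w = c' w u" for u w using c by (simp add: c'_def insert_commute)
    obtain \<phi> s where *: "\<forall>u w. {u, w} \<in> ?E \<longrightarrow> edge_form \<kappa> \<theta> \<rho> \<phi> s u w = c' u w"
      using solvable_symmetric[where b = c', OF solv c'] by blast
    from edge_form_solve[OF g, of \<phi> s "c v a"]
    obtain \<alpha> where \<alpha>: "edge_form \<kappa> \<theta>0 \<rho> (\<phi>(v := \<alpha>)) s v a = c v a" by blast
    have old: "edge_form \<kappa> \<theta>0 \<rho> (\<phi>(v := \<alpha>)) s u w = c' u w" if "{u, w} \<in> ?E" for u w
    proof -
      have "v \<noteq> u" "v \<noteq> w" using that ends by (auto simp: doubleton_eq_iff)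
      then show ?thesis using * that unfolding \<theta>0_def by (subst edge_form_upd) auto
    qed
    have "edge_form \<kappa> \<theta>0 \<rho> (\<phi>(v := \<alpha>)) s u w = c u w" if "{u, w} \<in> {e\<in>E. v \<notin> e}" for u w
      using old[of u w] that ab unfolding c'_def by (metis insertI2)
    moreover have "edge_form \<kappa> \<theta>0 \<rho> (\<phi>(v := \<alpha>)) s v b = c v b"
      using edge_form_collinear[OF col \<mu>01, of "\<phi>(v := \<alpha>)" s] old[of a b] \<mu>01 \<alpha>
      by (simp add: c'_def)
    ultimately show "\<exists>\<phi> s. (\<forall>u w. {u, w} \<in> {e\<in>E. v \<notin> e} \<longrightarrow> edge_form \<kappa> \<theta>0 \<rho> \<phi> s u w = c u w) \<and>
        (\<forall>u. {v, u} \<in> E \<longrightarrow> edge_form \<kappa> \<theta>0 \<rho> \<phi> s v u = c v u)"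
      using \<alpha> star_two[OF star] by (intro exI[of _ "\<phi>(v := \<alpha>)"] exI[of _ s]) metis
  qed
  then show ?thesis by blast
qed

text \<open>Cramer's rule: multiplication by the imaginary unit is a quarter turn and exchanges
  scalar and cross products up to sign.\<close>

lemma real_linear_system_complex:
  assumes "Im (cnj A * B) \<noteq> 0"
  shows "\<exists>W. Re (cnj A * W) = k \<and> Re (cnj B * W) = l"
proof -
  define Z where "Z = \<i> * (of_real l * A - of_real k * B)"
  define x where "x = Im (cnj A * B)"
  have Z: "Re (cnj A * Z) = k * x" "Re (cnj B * Z) = l * x"
    by (simp_all add: Z_def x_def algebra_simps)
  have "Re (C * (of_real (1 / x) * Z)) = Re (C * Z) / x" for C
    by (simp add: diff_divide_distrib)
  then have "Re (cnj A * (of_real (1 / x) * Z)) = k" "Re (cnj B * (of_real (1 / x) * Z)) = l"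
    using assms by (simp_all only: Z) (simp_all add: x_def)
  then show ?thesis by blast
qed

text \<open>As no other vertex has the colour of v, both coordinates of v and of its velocity are
  free. With v at the midpoint of ab, the rows of va and vb combine to that of ab. The velocity of v
  is chosen to solve va and vd, and vb then follows from the equation on ab.\<close>

lemma extend_unique_colour:
  assumes E: "simple_graph V E" and star: "{e\<in>E. v \<in> e} = {{v, a}, {v, b}, {v, d}}"
    and distinct: "a \<noteq> b" "a \<noteq> d" "b \<noteq> d"
    and colour: "\<kappa> v = Some x" "\<And>w. w \<in> V \<Longrightarrow> \<kappa> w = Some x \<Longrightarrow> w = v"
    and ab: "{a, b} \<notin> {e\<in>E. v \<notin> e}"
    and solv: "solvable (insert {a, b} {e\<in>E. v \<notin> e}) \<kappa> \<theta>1 \<rho>1"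
  shows "\<exists>\<theta> \<rho>. solvable E \<kappa> \<theta> \<rho>"
proof -
  let ?E = "insert {a, b} {e\<in>E. v \<notin> e}"
  have in_star: "{v, a} \<in> E" "{v, b} \<in> E" "{v, d} \<in> E" using star by auto
  note ends = simple_graph_edge[OF E in_star(1)] simple_graph_edge[OF E in_star(2)]
    simple_graph_edge[OF E in_star(3)]
  have G: "simple_graph V ?E" by (rule simple_graph_insert[OF E ends(2,5) distinct(1)])
  \<comment> \<open>The first factor keeps the midpoint of ab away from the centre, the second keeps
    a, b and d off a common line.\<close>
  define g where "g \<theta> \<rho> = radius \<kappa> \<rho> a * radius \<kappa> \<rho> b * sin (\<theta> a - \<theta> b) *
      ((radius \<kappa> \<rho> b * cos (\<theta> b) - radius \<kappa> \<rho> a * cos (\<theta> a)) * (radius \<kappa> \<rho> d * sin (\<theta> d) - radius \<kappa> \<rho> a * sin (\<theta> a)) -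
       (radius \<kappa> \<rho> b * sin (\<theta> b) - radius \<kappa> \<rho> a * sin (\<theta> a)) * (radius \<kappa> \<rho> d * cos (\<theta> d) - radius \<kappa> \<rho> a * cos (\<theta> a)))"
    for \<theta> :: "'a \<Rightarrow> real" and \<rho>
  \<comment> \<open>Places a, b, d at 1, i, -1 on the unit circle.\<close>
  let ?\<theta> = "\<lambda>w. if w = b then pi / 2 else if w = d then pi else 0"
  have "\<exists>\<theta> \<rho>. solvable ?E \<kappa> \<theta> \<rho> \<and> g \<theta> \<rho> \<noteq> 0"
  proof (rule solvable_near[OF G solv])
    fix \<theta> :: "real \<Rightarrow> 'a \<Rightarrow> real" and \<rho> :: "real \<Rightarrow> 'b \<Rightarrow> real"
    assume \<theta>: "\<And>w. ((\<lambda>t. \<theta> t w) \<longlongrightarrow> ?\<theta> w) (at 0)"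
      and \<rho>: "\<And>c. ((\<lambda>t. \<rho> t c) \<longlongrightarrow> 1) (at 0)"
    have "((\<lambda>t. g (\<theta> t) (\<rho> t)) \<longlongrightarrow> g ?\<theta> (\<lambda>_. 1)) (at 0)"
      unfolding g_def by (intro tendsto_mult tendsto_radius tendsto_sin tendsto_cos tendsto_diff \<theta> \<rho>)
    moreover have "radius \<kappa> (\<lambda>_. 1::real) w = 1" for w by (simp add: radius_def split: option.split)
    then have "g ?\<theta> (\<lambda>_. 1) \<noteq> 0" using distinct by (simp add: g_def)
    ultimately show "\<forall>\<^sub>F t in at 0. g (\<theta> t) (\<rho> t) \<noteq> 0" by (rule tendsto_imp_eventually_ne)
  qed
  then obtain \<theta> \<rho> where solv: "solvable ?E \<kappa> \<theta> \<rho>" and g: "g \<theta> \<rho> \<noteq> 0" by blast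
  define A where "A = position \<kappa> \<theta> \<rho> a"
  define B where "B = position \<kappa> \<theta> \<rho> b"
  define Q where "Q = position \<kappa> \<theta> \<rho> d"
  define M where "M = (A + B) / 2"
  have "Im (cnj B * A) = radius \<kappa> \<rho> a * radius \<kappa> \<rho> b * sin (\<theta> a - \<theta> b)"
    unfolding A_def B_def by (rule cross_position)
  moreover have "Im (cnj (B - A) * (Q - A)) =
      ((radius \<kappa> \<rho> b * cos (\<theta> b) - radius \<kappa> \<rho> a * cos (\<theta> a)) * (radius \<kappa> \<rho> d * sin (\<theta> d) - radius \<kappa> \<rho> a * sin (\<theta> a)) -
       (radius \<kappa> \<rho> b * sin (\<theta> b) - radius \<kappa> \<rho> a * sin (\<theta> a)) * (radius \<kappa> \<rho> d * cos (\<theta> d) - radius \<kappa> \<rho> a * cos (\<theta> a)))"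
    by (simp add: A_def B_def Q_def position_def algebra_simps)
  ultimately have cross: "Im (cnj B * A) \<noteq> 0" "Im (cnj (B - A) * (Q - A)) \<noteq> 0"
    using g unfolding g_def by auto
  have "M \<noteq> 0"
  proof
    assume "M = 0"
    then have "B = - A" by (simp add: M_def eq_neg_iff_add_eq_0 add.commute)
    then show False using cross(1) by simp
  qed
  have MQ: "Im (cnj (M - A) * (M - Q)) \<noteq> 0"
  proof -
    have "Im (cnj (M - A) * (M - Q)) = - Im (cnj (B - A) * (Q - A)) / 2"
      by (simp add: M_def field_simps)
    then show ?thesis using cross(2) by simp
  qed
  define \<theta>0 where "\<theta>0 = \<theta>(v := Arg M)"
  define \<rho>0 where "\<rho>0 = \<rho>(x := cmod M)"
  have r: "radius \<kappa> \<rho>0 w = radius \<kappa> \<rho> w" if "w \<in> V" "w \<noteq> v" for w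
    using colour that by (auto simp: radius_def \<rho>0_def split: option.split)
  have rv: "radius \<kappa> \<rho>0 v = cmod M" using colour by (simp add: radius_def \<rho>0_def)
  have PA: "position \<kappa> \<theta>0 \<rho>0 a = A" and PB: "position \<kappa> \<theta>0 \<rho>0 b = B" and PQ: "position \<kappa> \<theta>0 \<rho>0 d = Q"
    using ends r by (simp_all add: \<theta>0_def A_def B_def Q_def position_def)
  have PV: "position \<kappa> \<theta>0 \<rho>0 v = M"
    using rcis_cmod_Arg[of M] rv by (simp add: position_def \<theta>0_def rcis_def)
  have col: "position \<kappa> \<theta>0 \<rho>0 v = (1 - of_real (1/2)) * position \<kappa> \<theta>0 \<rho>0 a + of_real (1/2) * position \<kappa> \<theta>0 \<rho>0 b"
    unfolding PA PB PV by (simp add: M_def field_simps)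
  have "solvable E \<kappa> \<theta>0 \<rho>0"
  proof (rule solvableI[of E v])
    fix c :: "'a \<Rightarrow> 'a \<Rightarrow> real" assume c: "\<And>u w. c u w = c w u"
    \<comment> \<open>At the midpoint both 1 / \<mu> and 1 / (1 - \<mu>) equal 2.\<close>
    define c' where "c' u w = (if {u, w} = {a, b} then 2 * c v a + 2 * c v b else c u w)" for u w
    have c': "c' u w = c' w u" for u w using c by (simp add: c'_def insert_commute)
    obtain \<phi> s where *: "\<forall>u w. {u, w} \<in> ?E \<longrightarrow> edge_form \<kappa> \<theta> \<rho> \<phi> s u w = c' u w"
      using solvable_symmetric[where b = c', OF solv c'] by blast
    let ?W = "velocity \<kappa> \<theta> \<rho> \<phi> s"
    obtain W where W: "Re (cnj (M - A) * W) = c v a + Re (cnj (M - A) * ?W a)"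
      "Re (cnj (M - Q) * W) = c v d + Re (cnj (M - Q) * ?W d)"
      using real_linear_system_complex[OF MQ] by blast
    \<comment> \<open>\<open>W\<close> in the polar frame of v: the real part is the radial
      velocity, the imaginary part the radius times the angular velocity.\<close>
    define W' where "W' = W * cnj (cis (Arg M))"
    define \<phi>' where "\<phi>' = \<phi>(v := Im W' / cmod M)"
    define s' where "s' = s(x := Re W')"
    have vel: "radius_velocity \<kappa> s' w = radius_velocity \<kappa> s w" if "w \<in> V" "w \<noteq> v" for w
      using colour that by (auto simp: radius_velocity_def s'_def split: option.split)
    have VV: "velocity \<kappa> \<theta>0 \<rho>0 \<phi>' s' w = ?W w" if "w \<in> V" "w \<noteq> v" for w
      using that r vel by (simp add: velocity_def \<theta>0_def \<phi>'_def)
    have "velocity \<kappa> \<theta>0 \<rho>0 \<phi>' s' v = W' * cis (Arg M)"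
      using \<open>M \<noteq> 0\<close> colour rv
      by (simp add: velocity_def \<theta>0_def \<phi>'_def s'_def radius_velocity_def complex_eq_iff)
    also have "\<dots> = W" by (simp add: W'_def cis_cnj mult.assoc cis_mult)
    finally have Wv: "velocity \<kappa> \<theta>0 \<rho>0 \<phi>' s' v = W" .
    have old: "edge_form \<kappa> \<theta>0 \<rho>0 \<phi>' s' u w = c' u w" if uw: "{u, w} \<in> ?E" for u w
    proof -
      have "v \<noteq> u" "v \<noteq> w" using uw ends by (auto simp: doubleton_eq_iff)
      moreover have "u \<in> V" "w \<in> V" using simple_graph_edge[OF G uw] by auto
      ultimately have "edge_form \<kappa> \<theta>0 \<rho>0 \<phi>' s' u w = edge_form \<kappa> \<theta> \<rho> \<phi> s u w"
        by (intro edge_form_cong) (auto simp: \<theta>0_def \<phi>'_def r vel)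
      also have "\<dots> = c' u w" using *[rule_format, OF uw] .
      finally show ?thesis .
    qed
    have away: "edge_form \<kappa> \<theta>0 \<rho>0 \<phi>' s' u w = c u w" if uw: "{u, w} \<in> {e\<in>E. v \<notin> e}" for u w
    proof -
      have "c' u w = c u w" using ab uw by (metis c'_def)
      then show ?thesis using old[of u w] uw by simp
    qed
    have va: "edge_form \<kappa> \<theta>0 \<rho>0 \<phi>' s' v a = c v a"
      unfolding edge_form_complex PA PV Wv using VV[of a] ends W(1) by (simp add: right_diff_distrib)
    have vd: "edge_form \<kappa> \<theta>0 \<rho>0 \<phi>' s' v d = c v d"
      unfolding edge_form_complex PQ PV Wv using VV[of d] ends W(2) by (simp add: right_diff_distrib)
    have vb: "edge_form \<kappa> \<theta>0 \<rho>0 \<phi>' s' v b = c v b"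
      using edge_form_collinear[OF col, of \<phi>' s'] old[of a b] va by (simp add: c'_def)
    have nbr: "edge_form \<kappa> \<theta>0 \<rho>0 \<phi>' s' v u = c v u" if "u \<in> {a, b, d}" for u
      using that va vb vd by (elim insertE emptyE) simp_all
    have "edge_form \<kappa> \<theta>0 \<rho>0 \<phi>' s' v u = c v u" if "{v, u} \<in> E" for u
    proof (rule nbr)
      have "{v, u} \<in> {e\<in>E. v \<in> e}" using that by simp
      then show "u \<in> {a, b, d}" unfolding star by (auto simp: doubleton_eq_iff)
    qed
    with away show "\<exists>\<phi> s. (\<forall>u w. {u, w} \<in> {e\<in>E. v \<notin> e} \<longrightarrow> edge_form \<kappa> \<theta>0 \<rho>0 \<phi> s u w = c u w) \<and>
        (\<forall>u. {v, u} \<in> E \<longrightarrow> edge_form \<kappa> \<theta>0 \<rho>0 \<phi> s v u = c v u)"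
      by (intro exI[of _ \<phi>'] exI[of _ s'] conjI allI impI)
  qed
  then show ?thesis by blast
qed

section \<open>Solvable positions of sparse graphs\<close>

text \<open>A colour not carried by \<open>D\<close> can be merged with another one or erased, and
  \<open>D\<close> still meets every colour at most once and no uncoloured vertex. If v and a differ
  in colour, the free colour is merged with the other; if they agree, it is erased.\<close>

lemma extend_degree_two:
  assumes E: "simple_graph V E" and star: "{e\<in>E. v \<in> e} = {{v, a}, {v, b}}" and "a \<noteq> b"
    and D: "inj_on \<kappa> D" "None \<notin> \<kappa> ` D"
    and free: "(\<kappa> v \<noteq> None \<and> \<kappa> v \<notin> \<kappa> ` D) \<or> (\<kappa> a \<noteq> None \<and> \<kappa> a \<notin> \<kappa> ` D)"
    and IH: "\<And>\<kappa>' :: 'v \<Rightarrow> 'c option. inj_on \<kappa>' D \<Longrightarrow> None \<notin> \<kappa>' ` D \<Longrightarrow>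
      \<exists>\<theta> \<rho>. solvable {e\<in>E. v \<notin> e} \<kappa>' \<theta> \<rho>"
  shows "\<exists>\<theta> \<rho>. solvable E (\<kappa> :: 'v \<Rightarrow> 'c option) \<theta> \<rho>"
proof -
  have merged: "\<exists>\<theta> \<rho>. solvable {e\<in>E. v \<notin> e} (merge_colour x y \<kappa>) \<theta> \<rho>" if "Some x \<notin> \<kappa> ` D" for x y
  proof (rule IH)
    have eq: "merge_colour x y \<kappa> w = \<kappa> w" if "w \<in> D" for w
      using that \<open>Some x \<notin> \<kappa> ` D\<close> by (force simp: merge_colour_def)
    show "inj_on (merge_colour x y \<kappa>) D" using D(1) eq by (simp cong: inj_on_cong)
    show "None \<notin> merge_colour x y \<kappa> ` D" using D(2) eq by (simp cong: image_cong)
  qed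
  show ?thesis
  proof (cases "\<kappa> v = \<kappa> a")
    case True
    then obtain x where x: "\<kappa> v = Some x" "\<kappa> a = Some x" "Some x \<notin> \<kappa> ` D" using free by auto
    obtain \<theta> \<rho> where "solvable {e\<in>E. v \<notin> e} (merge_colour x None \<kappa>) \<theta> \<rho>"
      using merged[OF x(3), of None] by blast
    then show ?thesis by (rule extend_uncolour[OF E star \<open>a \<noteq> b\<close> x(1,2)])
  next
    case False
    from free have "\<exists>x y. ((\<kappa> v = Some x \<and> \<kappa> a = y) \<or> (\<kappa> v = y \<and> \<kappa> a = Some x)) \<and> Some x \<notin> \<kappa> ` D"
    proof
      assume *: "\<kappa> v \<noteq> None \<and> \<kappa> v \<notin> \<kappa> ` D"
      then obtain x where "\<kappa> v = Some x" by auto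
      with * show ?thesis by (intro exI[of _ x] exI[of _ "\<kappa> a"]) simp
    next
      assume *: "\<kappa> a \<noteq> None \<and> \<kappa> a \<notin> \<kappa> ` D"
      then obtain x where "\<kappa> a = Some x" by auto
      with * show ?thesis by (intro exI[of _ x] exI[of _ "\<kappa> v"]) simp
    qed
    then obtain x y where xy: "(\<kappa> v = Some x \<and> \<kappa> a = y) \<or> (\<kappa> v = y \<and> \<kappa> a = Some x)" "Some x \<notin> \<kappa> ` D"
      by blast
    have "y \<noteq> Some x" using xy(1) False by auto
    obtain \<theta> \<rho> where "solvable {e\<in>E. v \<notin> e} (merge_colour x y \<kappa>) \<theta> \<rho>"
      using merged[OF xy(2), of y] by blast
    then show ?thesis by (rule extend_merge[OF E star \<open>a \<noteq> b\<close> xy(1) \<open>y \<noteq> Some x\<close>])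
  qed
qed

lemma star_image:
  assumes "simple_graph V E"
  shows "{e\<in>E. v \<in> e} = (\<lambda>u. {v, u}) ` {u. {v, u} \<in> E}"
proof
  show "{e\<in>E. v \<in> e} \<subseteq> (\<lambda>u. {v, u}) ` {u. {v, u} \<in> E}"
  proof
    fix e assume e: "e \<in> {e\<in>E. v \<in> e}"
    then have eE: "e \<in> E" "v \<in> e" by auto
    obtain x y where "e = {x, y}" using simple_graph_edgeE[OF assms eE(1)] .
    then have "e = {v, x} \<or> e = {v, y}" using eE(2) by auto
    then show "e \<in> (\<lambda>u. {v, u}) ` {u. {v, u} \<in> E}" using eE(1) by auto
  qed
qed auto

lemma card_star:
  assumes "simple_graph V E"
  shows "card {e\<in>E. v \<in> e} = card {u. {v, u} \<in> E}"
  unfolding star_image[OF assms] by (rule card_image) (auto simp: inj_on_def doubleton_eq_iff)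

lemma simple_graph_delete_vertex:
  assumes "simple_graph V E"
  shows "simple_graph (V - {v}) {e\<in>E. v \<notin> e}"
  using assms by (auto simp: simple_graph_def)

text \<open>The colouring is generalised in the induction because the step changes it, whereas
  sparsity mentions only \<open>D\<close>. A vertex of degree 2 has degree 2 in the cone if it lies
  in \<open>D\<close>, and 3 otherwise; the vertex of degree 3 lies in \<open>D\<close> and keeps
  its degree.\<close>

lemma exists_solvable:
  fixes \<kappa> :: "'v \<Rightarrow> 'c option"
  assumes "simple_graph V E" "z \<notin> V" "D \<subseteq> V" "inj_on \<kappa> D" "None \<notin> \<kappa> ` D"
    and "laman_sparse (insert z V) (E \<union> cone_edges z (V - D))"
  shows "\<exists>\<theta> \<rho>. solvable E \<kappa> \<theta> \<rho>"
  using assms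
proof (induction "card V" arbitrary: V E \<kappa> D rule: less_induct)
  case less
  note E = less.prems(1) and z = less.prems(2) and DV = less.prems(3) and inj = less.prems(4)
    and None = less.prems(5) and sparse = less.prems(6)
  have V: "finite V" using E by (simp add: simple_graph_def)
  have finE: "finite E" using simple_graph_finite_edges[OF E] .
  let ?H = "E \<union> cone_edges z (V - D)"
  have H: "simple_graph (insert z V) ?H"
    using E z by (auto simp: simple_graph_def cone_edges_def card_insert_if)
  have finH: "finite ?H" using simple_graph_finite_edges[OF H] .
  have zE: "z \<notin> e" if "e \<in> E" for e using that E z by (auto simp: simple_graph_def)
  show ?case
  proof (cases "V = {}")
    case True
    then have "E = {}" using E by (auto simp: simple_graph_def)
    then have "solvable E \<kappa> \<theta> \<rho>" for \<theta> \<rho> by (simp add: solvable_def)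
    then show ?thesis by blast
  next
    case False
    have "card {e\<in>?H. e \<subseteq> insert z V} + 3 \<le> 2 * card (insert z V)"
    proof -
      have "0 < card V" using False V by (simp add: card_gt_0_iff)
      then have "2 \<le> card (insert z V)" using V z by simp
      then show ?thesis using sparse unfolding laman_sparse_def by (elim allE impE) auto
    qed
    moreover have "{e\<in>?H. e \<subseteq> insert z V} = ?H" using H by (auto simp: simple_graph_def)
    moreover have "card ?H = card E + card (V - D)"
    proof -
      have "card (cone_edges z (V - D)) = card (V - D)"
        unfolding cone_edges_def by (rule card_image) (auto simp: inj_on_def doubleton_eq_iff)
      moreover have "E \<inter> cone_edges z (V - D) = {}" using zE by (auto simp: cone_edges_def)
      ultimately show ?thesis using finH by (simp add: card_Un_disjoint)
    qed
    \<comment> \<open>The Laman count 2(|V| + 1) - 3 of the whole cone.\<close>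
    ultimately have "card E + card (V - D) + 1 \<le> 2 * card V" using V z by simp
    from low_degree_vertex[OF E False DV inj this]
    obtain v where v: "v \<in> V" "card {e\<in>E. v \<in> e} \<le> 2 \<or>
      (card {e\<in>E. v \<in> e} = 3 \<and> v \<in> D \<and> (\<forall>w\<in>V. \<kappa> w = \<kappa> v \<longrightarrow> w = v))" by blast
    let ?E = "{e\<in>E. v \<notin> e}" and ?V = "V - {v}"
    have vz: "v \<noteq> z" using v(1) z by auto
    have zV: "z \<notin> ?V" using z by simp
    have less': "card ?V < card V" using V v(1) by (rule card_Diff1_less)
    have E': "simple_graph ?V ?E" using simple_graph_delete_vertex[OF E] .
    have H': "{e\<in>?H. v \<notin> e} = ?E \<union> cone_edges z (?V - (D - {v}))"
      using vz by (auto simp: cone_edges_def)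
    have zV': "insert z V - {v} = insert z ?V" using vz by auto
    have sparse': "laman_sparse (insert z ?V) (?E \<union> cone_edges z (?V - (D - {v})))"
      unfolding H'[symmetric] by (rule laman_sparse_mono[OF sparse finH]) auto
    have D': "D - {v} \<subseteq> ?V" "inj_on \<kappa> (D - {v})" "None \<notin> \<kappa> ` (D - {v})"
      using DV inj None by (auto intro: inj_on_subset)
    have D_free: "\<kappa> u \<noteq> None \<and> \<kappa> u \<notin> \<kappa> ` (D - {u})" if "u \<in> D" for u
    proof
      show "\<kappa> u \<noteq> None"
      proof
        assume "\<kappa> u = None"
        then have "None \<in> \<kappa> ` D" using that by (metis imageI)
        with None show False by contradiction
      qed
      show "\<kappa> u \<notin> \<kappa> ` (D - {u})" using inj that by (auto simp: inj_on_def)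
    qed
    let ?N = "{u. {v, u} \<in> E}"
    have N: "v \<notin> ?N" "?N \<subseteq> V" "finite ?N"
    proof -
      show "v \<notin> ?N" using simple_graph_edge(3)[OF E, of v v] by auto
      show "?N \<subseteq> V" using simple_graph_edge(2)[OF E] by auto
      then show "finite ?N" using V by (rule finite_subset)
    qed
    note starN = star_image[OF E, of v] and cardN = card_star[OF E, of v]
    show ?thesis
    proof (cases "card ?N \<le> 1")
      case True
      obtain \<theta> \<rho> where solv: "solvable ?E \<kappa> \<theta> \<rho>"
        using less.hyps[OF less' E' zV D' sparse'] by blast
      have "\<exists>a. v \<noteq> a \<and> ?N \<subseteq> {a}"
      proof (cases "?N = {}")
        case True
        \<comment> \<open>An isolated v gets the centre z as a dummy neighbour.\<close>
        then show ?thesis using vz by auto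
      next
        case False
        then have "0 < card ?N" using N(3) card_gt_0_iff by blast
        then have "card ?N = 1" using \<open>card ?N \<le> 1\<close> by linarith
        then obtain a where a: "?N = {a}" by (auto simp: card_1_singleton_iff)
        then have "v \<noteq> a" using N(1) by blast
        then show ?thesis using a by blast
      qed
      then obtain a where a: "v \<noteq> a" "?N \<subseteq> {a}" by blast
      have "{e\<in>E. v \<in> e} \<subseteq> {{v, a}}" unfolding starN using a(2) by auto
      from extend_pendant[OF E this a(1) solv] show ?thesis .
    next
      case deg: False
      show ?thesis
      proof (cases "card ?N = 2")
        case True
        then obtain a b where ab: "?N = {a, b}" "a \<noteq> b" by (auto simp: card_2_iff)
        have star: "{e\<in>E. v \<in> e} = {{v, a}, {v, b}}" unfolding starN ab(1) by simp
        then have star': "{e\<in>E. v \<in> e} = {{v, b}, {v, a}}" by auto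
        have abV: "a \<in> ?V" "b \<in> ?V" using ab(1) N(1,2) by auto
        have degree_two: ?thesis
          if star: "{e\<in>E. v \<in> e} = {{v, a}, {v, b}}" "a \<noteq> b" and D'': "D'' \<subseteq> D - {v}"
            and sp: "laman_sparse (insert z ?V) (?E \<union> cone_edges z (?V - D''))"
            and free: "(\<kappa> v \<noteq> None \<and> \<kappa> v \<notin> \<kappa> ` D'') \<or> (\<kappa> a \<noteq> None \<and> \<kappa> a \<notin> \<kappa> ` D'')" for a b D''
        proof (rule extend_degree_two[OF E star _ _ free])
          show "inj_on \<kappa> D''" using D'(2) D'' by (rule inj_on_subset)
          show "None \<notin> \<kappa> ` D''" using D'(3) D'' by blast
          fix \<kappa>' :: "'v \<Rightarrow> 'c option" assume "inj_on \<kappa>' D''" "None \<notin> \<kappa>' ` D''"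
          with less.hyps[OF less' E' zV _ _ _ sp] D' D'' show "\<exists>\<theta> \<rho>. solvable ?E \<kappa>' \<theta> \<rho>" by blast
        qed
        show ?thesis
        proof (cases "v \<in> D")
          case True
          \<comment> \<open>Once v has left \<open>D\<close>, no vertex of \<open>D\<close> carries
            its colour.\<close>
          show ?thesis using degree_two[OF star ab(2) subset_refl sparse'] D_free[OF True] by blast
        next
          case vD: False
          \<comment> \<open>The added edge az takes a out of \<open>D\<close>: the new cone is the
            one for \<open>D - {a}\<close>, and the colour of a becomes free.\<close>
          have via_centre: ?thesis
            if star: "{e\<in>E. v \<in> e} = {{v, a}, {v, b}}" "a \<noteq> b" and a: "a \<in> ?V"
              and az: "{a, z} \<notin> {e\<in>?H. v \<notin> e}"
              and sp: "laman_sparse (insert z V - {v}) (insert {a, z} {e\<in>?H. v \<notin> e})" for a b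
          proof -
            have aD: "a \<in> D"
            proof (rule ccontr)
              assume "a \<notin> D"
              then have "{z, a} \<in> {e\<in>?H. v \<notin> e}" using a vz by (auto simp: cone_edges_def)
              then show False using az by (simp add: insert_commute)
            qed
            have "?V - (D - {a}) = insert a (?V - (D - {v}))" using a aD vD by auto
            then have "insert {a, z} {e\<in>?H. v \<notin> e} = ?E \<union> cone_edges z (?V - (D - {a}))"
              unfolding H' by (simp add: cone_edges_def insert_commute)
            with sp have "laman_sparse (insert z ?V) (?E \<union> cone_edges z (?V - (D - {a})))"
              unfolding zV' by simp
            moreover have "D - {a} \<subseteq> D - {v}" using vD by auto
            ultimately show ?thesis using degree_two[OF star] D_free[OF aD] by blast
          qed
          have "{z, v} \<in> cone_edges z (V - D)" using v(1) vD by (simp add: cone_edges_def)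
          moreover have "e = {z, v}" if "e \<in> cone_edges z (V - D)" "v \<in> e" for e
            using that vz by (auto simp: cone_edges_def)
          ultimately have "{e\<in>?H. v \<in> e} = insert {z, v} {e\<in>E. v \<in> e}" by blast
          then have starH: "{e\<in>?H. v \<in> e} = {{v, a}, {v, b}, {v, z}}" unfolding star by auto
          have "v \<in> insert z V" "a \<noteq> z" "b \<noteq> z" "v \<noteq> a" "v \<noteq> b" using v(1) abV z by auto
          from laman_sparse_extend[OF sparse H starH this(1) ab(2) this(2,3,4,5) vz]
          obtain x y where xy: "(x, y) \<in> {(a, b), (a, z), (b, z)}" "{x, y} \<notin> {e\<in>?H. v \<notin> e}"
            "laman_sparse (insert z V - {v}) (insert {x, y} {e\<in>?H. v \<notin> e})" by blast
          from xy(1) consider "x = a" "y = b" | "x = a" "y = z" | "x = b" "y = z" by auto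
          then show ?thesis
          proof cases
            case 1
            have ab': "{a, b} \<notin> ?E" using xy(2) 1 by auto
            have ba': "{b, a} \<notin> ?E" using ab' by (simp add: insert_commute)
            have G: "simple_graph ?V (insert {a, b} ?E)"
              using E' abV ab(2) by (auto simp: simple_graph_def)
            have sp: "laman_sparse (insert z ?V) (insert {a, b} ?E \<union> cone_edges z (?V - (D - {v})))"
              using xy(3) 1 unfolding H' zV' by simp
            obtain \<theta> \<rho> where solv: "solvable (insert {a, b} ?E) \<kappa> \<theta> \<rho>"
              using less.hyps[OF less' G zV D' sp] by blast
            then have solv': "solvable (insert {b, a} ?E) \<kappa> \<theta> \<rho>" by (simp add: insert_commute)
            show ?thesis
            proof (cases "\<kappa> v = \<kappa> a")
              case True
              show ?thesis by (rule extend_contract[OF E star ab(2) True ab' solv])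
            next
              case va: False
              show ?thesis
              proof (cases "\<kappa> v = \<kappa> b")
                case True
                show ?thesis by (rule extend_contract[OF E star' ab(2)[symmetric] True ba' solv'])
              next
                case False
                show ?thesis by (rule extend_line[OF E star ab(2) va False ab' solv])
              qed
            qed
          next
            case 2
            show ?thesis using via_centre[OF star ab(2) abV(1)] xy(2,3) 2 by blast
          next
            case 3
            show ?thesis using via_centre[OF star' ab(2)[symmetric] abV(2)] xy(2,3) 3 by blast
          qed
        qed
      next
        case False
        with v(2) deg have "card ?N = 3" and vD: "v \<in> D"
          and unique: "\<And>w. w \<in> V \<Longrightarrow> \<kappa> w = \<kappa> v \<Longrightarrow> w = v"
          unfolding cardN by auto
        then obtain a b d where abd: "?N = {a, b, d}" "a \<noteq> b" "a \<noteq> d" "b \<noteq> d"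
          by (auto simp: card_3_iff)
        have star: "{e\<in>E. v \<in> e} = {{v, a}, {v, b}, {v, d}}" unfolding starN abd(1) by simp
        have abdV: "a \<in> ?V" "b \<in> ?V" "d \<in> ?V" using abd(1) N(1,2) by auto
        obtain c where c: "\<kappa> v = Some c" using D_free[OF vD] by auto
        have unique': "w = v" if "w \<in> V" "\<kappa> w = Some c" for w using unique that c by simp
        \<comment> \<open>As v lies in \<open>D\<close>, it is not joined to z and has the same
          three neighbours in the cone.\<close>
        have "v \<notin> e" if "e \<in> cone_edges z (V - D)" for e
          using that vz vD by (auto simp: cone_edges_def)
        then have "{e\<in>?H. v \<in> e} = {e\<in>E. v \<in> e}" by blast
        then have starH: "{e\<in>?H. v \<in> e} = {{v, a}, {v, b}, {v, d}}" using star by simp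
        have "v \<in> insert z V" "v \<noteq> a" "v \<noteq> b" "v \<noteq> d" using v(1) abdV by auto
        from laman_sparse_extend[OF sparse H starH this(1) abd(2-4) this(2-4)]
        obtain x y where xy: "(x, y) \<in> {(a, b), (a, d), (b, d)}" "{x, y} \<notin> {e\<in>?H. v \<notin> e}"
          "laman_sparse (insert z V - {v}) (insert {x, y} {e\<in>?H. v \<notin> e})" by blast
        have xyV: "x \<in> ?V" "y \<in> ?V" "x \<noteq> y" using xy(1) abdV abd(2-4) by auto
        have xyE: "{x, y} \<notin> ?E" using xy(2) by auto
        have G: "simple_graph ?V (insert {x, y} ?E)"
          using E' xyV by (auto simp: simple_graph_def)
        have sp: "laman_sparse (insert z ?V) (insert {x, y} ?E \<union> cone_edges z (?V - (D - {v})))"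
          using xy(3) unfolding H' zV' by simp
        obtain \<theta> \<rho> where solv: "solvable (insert {x, y} ?E) \<kappa> \<theta> \<rho>"
          using less.hyps[OF less' G zV D' sp] by blast
        have "\<exists>w. {e\<in>E. v \<in> e} = {{v, x}, {v, y}, {v, w}} \<and> x \<noteq> w \<and> y \<noteq> w"
        proof -
          from xy(1) consider "x = a" "y = b" | "x = a" "y = d" | "x = b" "y = d" by auto
          then show ?thesis
          proof cases
            case 1
            then show ?thesis unfolding star using abd(2-4) by (intro exI[of _ d]) simp
          next
            case 2
            then show ?thesis unfolding star using abd(2-4)
              by (intro exI[of _ b]) (simp add: insert_commute)
          next
            case 3
            then show ?thesis unfolding star using abd(2-4)
              by (intro exI[of _ a]) (simp add: insert_commute)
          qed
        qed
        then obtain w where w: "{e\<in>E. v \<in> e} = {{v, x}, {v, y}, {v, w}}" "x \<noteq> w" "y \<noteq> w"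
          by (elim exE conjE)
        show ?thesis
          by (rule extend_unique_colour[OF E w(1) xyV(3) w(2,3) c unique' xyE solv])
      qed
    qed
  qed
qed

section \<open>Generic frameworks\<close>

definition monomial_value :: "('x \<Rightarrow> real) \<Rightarrow> ('x \<Rightarrow>\<^sub>0 nat) \<Rightarrow> real" where
  "monomial_value a m = (\<Prod>x\<in>Poly_Mapping.keys m. a x ^ Poly_Mapping.lookup m x)"

lemma monomial_value_superset:
  assumes "finite S" "Poly_Mapping.keys m \<subseteq> S"
  shows "monomial_value a m = (\<Prod>x\<in>S. a x ^ Poly_Mapping.lookup m x)"
  unfolding monomial_value_def using assms
  by (intro prod.mono_neutral_left) (auto simp: in_keys_iff)

lemma monomial_value_add: "monomial_value a (m + n) = monomial_value a m * monomial_value a n"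
proof -
  let ?S = "Poly_Mapping.keys m \<union> Poly_Mapping.keys n"
  have "Poly_Mapping.keys (m + n) \<subseteq> ?S" by (rule keys_add)
  then show ?thesis
    by (simp add: monomial_value_superset[of ?S] lookup_add power_add prod.distrib)
qed

lemma poly_value_superset:
  assumes "finite S" "Poly_Mapping.keys P \<subseteq> S"
  shows "poly_value a P = (\<Sum>m\<in>S. of_rat (Poly_Mapping.lookup P m) * monomial_value a m)"
  unfolding poly_value_def monomial_value_def[symmetric] using assms
  by (intro sum.mono_neutral_left) (auto simp: in_keys_iff)

lemma poly_value_add: "poly_value a (P + Q) = poly_value a P + poly_value a Q"
proof -
  let ?S = "Poly_Mapping.keys P \<union> Poly_Mapping.keys Q"
  have "Poly_Mapping.keys (P + Q) \<subseteq> ?S" by (rule keys_add)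
  then show ?thesis
    by (simp add: poly_value_superset[of ?S] lookup_add of_rat_add distrib_right sum.distrib)
qed

lemma poly_value_zero [simp]: "poly_value a 0 = 0"
  by (simp add: poly_value_def)

lemma poly_value_sum: "poly_value a (\<Sum>i\<in>I. P i) = (\<Sum>i\<in>I. poly_value a (P i))"
  by (induction I rule: infinite_finite_induct) (auto simp: poly_value_add)

lemma poly_value_single: "poly_value a (Poly_Mapping.single m c) = of_rat c * monomial_value a m"
  by (simp add: poly_value_superset[of "{m}"])

lemma sum_single_keys:
  fixes P :: "'a \<Rightarrow>\<^sub>0 'b::comm_monoid_add"
  shows "(\<Sum>m\<in>Poly_Mapping.keys P. Poly_Mapping.single m (Poly_Mapping.lookup P m)) = P"
proof (rule poly_mapping_eqI)
  fix k
  have "Poly_Mapping.lookup (\<Sum>m\<in>Poly_Mapping.keys P. Poly_Mapping.single m (Poly_Mapping.lookup P m)) k =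
      (\<Sum>m\<in>Poly_Mapping.keys P. if m = k then Poly_Mapping.lookup P m else 0)"
    by (simp add: lookup_sum lookup_single when_def)
  also have "\<dots> = Poly_Mapping.lookup P k" by (simp add: in_keys_iff)
  finally show "Poly_Mapping.lookup (\<Sum>m\<in>Poly_Mapping.keys P. Poly_Mapping.single m (Poly_Mapping.lookup P m)) k =
      Poly_Mapping.lookup P k" .
qed

text \<open>Both factors are expanded into monomials, on which evaluation is multiplicative.\<close>

lemma poly_value_mult: "poly_value a (P * Q) = poly_value a P * poly_value a Q"
proof -
  let ?p = "Poly_Mapping.lookup P" and ?q = "Poly_Mapping.lookup Q"
  have "P * Q = (\<Sum>m\<in>Poly_Mapping.keys P. Poly_Mapping.single m (?p m)) *
      (\<Sum>n\<in>Poly_Mapping.keys Q. Poly_Mapping.single n (?q n))"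
    by (simp only: sum_single_keys)
  also have "\<dots> = (\<Sum>m\<in>Poly_Mapping.keys P. \<Sum>n\<in>Poly_Mapping.keys Q. Poly_Mapping.single (m + n) (?p m * ?q n))"
    by (simp only: sum_product mult_single)
  finally have "poly_value a (P * Q) = (\<Sum>m\<in>Poly_Mapping.keys P. \<Sum>n\<in>Poly_Mapping.keys Q.
      (of_rat (?p m) * monomial_value a m) * (of_rat (?q n) * monomial_value a n))"
    by (simp add: poly_value_sum poly_value_single monomial_value_add of_rat_mult mult.assoc mult.left_commute)
  also have "\<dots> = poly_value a P * poly_value a Q"
    by (simp add: poly_value_def monomial_value_def[symmetric] sum_product)
  finally show ?thesis .
qed

lemma poly_value_one [simp]: "poly_value a 1 = 1"
  unfolding single_one[symmetric] poly_value_single by (simp add: monomial_value_def)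

lemma comm_ring_hom_poly_value: "comm_ring_hom (poly_value a)"
  by unfold_locales (simp_all add: poly_value_add poly_value_mult)

lemma poly_value_uminus: "poly_value a (- P) = - poly_value a P"
  using poly_value_add[of a P "- P"] by simp

lemma poly_value_diff: "poly_value a (P - Q) = poly_value a P - poly_value a Q"
  using poly_value_add[of a P "- Q"] by (simp add: poly_value_uminus)

lemma poly_value_var [simp]: "poly_value a (poly_var x) = a x"
  by (simp add: poly_var_def poly_value_single monomial_value_def)

lemma poly_ring_zero: "0 \<in> poly_ring X"
  by (simp add: poly_ring_def)

lemma poly_ring_one: "1 \<in> poly_ring X"
  unfolding single_one[symmetric] by (auto simp: poly_ring_def)

lemma poly_ring_var: "x \<in> X \<Longrightarrow> poly_var x \<in> poly_ring X"
  by (auto simp: poly_ring_def poly_var_def)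

lemma poly_ring_add: "P \<in> poly_ring X \<Longrightarrow> Q \<in> poly_ring X \<Longrightarrow> P + Q \<in> poly_ring X"
  using keys_add[of P Q] by (auto simp: poly_ring_def)

lemma poly_ring_uminus: "P \<in> poly_ring X \<Longrightarrow> - P \<in> poly_ring X"
  by (simp add: poly_ring_def)

lemma poly_ring_diff: "P \<in> poly_ring X \<Longrightarrow> Q \<in> poly_ring X \<Longrightarrow> P - Q \<in> poly_ring X"
  using poly_ring_add[of P X "- Q"] by (simp add: poly_ring_uminus)

lemma poly_ring_mult:
  assumes "P \<in> poly_ring X" "Q \<in> poly_ring X"
  shows "P * Q \<in> poly_ring X"
  unfolding poly_ring_def
proof (intro CollectI ballI)
  fix k assume "k \<in> Poly_Mapping.keys (P * Q)"
  then have "k \<in> {m + n | m n. m \<in> Poly_Mapping.keys P \<and> n \<in> Poly_Mapping.keys Q}"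
    by (rule subsetD[OF keys_mult])
  then obtain m n where k: "k = m + n" "m \<in> Poly_Mapping.keys P" "n \<in> Poly_Mapping.keys Q" by auto
  then have "Poly_Mapping.keys m \<subseteq> X" "Poly_Mapping.keys n \<subseteq> X"
    using assms by (auto simp: poly_ring_def)
  then show "Poly_Mapping.keys k \<subseteq> X" using keys_add[of m n] k(1) by auto
qed

lemma poly_ring_sum: "(\<And>i. i \<in> I \<Longrightarrow> P i \<in> poly_ring X) \<Longrightarrow> (\<Sum>i\<in>I. P i) \<in> poly_ring X"
  by (induction I rule: infinite_finite_induct) (auto intro: poly_ring_zero poly_ring_add)

lemma poly_ring_prod: "(\<And>i. i \<in> I \<Longrightarrow> P i \<in> poly_ring X) \<Longrightarrow> (\<Prod>i\<in>I. P i) \<in> poly_ring X"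
  by (induction I rule: infinite_finite_induct) (auto intro: poly_ring_one poly_ring_mult)

lemma poly_ring_signof: "signof \<pi> \<in> poly_ring X"
  by (simp add: sign_def poly_ring_one poly_ring_uminus)

lemma poly_ring_gram_det:
  assumes "finite I" "\<And>i j. i \<in> I \<Longrightarrow> j \<in> J \<Longrightarrow> A i j \<in> poly_ring X"
  shows "gram_det I J A \<in> poly_ring X"
proof -
  note e = enumeration_in[OF assms(1)]
  show ?thesis
    unfolding gram_det_expand
    by (intro poly_ring_sum poly_ring_mult poly_ring_prod poly_ring_signof assms(2) e) (auto intro: permutes_less)
qed

section \<open>From one independent position to all generic ones\<close>

fun rigidity_poly ::
    "('v \<Rightarrow> 'c option) \<Rightarrow> 'v set + 'v \<Rightarrow> ('v, 'm, 'c) var \<Rightarrow> ('v, 'm, 'c) var mpoly_rat" where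
  "rigidity_poly \<kappa> (Inl e) (Inl (w, i)) =
     (if w \<in> e then poly_var (Inl (w, i)) - poly_var (Inl (the_elem (e - {w}), i)) else 0)"
| "rigidity_poly \<kappa> (Inl e) (Inr c) = 0"
| "rigidity_poly \<kappa> (Inr v) (Inl (w, i)) = (if w = v then poly_var (Inl (v, i)) else 0)"
| "rigidity_poly \<kappa> (Inr v) (Inr c) = (if \<kappa> v = Some c then - 1 else 0)"

lemma poly_value_rigidity_poly:
  "poly_value (config p r) (rigidity_poly \<kappa> i j) = rigidity_matrix \<kappa> p i j"
  by (induction \<kappa> i j rule: rigidity_poly.induct)
    (auto simp: poly_value_diff poly_value_uminus config_def)

lemma rigidity_poly_ring:
  fixes j :: "('v, 'm, 'c) var"
  assumes "simple_graph V E" "i \<in> rigidity_rows V E" "j \<in> coords V C"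
  shows "rigidity_poly \<kappa> i j \<in> poly_ring (coords V C)"
proof -
  have other: "the_elem (e - {w}) \<in> V" if e: "e \<in> E" and w: "w \<in> e" for e w
  proof -
    obtain u v where uv: "e = {u, v}" "u \<in> V" "v \<in> V" "u \<noteq> v"
      using simple_graph_edgeE[OF assms(1) e] .
    have "the_elem ({u, v} - {u}) = v" "the_elem ({u, v} - {v}) = u"
      using uv(4) by (simp_all add: insert_Diff_if)
    moreover have "w = u \<or> w = v" using w uv(1) by simp
    ultimately show ?thesis unfolding uv(1) using uv(2,3) by (elim disjE) simp_all
  qed
  have var: "poly_var (Inl (w, k)) \<in> poly_ring (coords V C :: ('v, 'm, 'c) var set)"
    if "w \<in> V" for w k
    using that by (intro poly_ring_var) (simp add: coords_def)
  from assms(2) consider e where "e \<in> E" "i = Inl e" | v where "v \<in> V" "i = Inr v"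
    by (auto simp: rigidity_rows_def)
  then show ?thesis
  proof cases
    case 1
    show ?thesis
    proof (cases j)
      case (Inl wk)
      obtain w k where wk: "wk = (w, k)" by (cases wk)
      then have "w \<in> V" using assms(3) Inl by (auto simp: coords_def)
      then show ?thesis
        using poly_ring_diff[OF var var[OF other[OF 1(1)]]] unfolding Inl wk 1(2)
        by (simp add: poly_ring_zero)
    qed (simp add: 1(2) poly_ring_zero)
  next
    case 2
    show ?thesis
    proof (cases j)
      case (Inl wk)
      obtain w k where wk: "wk = (w, k)" by (cases wk)
      show ?thesis using var[OF 2(1)] unfolding Inl wk 2(2) by (simp add: poly_ring_zero)
    qed (simp add: 2(2) poly_ring_zero poly_ring_one poly_ring_uminus)
  qed
qed

lemma poly_value_sphere_poly:
  fixes p :: "'v \<Rightarrow> real ^ 'm::finite"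
  shows "poly_value (config p r) (sphere_poly \<kappa> v) =
    p v \<bullet> p v - (case \<kappa> v of None \<Rightarrow> 1 | Some c \<Rightarrow> (r c)\<^sup>2)"
  by (simp add: sphere_poly_def poly_value_diff poly_value_sum poly_value_mult config_def inner_vec_def
      power2_eq_square split: option.split)

text \<open>Elements of the sphere ideal vanish wherever the sphere equations hold, so a polynomial
  that is nonzero at one such point lies outside the ideal. Only squares of radii enter, so
  \<open>r0\<close> may take negative values.\<close>

lemma generic_specialise:
  fixes p p0 :: "'v \<Rightarrow> real ^ 'm::finite"
  assumes "generic V C \<kappa> r p" "P \<in> poly_ring (coords V C)"
    and sphere: "\<And>v. v \<in> V \<Longrightarrow> p0 v \<bullet> p0 v = (case \<kappa> v of None \<Rightarrow> 1 | Some c \<Rightarrow> (r0 c)\<^sup>2)"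
    and "poly_value (config p0 r0) P \<noteq> 0"
  shows "poly_value (config p r) P \<noteq> 0"
proof
  assume "poly_value (config p r) P = 0"
  moreover have "P \<noteq> 0" using assms(4) by auto
  ultimately have "P \<in> sphere_ideal V C \<kappa>" using assms(1,2) unfolding generic_def by blast
  then obtain q where "P = (\<Sum>v\<in>V. q v * sphere_poly \<kappa> v)" unfolding sphere_ideal_def by blast
  then have "poly_value (config p0 r0) P = (\<Sum>v\<in>V. poly_value (config p0 r0) (q v) *
      (p0 v \<bullet> p0 v - (case \<kappa> v of None \<Rightarrow> 1 | Some c \<Rightarrow> (r0 c)\<^sup>2)))"
    by (simp add: poly_value_sum poly_value_mult poly_value_sphere_poly)
  also have "\<dots> = 0" using sphere by simp
  finally show False using assms(4) by contradiction
qed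

lemma finite_rigidity_rows: "simple_graph V E \<Longrightarrow> finite (rigidity_rows V E)"
  using simple_graph_finite_edges[of V E] by (simp add: rigidity_rows_def simple_graph_def)

lemma finite_coords: "finite V \<Longrightarrow> finite C \<Longrightarrow> finite (coords V C :: ('v, 'm::finite, 'c) var set)"
  by (simp add: coords_def)

lemma independent_framework_iff:
  fixes p :: "'v \<Rightarrow> real ^ 'm::finite" and \<kappa> :: "'v \<Rightarrow> 'c option"
  assumes "simple_graph V E" "finite C"
  shows "independent_framework V E C \<kappa> p \<longleftrightarrow>
    full_row_rank (rigidity_rows V E) (coords V C) (rigidity_matrix \<kappa> p)"
proof -
  have "finite V" using assms(1) by (simp add: simple_graph_def)
  then have fin: "finite (coords V C :: ('v, 'm, 'c) var set)" using assms(2) by (rule finite_coords)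
  show ?thesis
    unfolding independent_framework_def
      rows_independent_iff_row_injective[OF finite_rigidity_rows[OF assms(1)]]
      full_row_rank_iff_row_injective[OF finite_rigidity_rows[OF assms(1)] fin] ..
qed

text \<open>This is \<open>generic_specialise\<close> for the Gram determinant of the rigidity
  matrix with indeterminate coordinates.\<close>

lemma generic_independent:
  fixes p p0 :: "'v \<Rightarrow> real ^ 'm::finite" and \<kappa> :: "'v \<Rightarrow> 'c option"
  assumes E: "simple_graph V E" and C: "finite C" and gen: "generic V C \<kappa> r p"
    and sphere: "\<And>v. v \<in> V \<Longrightarrow> p0 v \<bullet> p0 v = (case \<kappa> v of None \<Rightarrow> 1 | Some c \<Rightarrow> (r0 c)\<^sup>2)"
    and ind: "independent_framework V E C \<kappa> p0"
  shows "independent_framework V E C \<kappa> p"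
proof -
  have V: "finite V" using E by (simp add: simple_graph_def)
  let ?I = "rigidity_rows V E" and ?J = "coords V C :: ('v, 'm, 'c) var set"
  note fin = finite_rigidity_rows[OF E] finite_coords[OF V C]
  let ?G = "gram_det ?I ?J (rigidity_poly \<kappa>)"
  have G: "gram_det ?I ?J (rigidity_matrix \<kappa> p') = poly_value (config p' r') ?G"
    for p' :: "'v \<Rightarrow> real ^ 'm" and r'
    by (rule gram_det_hom[OF comm_ring_hom_poly_value poly_value_rigidity_poly[symmetric] fin(1)])
  have poly: "?G \<in> poly_ring (coords V C)"
    by (rule poly_ring_gram_det[OF fin(1) rigidity_poly_ring[OF E]])
  have nz: "poly_value (config p0 r0) ?G \<noteq> 0"
    using ind unfolding independent_framework_iff[OF E C] full_row_rank_iff_gram_det[OF fin] G[of p0 r0] .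
  have "poly_value (config p r) ?G \<noteq> 0"
  proof (rule generic_specialise[OF gen poly, where ?p0.0 = p0 and ?r0.0 = r0])
    show "p0 v \<bullet> p0 v = (case \<kappa> v of None \<Rightarrow> 1 | Some c \<Rightarrow> (r0 c)\<^sup>2)" if "v \<in> V" for v
      using sphere[OF that] .
  qed (rule nz)
  then show ?thesis
    unfolding independent_framework_iff[OF E C] full_row_rank_iff_gram_det[OF fin] G[of p r] .
qed

section \<open>The rigidity matrix and the edge system\<close>

definition complex_vec :: "complex \<Rightarrow> real ^ 2" where
  "complex_vec z = vector [Re z, Im z]"

definition vec_complex :: "real ^ 2 \<Rightarrow> complex" where
  "vec_complex x = Complex (x $ 1) (x $ 2)"

lemma vec_complex_diff: "vec_complex (x - y) = vec_complex x - vec_complex y"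
  by (simp add: vec_complex_def complex_eq_iff)

lemma complex_vec_inverse: "vec_complex (complex_vec z) = z"
  by (simp add: vec_complex_def complex_vec_def)

lemma inner_vec_complex: "x \<bullet> y = Re (cnj (vec_complex x) * vec_complex y)"
  by (simp add: vec_complex_def inner_vec_def sum_2)

lemma norm_vec_complex: "cmod (vec_complex x) = norm x"
  unfolding norm_eq_sqrt_inner[of x] inner_vec_complex by (simp add: cmod_def power2_eq_square)

text \<open>The two columns of a vertex are read as one complex velocity.\<close>

lemma full_row_rank_rigidity_iff:
  fixes p :: "'v \<Rightarrow> real ^ 2" and \<kappa> :: "'v \<Rightarrow> 'c option"
  assumes E: "simple_graph V E" and C: "finite C" "colouring V C \<kappa>"
  shows "full_row_rank (rigidity_rows V E) (coords V C) (rigidity_matrix \<kappa> p) \<longleftrightarrow>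
    (\<forall>b. \<exists>w s. (\<forall>u v. {u, v} \<in> E \<longrightarrow>
        Re (cnj (vec_complex (p u) - vec_complex (p v)) * (w u - w v)) = b (Inl {u, v})) \<and>
      (\<forall>v\<in>V. Re (cnj (vec_complex (p v)) * w v) - radius_velocity \<kappa> s v = b (Inr v)))"
    (is "?lhs \<longleftrightarrow> (\<forall>b. \<exists>w s. ?sol b w s)")
proof -
  have V: "finite V" using E by (simp add: simple_graph_def)
  let ?J = "coords V C :: ('v, 2, 'c) var set"
  have edge: "(\<Sum>j\<in>?J. rigidity_matrix \<kappa> p (Inl {u, v}) j * config p' s j) =
      Re (cnj (vec_complex (p u) - vec_complex (p v)) * (vec_complex (p' u) - vec_complex (p' v)))"
    if "{u, v} \<in> E" for u v p' s
    unfolding rigidity_matrix_edge_row[OF V C(1) simple_graph_edge[OF E that]] inner_vec_complex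
      vec_complex_diff ..
  have vertex: "(\<Sum>j\<in>?J. rigidity_matrix \<kappa> p (Inr v) j * config p' s j) =
      Re (cnj (vec_complex (p v)) * vec_complex (p' v)) - radius_velocity \<kappa> s v"
    if "v \<in> V" for v p' s
    unfolding rigidity_matrix_vertex_row[OF V C that] inner_vec_complex radius_velocity_def ..
  show ?thesis
  proof
    assume ?lhs
    show "\<forall>b. \<exists>w s. ?sol b w s"
    proof
      fix b
      obtain x where x: "\<forall>i\<in>rigidity_rows V E. (\<Sum>j\<in>?J. rigidity_matrix \<kappa> p i j * x j) = b i"
        using \<open>?lhs\<close> unfolding full_row_rank_def by (elim allE[of _ b]) blast
      define p' :: "'v \<Rightarrow> real ^ 2" where "p' v = (\<chi> i. x (Inl (v, i)))" for v
      have config: "config p' (x \<circ> Inr) = x"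
        by (auto simp: fun_eq_iff config_def p'_def split: sum.split)
      have "?sol b (\<lambda>v. vec_complex (p' v)) (x \<circ> Inr)"
      proof (intro conjI allI impI ballI)
        fix u v assume uv: "{u, v} \<in> E"
        then have "Inl {u, v} \<in> rigidity_rows V E" by (simp add: rigidity_rows_def)
        then show "Re (cnj (vec_complex (p u) - vec_complex (p v)) * (vec_complex (p' u) - vec_complex (p' v))) =
            b (Inl {u, v})"
          using x unfolding edge[OF uv, of p' "x \<circ> Inr", symmetric] config by (rule bspec[rotated])
      next
        fix v assume v: "v \<in> V"
        then have "Inr v \<in> rigidity_rows V E" by (simp add: rigidity_rows_def)
        then show "Re (cnj (vec_complex (p v)) * vec_complex (p' v)) - radius_velocity \<kappa> (x \<circ> Inr) v = b (Inr v)"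
          using x unfolding vertex[OF v, of p' "x \<circ> Inr", symmetric] config by (rule bspec[rotated])
      qed
      then show "\<exists>w s. ?sol b w s"
        by (rule exI[of _ "\<lambda>v. vec_complex (p' v)", OF exI[of _ "x \<circ> Inr"]])
    qed
  next
    assume sol: "\<forall>b. \<exists>w s. ?sol b w s"
    show ?lhs
      unfolding full_row_rank_def
    proof
      fix b
      obtain w s where ws: "?sol b w s" using spec[OF sol, of b] by (elim exE)
      define p' where "p' v = complex_vec (w v)" for v
      have p': "vec_complex (p' v) = w v" for v by (simp add: p'_def complex_vec_inverse)
      have "(\<Sum>j\<in>?J. rigidity_matrix \<kappa> p i j * config p' s j) = b i" if i: "i \<in> rigidity_rows V E" for i
      proof -
        from i consider e where "e \<in> E" "i = Inl e" | v where "v \<in> V" "i = Inr v"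
          by (auto simp: rigidity_rows_def)
        then show ?thesis
        proof cases
          case 1
          obtain u v where e: "e = {u, v}" using simple_graph_edgeE[OF E 1(1)] .
          then have uv: "{u, v} \<in> E" using 1(1) by simp
          show ?thesis unfolding 1(2) e edge[OF uv] p' using ws uv by blast
        next
          case 2
          show ?thesis unfolding 2(2) vertex[OF 2(1)] p' using ws 2(1) by blast
        qed
      qed
      then show "\<exists>x. \<forall>i\<in>rigidity_rows V E. (\<Sum>j\<in>?J. rigidity_matrix \<kappa> p i j * x j) = b i" by blast
    qed
  qed
qed

text \<open>With right-hand side 0 in the vertex rows, the radial part of each velocity is dictated
  by the colour. The velocities then have the form \<open>velocity\<close>, and the edge rows turn
  into \<open>edge_form\<close>.\<close>

lemma independent_framework_imp_solvable:
  fixes p :: "'v \<Rightarrow> real ^ 2"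
  assumes E: "simple_graph V E" and C: "finite C" "colouring V C \<kappa>"
    and fw: "framework V C \<kappa> r p" and ind: "independent_framework V E C \<kappa> p"
  shows "solvable E \<kappa> (\<lambda>v. Arg (vec_complex (p v))) r"
  unfolding solvable_def
proof
  fix b
  define \<theta> where "\<theta> v = Arg (vec_complex (p v))" for v
  have col: "c \<in> C" if "v \<in> V" "\<kappa> v = Some c" for v c
    using C(2) that unfolding colouring_def by (metis image_eqI image_iff insertE option.distinct(1) option.inject subsetD)
  have rad: "norm (p v) = radius \<kappa> r v" "radius \<kappa> r v > 0" if "v \<in> V" for v
    using fw that col by (auto simp: framework_def radius_def split: option.split)
  have pos: "vec_complex (p v) = position \<kappa> \<theta> r v" if "v \<in> V" for v
    using rcis_cmod_Arg[of "vec_complex (p v)"] rad(1)[OF that]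
    by (simp add: position_def \<theta>_def rcis_def norm_vec_complex)
  obtain w s where edges: "\<And>u v. {u, v} \<in> E \<Longrightarrow>
      Re (cnj (vec_complex (p u) - vec_complex (p v)) * (w u - w v)) = b {u, v}"
    and verts: "\<And>v. v \<in> V \<Longrightarrow> Re (cnj (vec_complex (p v)) * w v) = radius_velocity \<kappa> s v"
  proof -
    define c :: "'v set + 'v \<Rightarrow> real" where "c = case_sum b (\<lambda>_. 0)"
    have "\<exists>w s. (\<forall>u v. {u, v} \<in> E \<longrightarrow>
        Re (cnj (vec_complex (p u) - vec_complex (p v)) * (w u - w v)) = c (Inl {u, v})) \<and>
      (\<forall>v\<in>V. Re (cnj (vec_complex (p v)) * w v) - radius_velocity \<kappa> s v = c (Inr v))"
      using ind unfolding independent_framework_iff[OF E C(1)] full_row_rank_rigidity_iff[OF E C]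
      by (rule spec[where x = c])
    then obtain w s where ws: "(\<forall>u v. {u, v} \<in> E \<longrightarrow>
        Re (cnj (vec_complex (p u) - vec_complex (p v)) * (w u - w v)) = c (Inl {u, v})) \<and>
      (\<forall>v\<in>V. Re (cnj (vec_complex (p v)) * w v) - radius_velocity \<kappa> s v = c (Inr v))"
      by (elim exE)
    show thesis by (rule that[of w s]) (use ws in \<open>auto simp: c_def\<close>)
  qed
  define q where "q v = w v * cnj (cis (\<theta> v))" for v
  \<comment> \<open>A vertex row equates p . p' with s, and p . p' is the radius times the radial
    velocity.\<close>
  define s' where "s' c = s c / r c" for c
  define \<phi> where "\<phi> v = Im (q v) / radius \<kappa> r v" for v
  have vel: "velocity \<kappa> \<theta> r \<phi> s' v = w v" if v: "v \<in> V" for v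
  proof -
    have "radius \<kappa> r v * Re (q v) = Re (cnj (position \<kappa> \<theta> r v) * w v)"
      by (simp add: q_def position_def algebra_simps)
    also have "\<dots> = radius_velocity \<kappa> s v" using verts[OF v] pos[OF v] by simp
    finally have "Re (q v) = radius_velocity \<kappa> s v / radius \<kappa> r v"
      using rad(2)[OF v] by (simp add: field_simps)
    also have "\<dots> = radius_velocity \<kappa> s' v"
      by (simp add: radius_velocity_def radius_def s'_def split: option.split)
    finally have "Complex (radius_velocity \<kappa> s' v) (radius \<kappa> r v * \<phi> v) = q v"
      using rad(2)[OF v] by (simp add: \<phi>_def complex_eq_iff)
    then show ?thesis by (simp add: velocity_def q_def cis_cnj mult.assoc cis_mult)
  qed
  have "edge_form \<kappa> \<theta> r \<phi> s' u v = b {u, v}" if uv: "{u, v} \<in> E" for u v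
    unfolding edge_form_complex using edges[OF uv] simple_graph_edge[OF E uv] by (simp add: pos vel)
  then show "\<exists>\<phi> s. \<forall>u v. {u, v} \<in> E \<longrightarrow>
      edge_form \<kappa> (\<lambda>v. Arg (vec_complex (p v))) r \<phi> s u v = b {u, v}"
    unfolding \<theta>_def by blast
qed

text \<open>Radial velocities \<open>e\<close> settle the right-hand sides of the vertex rows; their
  effect on the edges is subtracted before the edge system is solved.\<close>

lemma solvable_imp_independent_framework:
  assumes E: "simple_graph V E" and C: "finite C" "colouring V C \<kappa>"
    and solv: "solvable E \<kappa> \<theta> \<rho>" and nz: "\<And>v. v \<in> V \<Longrightarrow> radius \<kappa> \<rho> v \<noteq> 0"
  shows "independent_framework V E C \<kappa> (\<lambda>v. complex_vec (position \<kappa> \<theta> \<rho> v))"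
  unfolding independent_framework_iff[OF E C(1)] full_row_rank_rigidity_iff[OF E C] complex_vec_inverse
proof
  fix b :: "'a set + 'a \<Rightarrow> real"
  let ?P = "position \<kappa> \<theta> \<rho>"
  define e where "e v = of_real (b (Inr v) / radius \<kappa> \<rho> v) * cis (\<theta> v)" for v
  define B where "B u v = b (Inl {u, v}) - Re (cnj (?P u - ?P v) * (e u - e v))" for u v
  have "B u v = B v u" for u v by (simp add: B_def insert_commute algebra_simps)
  from solvable_symmetric[where b = B, OF solv this] obtain \<phi> s
    where \<phi>s: "\<forall>u v. {u, v} \<in> E \<longrightarrow> edge_form \<kappa> \<theta> \<rho> \<phi> s u v = B u v" by (elim exE)
  define w where "w v = velocity \<kappa> \<theta> \<rho> \<phi> s v + e v" for v
  define s' where "s' c = \<rho> c * s c" for c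
  have "Re (cnj (?P u - ?P v) * (w u - w v)) = b (Inl {u, v})" if uv: "{u, v} \<in> E" for u v
  proof -
    have "w u - w v = (velocity \<kappa> \<theta> \<rho> \<phi> s u - velocity \<kappa> \<theta> \<rho> \<phi> s v) + (e u - e v)"
      by (simp add: w_def)
    then have "Re (cnj (?P u - ?P v) * (w u - w v)) =
        edge_form \<kappa> \<theta> \<rho> \<phi> s u v + Re (cnj (?P u - ?P v) * (e u - e v))"
      unfolding edge_form_complex by (simp only: distrib_left plus_complex.sel)
    also have "edge_form \<kappa> \<theta> \<rho> \<phi> s u v = B u v" using \<phi>s uv by blast
    finally show ?thesis by (simp add: B_def)
  qed
  moreover have "Re (cnj (?P v) * w v) - radius_velocity \<kappa> s' v = b (Inr v)" if v: "v \<in> V" for v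
  proof -
    let ?W = "Complex (radius_velocity \<kappa> s v) (radius \<kappa> \<rho> v * \<phi> v) + of_real (b (Inr v) / radius \<kappa> \<rho> v)"
    have "w v = ?W * cis (\<theta> v)" by (simp add: w_def velocity_def e_def distrib_right)
    then have "cnj (?P v) * w v = of_real (radius \<kappa> \<rho> v) * ((cnj (cis (\<theta> v)) * cis (\<theta> v)) * ?W)"
      by (simp only: position_def complex_cnj_mult complex_cnj_complex_of_real mult_ac)
    also have "cnj (cis (\<theta> v)) * cis (\<theta> v) = 1" by (simp add: cis_cnj cis_mult)
    finally have "cnj (?P v) * w v = of_real (radius \<kappa> \<rho> v) * ?W" by simp
    then have "Re (cnj (?P v) * w v) = radius \<kappa> \<rho> v * radius_velocity \<kappa> s v + b (Inr v)"
      using nz[OF v] by (simp add: distrib_left)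
    then show ?thesis by (simp add: radius_def radius_velocity_def s'_def split: option.split)
  qed
  ultimately have "(\<forall>u v. {u, v} \<in> E \<longrightarrow> Re (cnj (?P u - ?P v) * (w u - w v)) = b (Inl {u, v})) \<and>
      (\<forall>v\<in>V. Re (cnj (?P v) * w v) - radius_velocity \<kappa> s' v = b (Inr v))"
    by (intro conjI allI impI ballI)
  then show "\<exists>w s. (\<forall>u v. {u, v} \<in> E \<longrightarrow> Re (cnj (?P u - ?P v) * (w u - w v)) = b (Inl {u, v})) \<and>
      (\<forall>v\<in>V. Re (cnj (?P v) * w v) - radius_velocity \<kappa> s v = b (Inr v))"
    by (rule exI[of _ w, OF exI[of _ s']])
qed

section \<open>The characterisation\<close>

lemma card_graph_components_le:
  assumes "finite V"
  shows "card (graph_components V F) \<le> card V"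
proof -
  have "V // r = (\<lambda>v. r `` {v}) ` V" for r by (auto simp: quotient_def)
  then show ?thesis using card_image_le[OF assms] unfolding graph_components_connectivity by metis
qed

text \<open>Subtracting a rotation of each connected component, one may fix one vertex per component.\<close>

lemma card_edges_le_of_solvable:
  assumes F: "simple_graph V F" and U: "finite U"
    and solv: "\<And>b. \<exists>\<phi> s. (\<forall>u v. {u, v} \<in> F \<longrightarrow> edge_form \<kappa> \<theta> \<rho> \<phi> s u v = b {u, v}) \<and>
      (\<forall>v\<in>\<Union> F. \<forall>c. \<kappa> v = Some c \<longrightarrow> c \<notin> U \<longrightarrow> s c = 0)"
  shows "card F + card (graph_components V F) \<le> card V + card U"
proof -
  have V: "finite V" using F by (simp add: simple_graph_def)
  have finF: "finite F" using simple_graph_finite_edges[OF F] .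
  let ?r = "connectivity V F"
  define rep where "rep v = (SOME x. x \<in> ?r `` {v})" for v
  define T where "T = rep ` V"
  have equiv: "equiv V ?r" by (rule equiv_connectivity)
  have rep: "(v, rep v) \<in> ?r" if "v \<in> V" for v
  proof -
    have "v \<in> ?r `` {v}" using that by (auto simp: connectivity_def)
    then have "rep v \<in> ?r `` {v}" unfolding rep_def by (rule someI)
    then show ?thesis by simp
  qed
  have repV: "rep v \<in> V" if "v \<in> V" for v using rep[OF that] by (auto simp: connectivity_def)
  have rep_eq: "rep u = rep v" if "(u, v) \<in> ?r" for u v
    unfolding rep_def using equiv_class_eq[OF equiv that] by simp
  have T: "T \<subseteq> V" using repV by (auto simp: T_def)
  have "graph_components V F = (\<lambda>t. ?r `` {t}) ` T"
  proof
    show "(\<lambda>t. ?r `` {t}) ` T \<subseteq> graph_components V F"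
      unfolding graph_components_connectivity using T by (auto simp: quotient_def)
    show "graph_components V F \<subseteq> (\<lambda>t. ?r `` {t}) ` T"
    proof
      fix X assume "X \<in> graph_components V F"
      then obtain v where v: "v \<in> V" "X = ?r `` {v}"
        unfolding graph_components_connectivity by (auto simp: quotient_def)
      have "X = ?r `` {rep v}" using equiv_class_eq[OF equiv rep[OF v(1)]] v(2) by simp
      then show "X \<in> (\<lambda>t. ?r `` {t}) ` T" using v(1) by (auto simp: T_def)
    qed
  qed
  then have comps: "card (graph_components V F) \<le> card T"
    using card_image_le[OF finite_subset[OF T V]] by metis
  \<comment> \<open>The unknowns that remain: angular velocities away from the representatives
    \<open>T\<close> and radial velocities of the colours in \<open>U\<close>.\<close>
  define J where "J = Inl ` (V - T) \<union> Inr ` U"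
  have finJ: "finite J" using V U by (simp add: J_def)
  have "full_row_rank F J (edge_matrix \<kappa> \<theta> \<rho>)"
    unfolding full_row_rank_def
  proof
    fix b
    obtain \<phi> s where *: "(\<forall>u v. {u, v} \<in> F \<longrightarrow> edge_form \<kappa> \<theta> \<rho> \<phi> s u v = b {u, v}) \<and>
      (\<forall>v\<in>\<Union> F. \<forall>c. \<kappa> v = Some c \<longrightarrow> c \<notin> U \<longrightarrow> s c = 0)"
      using solv[of b] by (elim exE)
    define \<phi>' where "\<phi>' v = \<phi> v - \<phi> (rep v)" for v
    define s' where "s' c = (if c \<in> U then s c else 0)" for c
    have vel: "radius_velocity \<kappa> s' u = radius_velocity \<kappa> s u" if "u \<in> \<Union> F" for u
      using * that by (auto simp: radius_velocity_def s'_def split: option.split)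
    have "(\<Sum>j\<in>J. edge_matrix \<kappa> \<theta> \<rho> e j * case_sum \<phi>' s' j) = b e" if e: "e \<in> F" for e
    proof -
      obtain u v where uv: "e = {u, v}" "u \<in> V" "v \<in> V" "u \<noteq> v" using simple_graph_edgeE[OF F e] .
      have eF: "{u, v} \<in> F" using e uv(1) by simp
      then have uF: "u \<in> \<Union> F" "v \<in> \<Union> F" by auto
      let ?M = "motion_coords V \<kappa>"
      let ?f = "\<lambda>j. edge_matrix \<kappa> \<theta> \<rho> e j * case_sum \<phi>' s' j"
      have finM: "finite ?M" using finite_motion_coords[OF V] .
      \<comment> \<open>\<open>J\<close> and \<open>motion_coords\<close> differ only where the
        unknown is zero (vertices of \<open>T\<close>, colours outside \<open>U\<close>) or the
        column is zero (colours of \<open>U\<close> absent from V).\<close>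
      have "sum ?f J = sum ?f (J \<union> ?M)"
      proof (rule sum.mono_neutral_left)
        show "\<forall>j\<in>J \<union> ?M - J. ?f j = 0"
        proof
          fix j assume j: "j \<in> J \<union> ?M - J"
          show "?f j = 0"
          proof (cases j)
            case (Inl w)
            then have "w \<in> T" using j by (auto simp: J_def motion_coords_def)
            then obtain x where x: "x \<in> V" "w = rep x" by (auto simp: T_def)
            then have "rep w = w" using rep_eq[OF rep[OF x(1)]] by simp
            then show ?thesis using Inl by (simp add: \<phi>'_def)
          next
            case (Inr c)
            then have "c \<notin> U" using j by (auto simp: J_def)
            then show ?thesis using Inr by (simp add: s'_def)
          qed
        qed
      qed (use finJ finM in auto)
      also have "\<dots> = sum ?f ?M"
      proof (rule sum.mono_neutral_right)
        show "\<forall>j\<in>J \<union> ?M - ?M. ?f j = 0"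
        proof
          fix j assume j: "j \<in> J \<union> ?M - ?M"
          show "?f j = 0"
          proof (cases j)
            case (Inl w)
            then show ?thesis using j by (auto simp: J_def motion_coords_def)
          next
            case (Inr c)
            then have "Some c \<notin> \<kappa> ` V" using j by (auto simp: motion_coords_def)
            then have "\<kappa> w \<noteq> Some c" if "w \<in> e" for w using that uv by force
            then show ?thesis using Inr by (simp cong: sum.cong)
          qed
        qed
      qed (use finJ finM in auto)
      also have "\<dots> = edge_form \<kappa> \<theta> \<rho> \<phi>' s' u v"
        unfolding uv(1) by (rule sum_edge_matrix[OF V uv(2-4)])
      also have "\<dots> = edge_form \<kappa> \<theta> \<rho> \<phi> s u v"
      proof -
        have "rep u = rep v" by (rule rep_eq[OF connectivity_edge[OF eF uv(2,3)]])
        then show ?thesis by (simp add: edge_form_def \<phi>'_def vel[OF uF(1)] vel[OF uF(2)])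
      qed
      also have "\<dots> = b e" using conjunct1[OF *] eF unfolding uv(1) by (elim allE impE)
      finally show ?thesis .
    qed
    then show "\<exists>x. \<forall>e\<in>F. (\<Sum>j\<in>J. edge_matrix \<kappa> \<theta> \<rho> e j * x j) = b e" by blast
  qed
  then have "card F \<le> card J" by (rule full_row_rank_imp_card_le[OF finF finJ])
  also have "card J \<le> card (Inl ` (V - T) :: ('a + 'b) set) + card (Inr ` U :: ('a + 'b) set)"
    unfolding J_def by (rule card_Un_le)
  also have "\<dots> = card (V - T) + card U" by (simp add: card_image)
  also have "card (V - T) = card V - card T" using card_Diff_subset[OF finite_subset[OF T V] T] .
  finally show ?thesis using comps card_mono[OF V T] by linarith
qed

lemma solvable_subset:
  assumes "solvable E \<kappa> \<theta> \<rho>" "F \<subseteq> E"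
  shows "solvable F \<kappa> \<theta> \<rho>"
  unfolding solvable_def
proof
  fix b
  obtain \<phi> s where "\<forall>u v. {u, v} \<in> E \<longrightarrow> edge_form \<kappa> \<theta> \<rho> \<phi> s u v = b {u, v}"
    using assms(1) unfolding solvable_def by (elim allE[of _ b] exE)
  then show "\<exists>\<phi> s. \<forall>u v. {u, v} \<in> F \<longrightarrow> edge_form \<kappa> \<theta> \<rho> \<phi> s u v = b {u, v}"
    using assms(2) by (intro exI[of _ \<phi>] exI[of _ s]) auto
qed

text \<open>Take for \<open>U\<close> all colours met by F: the side condition on s is then vacuous,
  and only the rotations of the components are used.\<close>

lemma solvable_card_le_colours:
  assumes F: "simple_graph V F" and "finite C" "\<kappa> ` V \<subseteq> insert None (Some ` C)"
    and solv: "solvable F \<kappa> \<theta> \<rho>"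
  shows "card F + card (graph_components V F) \<le> card V + card (edge_colours C \<kappa> F)"
proof (rule card_edges_le_of_solvable[OF F])
  show "finite (edge_colours C \<kappa> F)" using assms(2) by (simp add: edge_colours_def)
  fix b
  have FV: "\<Union> F \<subseteq> V" using F by (auto simp: simple_graph_def)
  have col: "c \<in> edge_colours C \<kappa> F" if "v \<in> \<Union> F" "\<kappa> v = Some c" for v c
  proof -
    have "Some c \<in> insert None (Some ` C)"
      using that FV assms(3) by (metis image_subset_iff subsetD)
    then show ?thesis using that by (auto simp: edge_colours_def edge_verts_def)
  qed
  obtain \<phi> s where "\<forall>u v. {u, v} \<in> F \<longrightarrow> edge_form \<kappa> \<theta> \<rho> \<phi> s u v = b {u, v}"
    using solv unfolding solvable_def by (elim allE[of _ b] exE)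
  then show "\<exists>\<phi> s. (\<forall>u v. {u, v} \<in> F \<longrightarrow> edge_form \<kappa> \<theta> \<rho> \<phi> s u v = b {u, v}) \<and>
      (\<forall>v\<in>\<Union> F. \<forall>c. \<kappa> v = Some c \<longrightarrow> c \<notin> edge_colours C \<kappa> F \<longrightarrow> s c = 0)"
    using col by (intro exI[of _ \<phi>] exI[of _ s]) auto
qed

text \<open>Giving every vertex its own colour makes the translations of the plane available; they fix the
  radii at both ends of one edge.\<close>

lemma solvable_card_le_plane:
  assumes F: "simple_graph V F" and ab: "{a, b} \<in> F"
    and solv: "solvable F \<kappa> \<theta> \<rho>" and nz: "\<And>v. v \<in> V \<Longrightarrow> radius \<kappa> \<rho> v \<noteq> 0"
    and sin: "sin (\<theta> b - \<theta> a) \<noteq> 0"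
  shows "card F + card (graph_components V F) + 2 \<le> card V + card (\<Union> F)"
proof -
  have V: "finite V" and FV: "\<Union> F \<subseteq> V" using F by (auto simp: simple_graph_def)
  have fin: "finite (\<Union> F)" using FV V by (rule finite_subset)
  let ?\<rho> = "radius \<kappa> \<rho>"
  note abV = simple_graph_edge[OF F ab]
  have r: "radius Some ?\<rho> v = ?\<rho> v" for v by (simp add: radius_def)
  have rv: "radius_velocity Some s v = s v" for s :: "'a \<Rightarrow> real" and v by (simp add: radius_velocity_def)
  have "card F + card (graph_components V F) \<le> card V + card (\<Union> F - {a, b})"
  proof (rule card_edges_le_of_solvable[OF F, where \<kappa> = Some and \<rho> = ?\<rho> and \<theta> = \<theta>])
    show "finite (\<Union> F - {a, b})" using fin by simp
    fix c
    obtain \<phi> s where \<phi>s: "\<forall>u v. {u, v} \<in> F \<longrightarrow> edge_form \<kappa> \<theta> \<rho> \<phi> s u v = c {u, v}"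
      using solv unfolding solvable_def by (elim allE[of _ c] exE)
    define s1 where "s1 = radius_velocity \<kappa> s"
    have "Im (cnj (cis (\<theta> a)) * cis (\<theta> b)) \<noteq> 0"
      using sin by (simp add: cis_cnj cis_mult)
    \<comment> \<open>A translation whose radial components at a and b equal the radial velocities
      there. It exists because a and b are not collinear with the centre; subtracting it makes s'
      vanish at both.\<close>
    from real_linear_system_complex[OF this, of "s1 a" "s1 b"]
    obtain \<tau> where \<tau>: "Re (cnj (cis (\<theta> a)) * \<tau>) = s1 a" "Re (cnj (cis (\<theta> b)) * \<tau>) = s1 b"
      by (elim exE conjE)
    define q where "q v = cnj (cis (\<theta> v)) * \<tau>" for v
    define s' where "s' v = s1 v - Re (q v)" for v
    define \<phi>' where "\<phi>' v = \<phi> v - Im (q v) / ?\<rho> v" for v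
    have vel: "velocity Some \<theta> ?\<rho> \<phi>' s' v = velocity \<kappa> \<theta> \<rho> \<phi> s v - \<tau>" if "v \<in> V" for v
    proof -
      have "Complex (s' v) (?\<rho> v * \<phi>' v) = Complex (s1 v) (?\<rho> v * \<phi> v) - q v"
        using nz[OF that] by (simp add: s'_def \<phi>'_def complex_eq_iff right_diff_distrib)
      moreover have "q v * cis (\<theta> v) = \<tau>"
      proof -
        have "q v * cis (\<theta> v) = (cnj (cis (\<theta> v)) * cis (\<theta> v)) * \<tau>" by (simp only: q_def mult_ac)
        also have "cnj (cis (\<theta> v)) * cis (\<theta> v) = 1" by (simp add: cis_cnj cis_mult)
        finally show ?thesis by simp
      qed
      ultimately show ?thesis by (simp add: velocity_def r rv s1_def left_diff_distrib)
    qed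
    have "edge_form Some \<theta> ?\<rho> \<phi>' s' u v = c {u, v}" if uv: "{u, v} \<in> F" for u v
    proof -
      have "edge_form Some \<theta> ?\<rho> \<phi>' s' u v = edge_form \<kappa> \<theta> \<rho> \<phi> s u v"
        unfolding edge_form_complex using simple_graph_edge[OF F uv] by (simp add: vel position_def r)
      then show ?thesis using \<phi>s uv by simp
    qed
    moreover have "s' a = 0" "s' b = 0" using \<tau> by (simp_all add: s'_def q_def)
    ultimately show "\<exists>\<phi> s. (\<forall>u v. {u, v} \<in> F \<longrightarrow> edge_form Some \<theta> ?\<rho> \<phi> s u v = c {u, v}) \<and>
        (\<forall>v\<in>\<Union> F. \<forall>c. Some v = Some c \<longrightarrow> c \<notin> \<Union> F - {a, b} \<longrightarrow> s c = 0)"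
      by (intro exI[of _ \<phi>'] exI[of _ s'] conjI) auto
  qed
  moreover have "card {a, b} = 2" "{a, b} \<subseteq> \<Union> F" using ab abV(3) by auto
  then have "card (\<Union> F - {a, b}) + 2 = card (\<Union> F)"
    using card_Diff_subset[of "{a, b}" "\<Union> F"] card_mono[OF fin, of "{a, b}"] by simp
  ultimately show ?thesis by linarith
qed

text \<open>The cross product is a polynomial, and it is nonzero at the position with all radii 1, a
  at (1, 0) and all other vertices at (0, 1).\<close>

lemma generic_not_collinear:
  fixes p :: "'v \<Rightarrow> real ^ 2"
  assumes gen: "generic V C \<kappa> r p" and "a \<in> V" "b \<in> V" "a \<noteq> b"
  shows "p a $ 1 * p b $ 2 - p a $ 2 * p b $ 1 \<noteq> 0"
proof -
  let ?x = "\<lambda>v i. poly_var (Inl (v, i)) :: ('v, 2, 'c) var mpoly_rat"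
  let ?P = "?x a 1 * ?x b 2 - ?x a 2 * ?x b 1"
  define p0 :: "'v \<Rightarrow> real ^ 2" where "p0 v = (if v = a then vector [1, 0] else vector [0, 1])" for v
  have "poly_value (config p r) ?P \<noteq> 0"
  proof (rule generic_specialise[OF gen, where ?p0.0 = p0 and ?r0.0 = "\<lambda>_. 1"])
    show "?P \<in> poly_ring (coords V C)"
      using assms by (intro poly_ring_diff poly_ring_mult poly_ring_var) (auto simp: coords_def)
    show "p0 v \<bullet> p0 v = (case \<kappa> v of None \<Rightarrow> 1 | Some c \<Rightarrow> (1::real)\<^sup>2)" for v
      by (simp add: p0_def inner_vec_def sum_2 split: option.split)
    show "poly_value (config p0 (\<lambda>_. 1)) ?P \<noteq> 0"
      using assms(4) by (simp add: poly_value_diff poly_value_mult config_def p0_def)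
  qed
  then show ?thesis by (simp add: poly_value_diff poly_value_mult config_def)
qed

text \<open>One inequality per argument of the minimum in (2), in additive form to avoid subtraction
  of naturals. For necessity of the second one, any edge of F will do: genericity keeps its ends
  from being collinear with the centre. The point z is the apex of the cone.\<close>

lemma generic_independent_iff:
  fixes p :: "'v \<Rightarrow> real ^ 2" and \<kappa> :: "'v \<Rightarrow> 'c option"
  assumes E: "simple_graph V E" and z: "z \<notin> V" and C: "finite C" "colouring V C \<kappa>"
    and fw: "framework V C \<kappa> r p" and gen: "generic V C \<kappa> r p"
  shows "independent_framework V E C \<kappa> p \<longleftrightarrow> (\<forall>F. F \<subseteq> E \<and> F \<noteq> {} \<longrightarrow>
    card F + card (graph_components V F) \<le> card V + card (edge_colours C \<kappa> F) \<and>
    card F + card (graph_components V F) + 2 \<le> card V + card (edge_verts F))"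
proof
  have V: "finite V" using E by (simp add: simple_graph_def)
  have col: "\<kappa> ` V \<subseteq> insert None (Some ` C)" using C(2) by (simp add: colouring_def)
  {
    assume ind: "independent_framework V E C \<kappa> p"
    define \<theta> where "\<theta> v = Arg (vec_complex (p v))" for v
    have solv: "solvable E \<kappa> \<theta> r"
      unfolding \<theta>_def by (rule independent_framework_imp_solvable[OF E C fw ind])
    have rad: "norm (p v) = radius \<kappa> r v" "radius \<kappa> r v > 0" if "v \<in> V" for v
    proof -
      have "\<kappa> v \<in> insert None (Some ` C)" using col that by blast
      then show "norm (p v) = radius \<kappa> r v" "radius \<kappa> r v > 0"
        using fw that by (auto simp: framework_def radius_def)
    qed
    show "\<forall>F. F \<subseteq> E \<and> F \<noteq> {} \<longrightarrow>
      card F + card (graph_components V F) \<le> card V + card (edge_colours C \<kappa> F) \<and>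
      card F + card (graph_components V F) + 2 \<le> card V + card (edge_verts F)"
    proof (intro allI impI)
      fix F assume F: "F \<subseteq> E \<and> F \<noteq> {}"
      have sF: "simple_graph V F" using E F by (auto simp: simple_graph_def)
      have solvF: "solvable F \<kappa> \<theta> r" using solvable_subset[OF solv] F by blast
      obtain e where "e \<in> F" using F by blast
      then obtain a b where ab: "{a, b} \<in> F" using simple_graph_edgeE[OF sF] by metis
      note abV = simple_graph_edge[OF sF ab]
      have pos: "vec_complex (p v) = position \<kappa> \<theta> r v" if "v \<in> V" for v
        using rcis_cmod_Arg[of "vec_complex (p v)"] rad(1)[OF that]
        by (simp add: position_def \<theta>_def rcis_def norm_vec_complex)
      have "Im (cnj (position \<kappa> \<theta> r a) * position \<kappa> \<theta> r b) = p a $ 1 * p b $ 2 - p a $ 2 * p b $ 1"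
        unfolding pos[OF abV(1), symmetric] pos[OF abV(2), symmetric] by (simp add: vec_complex_def)
      then have "sin (\<theta> b - \<theta> a) \<noteq> 0"
        using generic_not_collinear[OF gen abV] unfolding cross_position by auto
      then have "card F + card (graph_components V F) + 2 \<le> card V + card (edge_verts F)"
        unfolding edge_verts_def using rad(2)
        by (intro solvable_card_le_plane[OF sF ab solvF]) (auto simp: less_le)
      with solvable_card_le_colours[OF sF C(1) col solvF]
      show "card F + card (graph_components V F) \<le> card V + card (edge_colours C \<kappa> F) \<and>
        card F + card (graph_components V F) + 2 \<le> card V + card (edge_verts F)" by blast
    qed
  }
  assume *: "\<forall>F. F \<subseteq> E \<and> F \<noteq> {} \<longrightarrow>
    card F + card (graph_components V F) \<le> card V + card (edge_colours C \<kappa> F) \<and>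
    card F + card (graph_components V F) + 2 \<le> card V + card (edge_verts F)"
  \<comment> \<open>The exchange starts from all coloured vertices; on V(F) they show exactly the
    colours counted by k(F).\<close>
  define D0 where "D0 = {v\<in>V. \<kappa> v \<noteq> None}"
  have "card F + card (graph_components V F) \<le> card V + card (\<kappa> ` (D0 \<inter> \<Union> F))" if F: "F \<subseteq> E" for F
  proof (cases "F = {}")
    case True
    then show ?thesis using card_graph_components_le[OF V, of F] by simp
  next
    case False
    have "Some ` edge_colours C \<kappa> F \<subseteq> \<kappa> ` (D0 \<inter> \<Union> F)"
    proof
      fix y assume "y \<in> Some ` edge_colours C \<kappa> F"
      then obtain c v where cv: "y = Some c" "v \<in> \<Union> F" "\<kappa> v = Some c"
        by (auto simp: edge_colours_def edge_verts_def)
      then have "v \<in> D0 \<inter> \<Union> F" using F E by (auto simp: D0_def simple_graph_def)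
      then show "y \<in> \<kappa> ` (D0 \<inter> \<Union> F)" unfolding cv(1) cv(3)[symmetric] by (rule imageI)
    qed
    moreover have "finite (\<kappa> ` (D0 \<inter> \<Union> F))" using V by (simp add: D0_def)
    ultimately have "card (Some ` edge_colours C \<kappa> F) \<le> card (\<kappa> ` (D0 \<inter> \<Union> F))" by (rule card_mono[rotated])
    then have "card (edge_colours C \<kappa> F) \<le> card (\<kappa> ` (D0 \<inter> \<Union> F))" by (simp add: card_image)
    moreover have "card F + card (graph_components V F) \<le> card V + card (edge_colours C \<kappa> F)"
      using * F False by blast
    ultimately show ?thesis by linarith
  qed
  from colour_transversal[OF E _ this] V obtain D where D: "D \<subseteq> D0" "inj_on \<kappa> D"
    "\<forall>F\<subseteq>E. card F + card (graph_components V F) \<le> card V + card (D \<inter> \<Union> F)"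
    by (auto simp: D0_def)
  have "laman_sparse (insert z V) (E \<union> cone_edges z (V - D))"
  proof (rule laman_sparse_cone[OF E z])
    fix F assume F: "F \<subseteq> E"
    show "card F + card (graph_components V F) \<le> card V + card (D \<inter> \<Union> F)" using D(3) F by blast
    assume "F \<noteq> {}"
    have "simple_graph V F" using E F by (auto simp: simple_graph_def)
    from card_graph_components_ge[OF this \<open>F \<noteq> {}\<close>]
    have "card V + 1 \<le> card (graph_components V F) + card (\<Union> F)" .
    moreover have "card F + card (graph_components V F) + 2 \<le> card V + card (\<Union> F)"
      using * F \<open>F \<noteq> {}\<close> unfolding edge_verts_def by blast
    ultimately show "card F + 3 \<le> 2 * card (\<Union> F)" by linarith
  qed
  moreover have "D \<subseteq> V" "None \<notin> \<kappa> ` D" using D(1) by (auto simp: D0_def)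
  ultimately obtain \<theta>0 \<rho>0 where solv0: "solvable E \<kappa> \<theta>0 \<rho>0"
    using exists_solvable[OF E z _ D(2)] by blast
  \<comment> \<open>Nothing so far excludes vanishing radii, so the position is moved close to one
    with all radii 1.\<close>
  have "\<exists>\<theta> \<rho>. solvable E \<kappa> \<theta> \<rho> \<and> (\<forall>v\<in>V. radius \<kappa> \<rho> v \<noteq> 0)"
  proof (rule solvable_near[OF E solv0])
    fix \<theta> :: "real \<Rightarrow> 'v \<Rightarrow> real" and \<rho> :: "real \<Rightarrow> 'c \<Rightarrow> real"
    assume \<rho>: "\<And>c. ((\<lambda>t. \<rho> t c) \<longlongrightarrow> 1) (at 0)"
    have "\<forall>\<^sub>F t in at 0. radius \<kappa> (\<rho> t) v \<noteq> 0" for v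
      by (rule tendsto_imp_eventually_ne[OF tendsto_radius[OF \<rho>]]) (simp add: radius_def split: option.split)
    then show "\<forall>\<^sub>F t in at 0. \<forall>v\<in>V. radius \<kappa> (\<rho> t) v \<noteq> 0"
      using V by (simp add: eventually_ball_finite)
  qed
  then obtain \<theta> \<rho> where solv: "solvable E \<kappa> \<theta> \<rho>" and nz: "\<And>v. v \<in> V \<Longrightarrow> radius \<kappa> \<rho> v \<noteq> 0" by blast
  show "independent_framework V E C \<kappa> p"
  proof (rule generic_independent[OF E C(1) gen])
    show "independent_framework V E C \<kappa> (\<lambda>v. complex_vec (position \<kappa> \<theta> \<rho> v))"
      by (rule solvable_imp_independent_framework[OF E C solv nz])
    fix v
    have "complex_vec (position \<kappa> \<theta> \<rho> v) \<bullet> complex_vec (position \<kappa> \<theta> \<rho> v) = (cmod (position \<kappa> \<theta> \<rho> v))\<^sup>2"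
      unfolding inner_vec_complex complex_vec_inverse by (simp add: cmod_power2 flip: power2_eq_square)
    also have "\<dots> = (radius \<kappa> \<rho> v)\<^sup>2" by (simp add: position_def norm_mult)
    finally show "complex_vec (position \<kappa> \<theta> \<rho> v) \<bullet> complex_vec (position \<kappa> \<theta> \<rho> v) =
        (case \<kappa> v of None \<Rightarrow> 1 | Some c \<Rightarrow> (\<rho> c)\<^sup>2)"
      by (simp add: radius_def split: option.split)
  qed
qed

lemma matrix_rank_independent:
  assumes "rows_independent I J A"
  shows "matrix_rank I J A = card I"
  unfolding matrix_rank_def
  using assms fun_space.dim_eq_card_independent card_image unfolding rows_independent_def by metis

theorem theorem4p4:
  fixes n k :: nat
    and V :: "nat set" and E :: "nat set set"
    and C :: "'c set" and \<kappa> :: "nat \<Rightarrow> 'c option"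
    and r :: "'c \<Rightarrow> real" and p :: "nat \<Rightarrow> real ^ 2"
  assumes "V = {1..n}"
    and "k_coloured_graph k V E C \<kappa>"
    and "framework V C \<kappa> r p"
    and "generic V C \<kappa> r p"
  shows "isostatic V E C \<kappa> p \<longleftrightarrow>
    int (card E) = int (card V) - 1 + min (int k) (int (card V) - 2) \<and>
    (\<forall>F. F \<subseteq> E \<and> F \<noteq> {} \<longrightarrow>
      int (card F) \<le> int (card V) - int (card (graph_components V F)) +
        min (int (card (edge_colours C \<kappa> F))) (int (card (edge_verts F)) - 2))"
proof -
  have E: "simple_graph V E" and C: "finite C" "colouring V C \<kappa>" and k: "card C = k"
    using assms(2) by (auto simp: k_coloured_graph_def)
  have V: "finite V" using E by (simp add: simple_graph_def)
  have finE: "finite E" using simple_graph_finite_edges[OF E] .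
  have "card (rigidity_rows V E) = card E + card V"
    unfolding rigidity_rows_def using V finE
    by (subst card_Un_disjoint) (auto simp: card_image)
  then have rank: "matrix_rank (rigidity_rows V E) (coords V C) (rigidity_matrix \<kappa> p) = card E + card V"
    if "independent_framework V E C \<kappa> p"
    using matrix_rank_independent that unfolding independent_framework_def by metis
  \<comment> \<open>Independence makes the rank |E| + |V|, and equating it with 2|V| - 1 + min(k,
    |V| - 2) is exactly (1).\<close>
  have "isostatic V E C \<kappa> p \<longleftrightarrow>
      int (card E) = int (card V) - 1 + min (int k) (int (card V) - 2) \<and> independent_framework V E C \<kappa> p"
    unfolding isostatic_def infinitesimally_rigid_def by (auto simp: rank k choose_two)
  also have "independent_framework V E C \<kappa> p \<longleftrightarrow> (\<forall>F. F \<subseteq> E \<and> F \<noteq> {} \<longrightarrow>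
      int (card F) \<le> int (card V) - int (card (graph_components V F)) +
        min (int (card (edge_colours C \<kappa> F))) (int (card (edge_verts F)) - 2))"
  proof -
    have iff: "card F + g \<le> card V + l \<and> card F + g + 2 \<le> card V + m \<longleftrightarrow>
        int (card F) \<le> int (card V) - int g + min (int l) (int m - 2)" for F :: "nat set set" and g l m
      by linarith
    \<comment> \<open>The number 0 serves as the apex of the cone.\<close>
    have "0 \<notin> V" using assms(1) by simp
    from generic_independent_iff[OF E this C assms(3,4)] show ?thesis unfolding iff .
  qed
  finally show ?thesis .
qed

end
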